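(* Let $d,t\in\mathbb N$ with $d\ge 2$. Then there is a constant $C_{d,t}>0$ such that the following holds. If an LCL $\Pi=(\Sigma_{in},\Sigma_{out},t,\mathcal P)$ on $\mathbb{Z}^d$ can be solved by a uniform local algorithm $\mathcal A$ for which there is $\varepsilon_0>0$ such that $$\mathrm P\left(R_{\mathcal A}>C_{d,t}\,\sqrt[d-1]{1/\varepsilon}\right)<\varepsilon$$ for every $0<\varepsilon\le\varepsilon_0$, then $\Pi\in\mathsf{ULOCAL}(O(\log^* 1/\varepsilon))$. Analogously, for $d=1$ we have $\mathsf{ffiid}=\mathsf{ULOCAL}(O(\log^* 1/\varepsilon))$, i.e. every LCL on $\mathbb{Z}$ that is solved by some uniform local algorithm is in $\mathsf{ULOCAL}(O(\log^* 1/\varepsilon))$.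
   Context: Grid and LCLs. $\mathbb{Z}^d$ denotes the infinite grid: the Cayley graph of the group $\mathbb{Z}^d$ with respect to the standard generators, each edge being oriented and labelled by its generator (isomorphisms preserve this structure). $\mathcal B(v,r)$ is the ball of radius $r$ around $v$ in graph distance. A locally checkable problem (LCL) on $\mathbb{Z}^d$ is $\Pi=(\Sigma_{in},\Sigma_{out},t,\mathcal P)$, where $\Sigma_{in},\Sigma_{out}$ are finite sets, $t\in\mathbb N$, and $\mathcal P$ is a set of (isomorphism types of) rooted grids of radius $t$ with each vertex labelled by one label of $\Sigma_{in}$ and one of $\Sigma_{out}$. A labelling of the vertices of a graph by $\Sigma_{in}\times\Sigma_{out}$ is a $\Pi$-coloring if the $t$-hop neighborhood of every vertex is in $\mathcal P$. Uniform local algorithms. A uniform local algorithm is a pair $\mathcal A=(\mathcal C,f)$, where $\mathcal C$ is a collection of rooted finite-radius neighborhoods in $\mathbb{Z}^d$ with vertices labelled by $\Sigma_{in}$ and by reals in $[0,1]$, and $f:\mathcal C\to\Sigma_{out}$ is measurable. It is run on $\Sigma_{in}$-labelled $\mathbb{Z}^d$ whose vertices carry independent uniform labels from $[0,1]$: each vertex explores balls of radius $0,1,2,\dots$ around itself until the labelled ball lies in $\mathcal C$, and then outputs the value of $f$. The coding radius $R_{\mathcal A}$ is the minimal radius needed; $\mathrm P(R_{\mathcal A}>r)$ denotes the supremum over all $\Sigma_{in}$-labellings of $\mathcal B(v,r)$ of the probability that $v$ has to look further than $r$. $\mathcal A$ solves $\Pi$ if for every $\Sigma_{in}$-labelling it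 produces a $\Pi$-coloring with probability $1$. $\mathcal A$ has uniform complexity $t(\varepsilon)$ if $\mathrm P(R_{\mathcal A}>t(\varepsilon))\le\varepsilon$ for all sufficiently small $\varepsilon>0$. $\mathsf{ULOCAL}(t(\varepsilon))$ is the class of LCLs solved by a uniform local algorithm of uniform complexity $t(\varepsilon)$; $\mathsf{ULOCAL}(O(g))$ means complexity $Cg(\varepsilon)$ for some constant $C$. $\mathsf{ffiid}=\bigcup_{t}\mathsf{ULOCAL}(t(\varepsilon))$, the union over all functions $t$. $\log^* x$ is the number of times $\log_2$ must be iterated, starting from $x$, to reach a value at most $1$. *)

theory Defs
  imports "HOL-Probability.Probability" "HOL-Library.Function_Algebras"
begin

section \<open>The grid\<close>

text \<open>
  A vertex of the d-dimensional grid is an integer function that vanishes at all indices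
  \<open>\<ge> d\<close>. Functions carry the pointwise group structure, so that translations are written with
  the ordinary \<open>+\<close> and the origin is \<open>0\<close>.
\<close>

type_synonym vertex = "nat \<Rightarrow> int"

definition grid :: "nat \<Rightarrow> vertex set" where
  "grid d = {v. \<forall>i\<ge>d. v i = 0}"

definition gen :: "nat \<Rightarrow> vertex" where
  "gen i = 0(i := 1)"

definition grid_edge :: "nat \<Rightarrow> nat \<Rightarrow> vertex \<Rightarrow> vertex \<Rightarrow> bool" where
  "grid_edge d i v w \<longleftrightarrow> v \<in> grid d \<and> i < d \<and> w = v + gen i"

definition adjacent :: "nat \<Rightarrow> (vertex \<times> vertex) set" where
  "adjacent d = {(v, w). \<exists>i. grid_edge d i v w \<or> grid_edge d i w v}"

definition gdist :: "nat \<Rightarrow> vertex \<Rightarrow> vertex \<Rightarrow> nat" where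
  "gdist d v w = (LEAST n. (v, w) \<in> adjacent d ^^ n)"

definition gball :: "nat \<Rightarrow> vertex \<Rightarrow> nat \<Rightarrow> vertex set" where
  "gball d v r = {w \<in> grid d. gdist d v w \<le> r}"

lemma grid_zero [simp]: "0 \<in> grid d"
  by (simp add: grid_def)

lemma grid_add: "v \<in> grid d \<Longrightarrow> w \<in> grid d \<Longrightarrow> v + w \<in> grid d"
  by (simp add: grid_def)

lemma gen_in_grid: "i < d \<Longrightarrow> gen i \<in> grid d"
  by (simp add: grid_def gen_def)

lemma adjacent_cases:
  assumes "(v, w) \<in> adjacent d"
  obtains i where "i < d" "v \<in> grid d" "w \<in> grid d" "w = v + gen i \<or> w = v - gen i"
proof -
  obtain i where "grid_edge d i v w \<or> grid_edge d i w v"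
    using assms by (auto simp: adjacent_def)
  then show thesis
    using that[of i] gen_in_grid[of i d] grid_add[of _ d "gen i"]
    by (auto simp: grid_edge_def)
qed

lemma adjacent_walk_bound:
  assumes "(v, w) \<in> adjacent d ^^ n" "v \<in> grid d"
  shows "w \<in> grid d \<and> (\<Sum>i<d. \<bar>w i - v i\<bar>) \<le> int n"
  using assms(1)
proof (induction n arbitrary: w)
  case 0
  then show ?case using assms(2) by simp
next
  case (Suc n)
  then obtain u where u: "(v, u) \<in> adjacent d ^^ n" "(u, w) \<in> adjacent d"
    by auto
  then obtain i where i: "i < d" "w \<in> grid d" "w = u + gen i \<or> w = u - gen i"
    by (elim adjacent_cases) blast
  have "(\<Sum>j<d. \<bar>w j - v j\<bar>) \<le> (\<Sum>j<d. \<bar>u j - v j\<bar> + (if j = i then 1 else 0))"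
    using i(3) by (intro sum_mono) (auto simp: gen_def)
  also have "\<dots> = (\<Sum>j<d. \<bar>u j - v j\<bar>) + 1"
    using i(1) by (simp add: sum.distrib)
  finally show ?case using Suc.IH[OF u(1)] i(2) by simp
qed

lemma adjacent_walk_exists:
  assumes "v \<in> grid d" "w \<in> grid d" "(\<Sum>i<d. \<bar>w i - v i\<bar>) = int n"
  shows "(v, w) \<in> adjacent d ^^ n"
  using assms(2,3)
proof (induction n arbitrary: w)
  case 0
  then have "\<forall>i<d. w i = v i"
    by (auto simp: sum_nonneg_eq_0_iff)
  then have "w = v" using 0 assms(1)
    by (auto simp: grid_def fun_eq_iff not_less) (metis not_less)
  then show ?case by simp
next
  case (Suc n)
  have "\<exists>i<d. w i \<noteq> v i"
  proof (rule ccontr)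
    assume "\<not> ?thesis"
    then have "(\<Sum>i<d. \<bar>w i - v i\<bar>) = 0" by (intro sum.neutral) auto
    then show False using Suc.prems by simp
  qed
  then obtain i where i: "i < d" "w i \<noteq> v i" by blast
  define u where "u = (if w i > v i then w - gen i else w + gen i)"
  have u: "u \<in> grid d" using Suc.prems(1) i(1) by (auto simp: u_def grid_def gen_def)
  have "(\<Sum>j<d. \<bar>w j - v j\<bar>) = (\<Sum>j<d. \<bar>u j - v j\<bar> + (if j = i then 1 else 0))"
    using i(2) by (intro sum.cong) (auto simp: u_def gen_def)
  also have "\<dots> = (\<Sum>j<d. \<bar>u j - v j\<bar>) + 1"
    using i(1) by (simp add: sum.distrib)
  finally have "(v, u) \<in> adjacent d ^^ n"
    using Suc.prems u by (intro Suc.IH) auto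
  moreover have "(u, w) \<in> adjacent d"
    using u i(1) Suc.prems(1) by (auto simp: adjacent_def grid_edge_def u_def)
  ultimately show ?case by auto
qed

lemma gdist_eq:
  assumes "v \<in> grid d" "w \<in> grid d"
  shows "int (gdist d v w) = (\<Sum>i<d. \<bar>w i - v i\<bar>)"
proof -
  define n where "n = nat (\<Sum>i<d. \<bar>w i - v i\<bar>)"
  have n: "int n = (\<Sum>i<d. \<bar>w i - v i\<bar>)" by (simp add: n_def sum_nonneg)
  have "gdist d v w = n" unfolding gdist_def
  proof (rule Least_equality)
    show "(v, w) \<in> adjacent d ^^ n" using assms n by (intro adjacent_walk_exists) auto
    show "n \<le> m" if "(v, w) \<in> adjacent d ^^ m" for m
      using adjacent_walk_bound[OF that assms(1)] n by linarith
  qed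
  then show ?thesis using n by simp
qed

lemma gball_translate:
  assumes "v \<in> grid d"
  shows "v + u \<in> gball d v r \<longleftrightarrow> u \<in> gball d 0 r"
proof -
  have "v + u \<in> grid d \<longleftrightarrow> u \<in> grid d"
    using assms by (auto simp: grid_def)
  then show ?thesis
    using gdist_eq[of v d "v + u"] gdist_eq[of 0 d u] assms by (auto simp: gball_def)
qed

text \<open>
  Isomorphisms of rooted balls that preserve the oriented and labelled edges are translations.
  Hence every isomorphism type of labelled rooted balls of radius \<open>r\<close> has exactly one
  representative on the ball around the origin.
\<close>

lemma rooted_ball_iso_is_translation:
  assumes v: "v \<in> grid d" and root: "\<phi> v = w"
    and edges: "\<And>i x y. x \<in> gball d v r \<Longrightarrow> y \<in> gball d v r \<Longrightarrow>
                  grid_edge d i x y \<Longrightarrow> grid_edge d i (\<phi> x) (\<phi> y)"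
    and u: "v + u \<in> gball d v r"
  shows "\<phi> (v + u) = w + u"
proof -
  have "\<phi> x = w + (x - v)" if "(v, x) \<in> adjacent d ^^ n" "n \<le> r" for n x
    using that
  proof (induction n arbitrary: x)
    case 0
    then have "x = v" by simp
    then show ?case using root by simp
  next
    case (Suc n)
    then obtain y where y: "(v, y) \<in> adjacent d ^^ n" "(y, x) \<in> adjacent d" by auto
    have yb: "y \<in> gball d v r" and xb: "x \<in> gball d v r"
      using adjacent_walk_bound[OF y(1) v] adjacent_walk_bound[OF Suc.prems(1) v]
        Suc.prems(2) gdist_eq[OF v, of y] gdist_eq[OF v, of x] by (auto simp: gball_def)
    have IH: "\<phi> y = w + (y - v)"
      by (rule Suc.IH[OF y(1)]) (use Suc.prems(2) in linarith)
    obtain i where "grid_edge d i y x \<or> grid_edge d i x y"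
      using y(2) by (auto simp: adjacent_def)
    then show ?case
    proof
      assume e: "grid_edge d i y x"
      have *: "\<phi> x = \<phi> y + gen i" "x = y + gen i"
        using edges[OF yb xb e] e by (auto simp only: grid_edge_def)
      have "\<phi> x j = (w + (x - v)) j" for j
        using fun_cong[OF IH, of j] fun_cong[OF *(1), of j] fun_cong[OF *(2), of j] by simp
      then show ?thesis by (rule ext)
    next
      assume e: "grid_edge d i x y"
      have *: "\<phi> y = \<phi> x + gen i" "y = x + gen i"
        using edges[OF xb yb e] e by (auto simp only: grid_edge_def)
      have "\<phi> x j = (w + (x - v)) j" for j
        using fun_cong[OF IH, of j] fun_cong[OF *(1), of j] fun_cong[OF *(2), of j] by simp
      then show ?thesis by (rule ext)
    qed
  qed
  moreover have "(v, v + u) \<in> adjacent d ^^ gdist d v (v + u)"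
    using u gdist_eq[OF v, of "v + u"] by (intro adjacent_walk_exists[OF v]) (auto simp: gball_def)
  moreover have "gdist d v (v + u) \<le> r" using u by (simp add: gball_def)
  ultimately show ?thesis by fastforce
qed

section \<open>Locally checkable problems\<close>

text \<open>
  Label sets are finite sets of natural numbers. A single label type is used because
  the constant in the theorem must not depend on the label sets.
\<close>

record lcl =
  in_labels :: "nat set"
  out_labels :: "nat set"
  radius :: nat
  allowed :: "(vertex \<Rightarrow> nat \<times> nat) set"

definition is_lcl :: "nat \<Rightarrow> lcl \<Rightarrow> bool" where
  "is_lcl d L \<longleftrightarrow> finite (in_labels L) \<and> finite (out_labels L) \<and>
     allowed L \<subseteq> gball d 0 (radius L) \<rightarrow>\<^sub>E in_labels L \<times> out_labels L"

text \<open>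
  The labelled ball around \<open>v\<close>, moved to the origin, i.e. the representative of its
  isomorphism type.
\<close>

definition nbhd :: "nat \<Rightarrow> (vertex \<Rightarrow> 'a) \<Rightarrow> vertex \<Rightarrow> nat \<Rightarrow> vertex \<Rightarrow> 'a" where
  "nbhd d l v r = (\<lambda>u\<in>gball d 0 r. l (v + u))"

definition is_coloring :: "nat \<Rightarrow> lcl \<Rightarrow> (vertex \<Rightarrow> nat \<times> nat) \<Rightarrow> bool" where
  "is_coloring d L l \<longleftrightarrow> (\<forall>v\<in>grid d. nbhd d l v (radius L) \<in> allowed L)"

section \<open>Uniform local algorithms\<close>

definition unit_labels :: "real measure" where
  "unit_labels = restrict_space lborel {0..1}"

definition random_labels :: "nat \<Rightarrow> (vertex \<Rightarrow> real) measure" where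
  "random_labels d = PiM (grid d) (\<lambda>_. unit_labels)"

text \<open>A labelled rooted neighborhood: its radius, its input labels and its real labels.\<close>

type_synonym labelled_ball = "nat \<times> (vertex \<Rightarrow> nat) \<times> (vertex \<Rightarrow> real)"

record uniform_alg =
  stops :: "labelled_ball set"
  result :: "labelled_ball \<Rightarrow> nat"

definition is_uniform_alg :: "nat \<Rightarrow> nat set \<Rightarrow> nat set \<Rightarrow> uniform_alg \<Rightarrow> bool" where
  "is_uniform_alg d Sin Sout A \<longleftrightarrow>
     (\<forall>(r, \<sigma>, x) \<in> stops A.
        \<sigma> \<in> gball d 0 r \<rightarrow>\<^sub>E Sin \<and> x \<in> gball d 0 r \<rightarrow>\<^sub>E {0..1}) \<and>
     (\<forall>r. \<forall>\<sigma> \<in> gball d 0 r \<rightarrow>\<^sub>E Sin.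
        {x. (r, \<sigma>, x) \<in> stops A} \<in> sets (PiM (gball d 0 r) (\<lambda>_. unit_labels)) \<and>
        (\<lambda>x. result A (r, \<sigma>, x)) \<in>
          restrict_space (PiM (gball d 0 r) (\<lambda>_. unit_labels)) {x. (r, \<sigma>, x) \<in> stops A}
            \<rightarrow>\<^sub>M count_space Sout)"

definition explored ::
    "nat \<Rightarrow> (vertex \<Rightarrow> nat) \<Rightarrow> (vertex \<Rightarrow> real) \<Rightarrow> vertex \<Rightarrow> nat \<Rightarrow> labelled_ball" where
  "explored d \<sigma> x v r = (r, nbhd d \<sigma> v r, nbhd d x v r)"

definition coding_radius ::
    "nat \<Rightarrow> uniform_alg \<Rightarrow> (vertex \<Rightarrow> nat) \<Rightarrow> (vertex \<Rightarrow> real) \<Rightarrow> vertex \<Rightarrow> enat" where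
  "coding_radius d A \<sigma> x v = (INF r \<in> {r. explored d \<sigma> x v r \<in> stops A}. enat r)"

lemma coding_radius_gt_iff:
  "ereal_of_enat (coding_radius d A \<sigma> x v) > ereal r \<longleftrightarrow>
     (\<forall>s. real s \<le> r \<longrightarrow> explored d \<sigma> x v s \<notin> stops A)"
proof (cases "\<exists>s. explored d \<sigma> x v s \<in> stops A")
  case False
  then show ?thesis by (simp add: coding_radius_def top_enat_def)
next
  case True
  define n where "n = (LEAST s. explored d \<sigma> x v s \<in> stops A)"
  have n: "explored d \<sigma> x v n \<in> stops A" and le: "\<And>s. explored d \<sigma> x v s \<in> stops A \<Longrightarrow> n \<le> s"
    using True unfolding n_def by (auto intro: LeastI_ex Least_le)
  have "coding_radius d A \<sigma> x v = enat n" unfolding coding_radius_def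
    by (rule INF_eqI) (use n le in auto)
  then have "ereal_of_enat (coding_radius d A \<sigma> x v) > ereal r \<longleftrightarrow> r < real n" by simp
  also have "\<dots> \<longleftrightarrow> (\<forall>s. real s \<le> r \<longrightarrow> explored d \<sigma> x v s \<notin> stops A)"
  proof
    assume "r < real n"
    then show "\<forall>s. real s \<le> r \<longrightarrow> explored d \<sigma> x v s \<notin> stops A"
      using le by fastforce
  next
    assume "\<forall>s. real s \<le> r \<longrightarrow> explored d \<sigma> x v s \<notin> stops A"
    then show "r < real n" using n not_le by blast
  qed
  finally show ?thesis .
qed

lemma measurable_nbhd:
  assumes "v \<in> grid d"
  shows "(\<lambda>x. nbhd d x v r) \<in> random_labels d \<rightarrow>\<^sub>M PiM (gball d 0 r) (\<lambda>_. unit_labels)"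
  unfolding nbhd_def random_labels_def
  by (intro measurable_restrict measurable_component_singleton)
     (use assms grid_add in \<open>auto simp: gball_def\<close>)

lemma coding_radius_gt_measurable:
  assumes "is_uniform_alg d Sin Sout A" "v \<in> grid d"
    and \<sigma>: "\<And>u. u \<in> gball d 0 (nat \<lfloor>r\<rfloor>) \<Longrightarrow> \<sigma> (v + u) \<in> Sin"
  shows "{x \<in> space (random_labels d). ereal_of_enat (coding_radius d A \<sigma> x v) > ereal r}
           \<in> sets (random_labels d)"
proof -
  have stage: "{x \<in> space (random_labels d). explored d \<sigma> x v s \<notin> stops A}
                 \<in> sets (random_labels d)"
    if s: "real s \<le> r" for s
  proof -
    have "nbhd d \<sigma> v s \<in> gball d 0 s \<rightarrow>\<^sub>E Sin"
    proof -
      have "s \<le> nat \<lfloor>r\<rfloor>" using s by (rule le_nat_floor)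
      then have "gball d 0 s \<subseteq> gball d 0 (nat \<lfloor>r\<rfloor>)" by (auto simp: gball_def)
      then show ?thesis using \<sigma> by (auto simp: nbhd_def)
    qed
    then have "{y. (s, nbhd d \<sigma> v s, y) \<in> stops A} \<in> sets (PiM (gball d 0 s) (\<lambda>_. unit_labels))"
      using assms(1) by (simp add: is_uniform_alg_def)
    from measurable_sets[OF measurable_nbhd[OF assms(2)] this]
    have "(\<lambda>x. nbhd d x v s) -` {y. (s, nbhd d \<sigma> v s, y) \<in> stops A} \<inter> space (random_labels d)
            \<in> sets (random_labels d)" .
    from sets.compl_sets[OF this]
    have "space (random_labels d) -
            ((\<lambda>x. nbhd d x v s) -` {y. (s, nbhd d \<sigma> v s, y) \<in> stops A} \<inter> space (random_labels d))
            \<in> sets (random_labels d)" .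
    also have "space (random_labels d) -
            ((\<lambda>x. nbhd d x v s) -` {y. (s, nbhd d \<sigma> v s, y) \<in> stops A} \<inter> space (random_labels d))
            = {x \<in> space (random_labels d). explored d \<sigma> x v s \<notin> stops A}"
      unfolding explored_def by blast
    finally show ?thesis .
  qed
  have "{x \<in> space (random_labels d). real s \<le> r \<longrightarrow> explored d \<sigma> x v s \<notin> stops A}
               \<in> sets (random_labels d)" for s
  proof (cases "real s \<le> r")
    case True
    then show ?thesis using stage[OF True] by (simp only: simp_thms)
  next
    case False
    then have "{x \<in> space (random_labels d). real s \<le> r \<longrightarrow> explored d \<sigma> x v s \<notin> stops A}
                 = space (random_labels d)" by blast
    then show ?thesis by (simp only: sets.top)
  qed
  then have "{x \<in> space (random_labels d). \<forall>s. real s \<le> r \<longrightarrow> explored d \<sigma> x v s \<notin> stops A}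
               \<in> sets (random_labels d)"
    by (rule sets.sets_Collect_countable_All)
  then show ?thesis by (simp only: coding_radius_gt_iff)
qed

text \<open>The output is only meaningful where the coding radius is finite.\<close>

definition output_label ::
    "nat \<Rightarrow> uniform_alg \<Rightarrow> (vertex \<Rightarrow> nat) \<Rightarrow> (vertex \<Rightarrow> real) \<Rightarrow> vertex \<Rightarrow> nat" where
  "output_label d A \<sigma> x v = result A (explored d \<sigma> x v (the_enat (coding_radius d A \<sigma> x v)))"

text \<open>
  The supremum over the input labellings of the ball of radius \<open>r\<close> of the probability
  that the origin has to look further than \<open>r\<close>. By translation invariance the origin
  stands for any vertex. The labelling is arbitrary (\<open>undefined\<close>) outside the ball, but
  the event depends only on the labels within the ball.
\<close>

definition prob_radius_gt :: "nat \<Rightarrow> nat set \<Rightarrow> uniform_alg \<Rightarrow> real \<Rightarrow> ennreal" where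
  "prob_radius_gt d Sin A r =
     (SUP \<sigma> \<in> gball d 0 (nat \<lfloor>r\<rfloor>) \<rightarrow>\<^sub>E Sin.
        emeasure (random_labels d)
          {x \<in> space (random_labels d). ereal_of_enat (coding_radius d A \<sigma> x 0) > ereal r})"

definition solves :: "nat \<Rightarrow> uniform_alg \<Rightarrow> lcl \<Rightarrow> bool" where
  "solves d A L \<longleftrightarrow> is_uniform_alg d (in_labels L) (out_labels L) A \<and>
     (\<forall>\<sigma> \<in> grid d \<rightarrow> in_labels L. AE x in random_labels d.
        (\<forall>v\<in>grid d. coding_radius d A \<sigma> x v < \<infinity>) \<and>
        is_coloring d L (\<lambda>v. (\<sigma> v, output_label d A \<sigma> x v)))"

definition has_uniform_complexity :: "nat \<Rightarrow> nat set \<Rightarrow> uniform_alg \<Rightarrow> (real \<Rightarrow> real) \<Rightarrow> bool" where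
  "has_uniform_complexity d Sin A t \<longleftrightarrow>
     (\<exists>\<epsilon>0>0. \<forall>\<epsilon>. 0 < \<epsilon> \<and> \<epsilon> \<le> \<epsilon>0 \<longrightarrow> prob_radius_gt d Sin A (t \<epsilon>) \<le> ennreal \<epsilon>)"

definition ULOCAL :: "nat \<Rightarrow> (real \<Rightarrow> real) \<Rightarrow> lcl set" where
  "ULOCAL d t = {L. is_lcl d L \<and>
     (\<exists>A. solves d A L \<and> has_uniform_complexity d (in_labels L) A t)}"

definition ULOCAL_O :: "nat \<Rightarrow> (real \<Rightarrow> real) \<Rightarrow> lcl set" where
  "ULOCAL_O d g = (\<Union>C\<in>{0<..}. ULOCAL d (\<lambda>\<epsilon>. C * g \<epsilon>))"

definition ffiid :: "nat \<Rightarrow> lcl set" where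
  "ffiid d = (\<Union>t. ULOCAL d t)"

definition log_star :: "real \<Rightarrow> nat" where
  "log_star x = (LEAST n. (log 2 ^^ n) x \<le> 1)"

end

theory Submission
  imports Defs
begin

text \<open>
  Random labels are first turned into a proper colouring of a power of the grid. The level of a
  vertex is the least \<open>j\<close> for which roughly \<open>tower j\<close> binary digits separate its label from those of
  its neighbours; it exceeds \<open>j\<close> with probability at most \<open>1 / tower (j + 1)\<close>. Within level \<open>j\<close>
  these digits form a proper colouring, which \<open>j\<close> Cole--Vishkin steps reduce to a constant palette.
  A greedy colouring in the order of (level, reduced colour) then only looks as far as \<open>O(level)\<close>.

  It remains to solve the problem by a rule of bounded radius from such a colouring. Choose an
  \<open>r\<close>-separated \<open>r\<close>-dense net. The vertices at distance between \<open>r\<close> and \<open>r + 2 t\<close> from some net point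
  form a skeleton that cuts the grid into bounded pieces which do not interact. Only \<open>O(r ^ (d - 1))\<close>
  skeleton vertices lie near a given net point, so by the assumption on the tail (for \<open>d = 1\<close>, by
  compactness) all of them finish within radius \<open>r\<close> with probability close to 1, and then almost
  surely their outputs extend to a colouring of the piece. The failure probability is
  below a constant depending only on \<open>d\<close> and \<open>t\<close>, hence one can fix the random labels around the net
  points deterministically, colour class by colour class, by the method of conditional
  expectations: every failure probability is touched a bounded number of times and stays below 1.
  The skeleton copies the given algorithm on these fixed labels, and the pieces are filled in by
  brute force.
\<close>

section \<open>Cubes and local rules\<close>

text \<open>The tail and the skeleton are matched in scale: if the tail at radius r is (C / r) ^ (d
  - 1), the expected number of late skeleton vertices near a net point is of order C ^ (d - 1),
  whatever r is. So one large radius is enough, and C only has to push this number below the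
  threshold. The obstacle is that r, and with it the number of colour classes, depends on the
  algorithm, while the threshold must not. A failure probability may grow by a constant factor in
  each round that touches it, so rounds are counted per net point: failure is decided by random
  labels within 4 r, a block reaches 4 r, hence only net points within 8 r interact, at most 16 ^ d
  by packing, and the total loss is (16 ^ d) ^ (16 ^ d). Colours are distinct up to distance 16 r so
  that no round touches a net point twice. Random labels are fixed, and not the outputs of each
  piece separately, because a skeleton vertex near several net points needs one output: that of the
  run on the common labels. Randomness then remains only in the colouring, at cost log*.\<close>

definition cube :: "nat \<Rightarrow> nat \<Rightarrow> vertex set" where
  "cube d k = {u \<in> grid d. \<forall>i. \<bar>u i\<bar> \<le> int k}"

lemma cube_grid: "u \<in> cube d k \<Longrightarrow> u \<in> grid d"
  by (simp add: cube_def)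

lemma zero_in_cube [simp]: "0 \<in> cube d k"
  by (simp add: cube_def)

lemma cube_uminus: "u \<in> cube d k \<Longrightarrow> - u \<in> cube d k"
  by (simp add: cube_def grid_def)

lemma cube_minus_commute: "u - v \<in> cube d k \<longleftrightarrow> v - u \<in> cube d k"
  using cube_uminus[of "u - v" d k] cube_uminus[of "v - u" d k] by auto

lemma cube_add: "u \<in> cube d a \<Longrightarrow> v \<in> cube d b \<Longrightarrow> u + v \<in> cube d (a + b)"
  unfolding cube_def grid_def
  by (auto intro!: order_trans[OF abs_triangle_ineq] add_mono)

lemma cube_mono: "a \<le> b \<Longrightarrow> cube d a \<subseteq> cube d b"
  by (auto simp: cube_def intro: order_trans)

lemma cube_in_mono: "u \<in> cube d a \<Longrightarrow> a \<le> b \<Longrightarrow> u \<in> cube d b"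
  using cube_mono by blast

lemma grid_diff: "v \<in> grid d \<Longrightarrow> w \<in> grid d \<Longrightarrow> v - w \<in> grid d"
  by (simp add: grid_def)

lemma bij_cube: "bij_betw (\<lambda>u. restrict u {..<d}) (cube d k) ({..<d} \<rightarrow>\<^sub>E {- int k..int k})"
proof (rule bij_betwI[where g = "\<lambda>f i. if i < d then f i else 0"])
  show "(\<lambda>u. restrict u {..<d}) \<in> cube d k \<rightarrow> {..<d} \<rightarrow>\<^sub>E {- int k..int k}"
    by (auto simp: cube_def abs_le_iff minus_le_iff)
  show "(\<lambda>f i. if i < d then f i else 0) \<in> ({..<d} \<rightarrow>\<^sub>E {- int k..int k}) \<rightarrow> cube d k"
    by (auto simp: cube_def grid_def PiE_iff abs_le_iff minus_le_iff)
qed (auto simp: cube_def grid_def fun_eq_iff PiE_iff extensional_def)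

lemma finite_cube [simp]: "finite (cube d k)"
  using bij_betw_finite[OF bij_cube] by (simp add: finite_PiE)

lemma card_cube: "card (cube d k) = (2 * k + 1) ^ d"
proof -
  have "nat (2 * int k + 1) = 2 * k + 1" by simp
  then show ?thesis using bij_betw_same_card[OF bij_cube, of d k] by (simp add: card_PiE del: nat_add_distrib)
qed

text \<open>Sup-norm cubes replace balls throughout, since packing and shell counts are then
  products over the axes. This inclusion and \<open>cube_subset_gball\<close>, which loses a factor
  \<open>d\<close>, translate back to graph distance.\<close>

lemma gball_subset_cube: "gball d 0 r \<subseteq> cube d r"
proof
  fix u assume u: "u \<in> gball d 0 r"
  then have g: "u \<in> grid d" and le: "(\<Sum>i<d. \<bar>u i\<bar>) \<le> int r"
    using gdist_eq[of 0 d u] by (auto simp: gball_def)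
  have "\<bar>u i\<bar> \<le> int r" for i
  proof (cases "i < d")
    case True
    then have "\<bar>u i\<bar> \<le> (\<Sum>i<d. \<bar>u i\<bar>)" by (intro member_le_sum) auto
    then show ?thesis using le by linarith
  next
    case False
    then show ?thesis using g by (simp add: grid_def)
  qed
  then show "u \<in> cube d r" using g by (simp add: cube_def)
qed

lemma cube_subset_gball: "cube d k \<subseteq> gball d 0 (d * k)"
proof
  fix u assume u: "u \<in> cube d k"
  then have "(\<Sum>i<d. \<bar>u i\<bar>) \<le> (\<Sum>i<d. int k)" by (intro sum_mono) (simp add: cube_def)
  then show "u \<in> gball d 0 (d * k)"
    using gdist_eq[of 0 d u] u by (simp add: gball_def cube_def flip: of_nat_mult)
qed

lemma finite_gball [simp]: "finite (gball d 0 r)"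
  using finite_subset[OF gball_subset_cube] by simp

lemma gball_grid: "u \<in> gball d v r \<Longrightarrow> u \<in> grid d"
  by (simp add: gball_def)

lemma zero_in_gball [simp]: "0 \<in> gball d 0 r"
  using gdist_eq[of 0 d 0] by (simp add: gball_def)

lemma gball_mono: "a \<le> b \<Longrightarrow> gball d v a \<subseteq> gball d v b"
  by (auto simp: gball_def)

lemma countable_grid: "countable (grid d)"
proof -
  have "u \<in> (\<Union>k. cube d k)" if u: "u \<in> grid d" for u
  proof -
    have "\<bar>u i\<bar> \<le> int (nat (\<Sum>i<d. \<bar>u i\<bar>))" for i
    proof (cases "i < d")
      case True
      then have "\<bar>u i\<bar> \<le> (\<Sum>i<d. \<bar>u i\<bar>)" by (intro member_le_sum) auto
      then show ?thesis by linarith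
    next
      case False
      then show ?thesis using u by (simp add: grid_def)
    qed
    then have "u \<in> cube d (nat (\<Sum>i<d. \<bar>u i\<bar>))" unfolding cube_def using u by blast
    then show ?thesis by blast
  qed
  then have "grid d \<subseteq> (\<Union>k. cube d k)" by blast
  then show ?thesis
    by (rule countable_subset[OF _ countable_UN[OF _ countable_finite[OF finite_cube]]]) simp
qed

text \<open>Each axis is cut into intervals of \<open>m + 1\<close> integers, counted from
  \<open>c\<close>. Two points in one box differ by at most \<open>m\<close> in every coordinate and
  so coincide, and coordinates between \<open>- k * m\<close> and \<open>k * m\<close> meet only the
  \<open>2 * k\<close> intervals with index from \<open>- k\<close> to \<open>k - 1\<close>.\<close>

lemma card_separated_le:
  assumes k: "0 < k" and S: "\<And>v. v \<in> S \<Longrightarrow> v - c \<in> cube d (k * m)"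
    and sep: "\<And>u v. u \<in> S \<Longrightarrow> v \<in> S \<Longrightarrow> u - v \<in> cube d m \<Longrightarrow> u = v"
  shows "finite S \<and> card S \<le> (2 * k) ^ d"
proof -
  define f where "f v = (\<lambda>i\<in>{..<d}. (v i - c i) div (int m + 1))" for v :: vertex
  let ?T = "{..<d} \<rightarrow>\<^sub>E {- int k..<int k}"
  have "inj_on f S"
  proof (rule inj_onI)
    fix u v assume u: "u \<in> S" and v: "v \<in> S" and eq: "f u = f v"
    have "\<bar>u i - v i\<bar> \<le> int m" for i
    proof (cases "i < d")
      case True
      with eq have "(u i - c i) div (int m + 1) = (v i - c i) div (int m + 1)"
        by (auto simp: f_def fun_eq_iff restrict_def) (metis)
      moreover have "(u i - c i) mod (int m + 1) \<in> {0..int m}" "(v i - c i) mod (int m + 1) \<in> {0..int m}"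
        using pos_mod_bound[of "int m + 1" "u i - c i"] pos_mod_bound[of "int m + 1" "v i - c i"]
        by auto
      moreover have "u i - v i = (u i - c i) - (v i - c i)" by simp
      ultimately have "u i - v i = (u i - c i) mod (int m + 1) - (v i - c i) mod (int m + 1)"
        using mult_div_mod_eq[of "int m + 1" "u i - c i"] mult_div_mod_eq[of "int m + 1" "v i - c i"]
        by (metis add_diff_cancel_left)
      then show ?thesis
        using \<open>(u i - c i) mod (int m + 1) \<in> {0..int m}\<close> \<open>(v i - c i) mod (int m + 1) \<in> {0..int m}\<close>
        unfolding atLeastAtMost_iff by linarith
    next
      case False
      then have "u i = c i" "v i = c i"
        using S[OF u] S[OF v] by (auto simp: cube_def grid_def)
      then show ?thesis by simp
    qed
    moreover have "u - v \<in> grid d" using S[OF u] S[OF v] by (auto simp: cube_def grid_def)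
    ultimately show "u = v" using sep[OF u v] by (simp add: cube_def)
  qed
  moreover have "f ` S \<subseteq> ?T"
  proof -
    have "- int k \<le> x div (int m + 1) \<and> x div (int m + 1) < int k" if "\<bar>x\<bar> \<le> int (k * m)" for x
    proof
      have "- int k * (int m + 1) \<le> x" using that by (simp add: algebra_simps abs_le_iff)
      then have "(- int k * (int m + 1)) div (int m + 1) \<le> x div (int m + 1)"
        by (intro zdiv_mono1) auto
      then show "- int k \<le> x div (int m + 1)" by (subst (asm) nonzero_mult_div_cancel_right) auto
      have *: "x < int k * (int m + 1)" using that k by (simp add: algebra_simps abs_le_iff)
      show "x div (int m + 1) < int k"
      proof (rule ccontr)
        assume "\<not> ?thesis"
        then have "int k * (int m + 1) \<le> x div (int m + 1) * (int m + 1)"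
          by (intro mult_right_mono) auto
        also have "\<dots> \<le> x div (int m + 1) * (int m + 1) + x mod (int m + 1)" by simp
        also have "\<dots> = x" by (rule div_mult_mod_eq)
        finally show False using * by simp
      qed
    qed
    moreover have "\<bar>v i - c i\<bar> \<le> int (k * m)" if "v \<in> S" for v i
      using S[OF that] by (simp add: cube_def)
    ultimately show ?thesis unfolding f_def by (intro image_subsetI restrict_PiE_iff[THEN iffD2]) simp
  qed
  moreover have "finite ?T" "card ?T = (2 * k) ^ d"
    by (auto simp: finite_PiE card_PiE nat_add_distrib nat_mult_distrib)
  ultimately show ?thesis
    by (metis card_inj_on_le inj_on_finite)
qed

text \<open>Two centres are compared along with two labellings, so that one relation expresses both
  dependence on a bounded neighbourhood and invariance under translations.\<close>

definition agree :: "nat \<Rightarrow> nat \<Rightarrow> (vertex \<Rightarrow> 'a) \<Rightarrow> vertex \<Rightarrow> (vertex \<Rightarrow> 'a) \<Rightarrow> vertex \<Rightarrow> bool" where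
  "agree d k l v l' v' \<longleftrightarrow> (\<forall>u\<in>cube d k. l (v + u) = l' (v' + u))"

lemma agreeD: "agree d k l v l' v' \<Longrightarrow> u \<in> cube d k \<Longrightarrow> l (v + u) = l' (v' + u)"
  by (simp add: agree_def)

lemma agree_root: "agree d k l v l' v' \<Longrightarrow> l v = l' v'"
  using agreeD[of d k l v l' v' 0] by simp

lemma agree_move:
  assumes "agree d k l v l' v'" "u \<in> cube d a" "a + b \<le> k"
  shows "agree d b l (v + u) l' (v' + u)"
  using assms agreeD[OF assms(1)] cube_in_mono[OF cube_add[OF assms(2)] assms(3)]
  by (simp add: agree_def add.assoc)

lemma agree_mono: "agree d k l v l' v' \<Longrightarrow> b \<le> k \<Longrightarrow> agree d b l v l' v'"
  using agree_move[of d k l v l' v' 0 0 b] by simp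

lemma agree_sym: "agree d k l v l' v' \<Longrightarrow> agree d k l' v' l v"
  by (simp add: agree_def)

lemma agree_nbhd:
  assumes "agree d k l v l' v'" "r \<le> k"
  shows "nbhd d l v r = nbhd d l' v' r"
  using agreeD[OF assms(1)] gball_subset_cube[of d r] cube_mono[OF assms(2), of d]
  by (fastforce simp: nbhd_def restrict_def fun_eq_iff)

definition local_rule :: "nat \<Rightarrow> ((vertex \<Rightarrow> 'a) \<Rightarrow> vertex \<Rightarrow> 'b) \<Rightarrow> bool" where
  "local_rule d F \<longleftrightarrow> (\<exists>k. \<forall>l l' v v'. v \<in> grid d \<longrightarrow> v' \<in> grid d \<longrightarrow>
     agree d k l v l' v' \<longrightarrow> F l v = F l' v')"

lemma local_ruleI:
  assumes "\<And>l l' v v'. v \<in> grid d \<Longrightarrow> v' \<in> grid d \<Longrightarrow> agree d k l v l' v' \<Longrightarrow> F l v = F l' v'"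
  shows "local_rule d F"
  using assms unfolding local_rule_def by blast

lemma local_ruleE:
  assumes "local_rule d F"
  obtains k where
    "\<And>l l' v v'. v \<in> grid d \<Longrightarrow> v' \<in> grid d \<Longrightarrow> agree d k l v l' v' \<Longrightarrow> F l v = F l' v'"
  using assms unfolding local_rule_def by blast

lemma local_rule_comp:
  assumes "local_rule d F" "local_rule d G"
  shows "local_rule d (\<lambda>l. G (F l))"
proof -
  obtain a where a: "\<And>l l' v v'. v \<in> grid d \<Longrightarrow> v' \<in> grid d \<Longrightarrow> agree d a l v l' v' \<Longrightarrow> F l v = F l' v'"
    using assms(1) by (rule local_ruleE) blast
  obtain b where b: "\<And>l l' v v'. v \<in> grid d \<Longrightarrow> v' \<in> grid d \<Longrightarrow> agree d b l v l' v' \<Longrightarrow> G l v = G l' v'"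
    using assms(2) by (rule local_ruleE) blast
  show ?thesis
  proof (rule local_ruleI[where k = "b + a"])
    fix l l' :: "vertex \<Rightarrow> 'a" and v v'
    assume v: "v \<in> grid d" "v' \<in> grid d" and ag: "agree d (b + a) l v l' v'"
    have "agree d b (F l) v (F l') v'"
      unfolding agree_def
      using a[OF grid_add[OF v(1) cube_grid] grid_add[OF v(2) cube_grid] agree_move[OF ag _ order_refl]]
      by blast
    then show "G (F l) v = G (F l') v'" by (rule b[OF v])
  qed
qed

lemma local_rule_pair:
  assumes "local_rule d F" "local_rule d G"
  shows "local_rule d (\<lambda>l v. (F l v, G l v))"
proof -
  obtain a where a: "\<And>l l' v v'. v \<in> grid d \<Longrightarrow> v' \<in> grid d \<Longrightarrow> agree d a l v l' v' \<Longrightarrow> F l v = F l' v'"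
    using assms(1) by (rule local_ruleE) blast
  obtain b where b: "\<And>l l' v v'. v \<in> grid d \<Longrightarrow> v' \<in> grid d \<Longrightarrow> agree d b l v l' v' \<Longrightarrow> G l v = G l' v'"
    using assms(2) by (rule local_ruleE) blast
  show ?thesis
    by (rule local_ruleI[where k = "max a b"])
       (use a b agree_mono in \<open>metis max.cobounded1 max.cobounded2\<close>)
qed

lemma local_rule_pointwise: "local_rule d (\<lambda>l v. h (l v))"
  by (rule local_ruleI[where k = 0]) (metis agree_root)

section \<open>Resampling random labels\<close>

lemma space_unit_labels [simp]: "space unit_labels = {0..1}"
  by (simp add: unit_labels_def space_restrict_space)

lemma sets_unit_labels: "A \<in> sets unit_labels \<longleftrightarrow> A \<subseteq> {0..1} \<and> A \<in> sets borel"
  by (simp add: unit_labels_def sets_restrict_space_iff conj_commute)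

lemma emeasure_unit_labels: "A \<subseteq> {0..1} \<Longrightarrow> emeasure unit_labels A = emeasure lborel A"
  by (simp add: unit_labels_def emeasure_restrict_space)

lemma prob_space_unit_labels: "prob_space unit_labels"
  unfolding unit_labels_def by (rule prob_space_restrict_space) auto

interpretation unit_labels: prob_space unit_labels
  by (rule prob_space_unit_labels)

interpretation random_labels: prob_space "random_labels d" for d
  unfolding random_labels_def by (rule prob_space_PiM) (rule prob_space_unit_labels)

lemma space_random_labels: "space (random_labels d) = grid d \<rightarrow>\<^sub>E {0..1}"
  by (simp add: random_labels_def space_PiM)

lemma measurable_label:
  "v \<in> grid d \<Longrightarrow> (\<lambda>x. x v) \<in> random_labels d \<rightarrow>\<^sub>M unit_labels"
  unfolding random_labels_def by (rule measurable_component_singleton)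

lemma borel_measurable_label:
  assumes "v \<in> grid d"
  shows "(\<lambda>x. x v) \<in> borel_measurable (random_labels d)"
proof -
  have "(\<lambda>x. x v) \<in> random_labels d \<rightarrow>\<^sub>M restrict_space lborel {0..1}"
    using measurable_label[OF assms] by (simp add: unit_labels_def)
  then show ?thesis by (simp add: measurable_restrict_space2_iff)
qed

definition translate :: "nat \<Rightarrow> vertex \<Rightarrow> (vertex \<Rightarrow> 'a) \<Rightarrow> vertex \<Rightarrow> 'a" where
  "translate d w x = (\<lambda>v\<in>grid d. x (v + w))"

lemma measurable_translate:
  assumes "w \<in> grid d"
  shows "translate d w \<in> random_labels d \<rightarrow>\<^sub>M random_labels d"
  unfolding translate_def random_labels_def
  using assms by (intro measurable_restrict measurable_component_singleton grid_add)

lemma distr_translate: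
  assumes "w \<in> grid d"
  shows "distr (random_labels d) (random_labels d) (translate d w) = random_labels d"
  unfolding translate_def random_labels_def
  using distr_PiM_reindex[of "grid d" "\<lambda>_. unit_labels" "\<lambda>v. v + w" "grid d"] assms
  by (auto simp: prob_space_unit_labels inj_on_def grid_add)

lemma emeasure_translate:
  assumes w: "w \<in> grid d" and E: "{x \<in> space (random_labels d). P x} \<in> sets (random_labels d)"
  shows "emeasure (random_labels d) {x \<in> space (random_labels d). P (translate d w x)} =
    emeasure (random_labels d) {x \<in> space (random_labels d). P x}"
proof -
  have "emeasure (random_labels d) {x \<in> space (random_labels d). P x} =
    emeasure (distr (random_labels d) (random_labels d) (translate d w)) {x \<in> space (random_labels d). P x}"
    by (simp add: distr_translate[OF w])
  also have "\<dots> = emeasure (random_labels d)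
      (translate d w -` {x \<in> space (random_labels d). P x} \<inter> space (random_labels d))"
    by (rule emeasure_distr[OF measurable_translate[OF w] E])
  also have "translate d w -` {x \<in> space (random_labels d). P x} \<inter> space (random_labels d) =
      {x \<in> space (random_labels d). P (translate d w x)}"
    using measurable_space[OF measurable_translate[OF w]] by auto
  finally show ?thesis by simp
qed

text \<open>Resampling: the labels in \<open>J\<close> are taken from a second copy. Fixing
  \<open>z\<close> amounts to conditioning on the labels in \<open>J\<close>.\<close>

definition splice :: "nat \<Rightarrow> vertex set \<Rightarrow> (vertex \<Rightarrow> 'a) \<Rightarrow> (vertex \<Rightarrow> 'a) \<Rightarrow> vertex \<Rightarrow> 'a" where
  "splice d J x z = (\<lambda>v\<in>grid d. if v \<in> J then z v else x v)"

lemma measurable_splice: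
  "(\<lambda>(x, z). splice d J x z) \<in> random_labels d \<Otimes>\<^sub>M random_labels d \<rightarrow>\<^sub>M random_labels d"
proof -
  have "(\<lambda>p. if v \<in> J then snd p v else fst p v)
      \<in> random_labels d \<Otimes>\<^sub>M random_labels d \<rightarrow>\<^sub>M unit_labels" if "v \<in> grid d" for v
    using measurable_compose[OF measurable_fst measurable_label[OF that]]
      measurable_compose[OF measurable_snd measurable_label[OF that]]
    by (cases "v \<in> J") simp_all
  then have "(\<lambda>p. \<lambda>v\<in>grid d. if v \<in> J then snd p v else fst p v)
      \<in> random_labels d \<Otimes>\<^sub>M random_labels d \<rightarrow>\<^sub>M PiM (grid d) (\<lambda>_. unit_labels)"
    by (intro measurable_restrict)
  then have "(\<lambda>p. \<lambda>v\<in>grid d. if v \<in> J then snd p v else fst p v)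
      \<in> random_labels d \<Otimes>\<^sub>M random_labels d \<rightarrow>\<^sub>M random_labels d"
    by (simp only: random_labels_def)
  then show ?thesis by (simp add: splice_def case_prod_unfold)
qed

text \<open>On a cylinder the conditions at indices in \<open>J\<close> concern only the second
  argument and the others only the first, so its preimage is a rectangle whose measure is the
  required product.\<close>

lemma distr_splice:
  "distr (random_labels d \<Otimes>\<^sub>M random_labels d) (random_labels d) (\<lambda>(x, z). splice d J x z) = random_labels d"
proof -
  interpret P: product_prob_space "\<lambda>_::vertex. unit_labels" "grid d"
    by (intro product_prob_spaceI prob_space_unit_labels)
  let ?M = "random_labels d" and ?U = "\<lambda>_::vertex. unit_labels"
  let ?D = "distr (?M \<Otimes>\<^sub>M ?M) ?M (\<lambda>(x, z). splice d J x z)"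
  have "?D = PiM (grid d) ?U"
  proof (rule P.PiM_eq)
    show "sets ?D = sets (PiM (grid d) ?U)" by (simp add: random_labels_def)
    fix I F assume I: "finite I" "I \<subseteq> grid d" and F: "\<And>j. j \<in> I \<Longrightarrow> F j \<in> sets unit_labels"
    let ?E = "\<lambda>I. prod_emb (grid d) ?U I (Pi\<^sub>E I F)"
    have E: "?E K \<in> sets ?M" if "K \<subseteq> I" for K
      unfolding random_labels_def
      by (rule sets_PiM_I) (use that I F finite_subset in auto)
    have F1: "F j \<subseteq> {0..1}" if "j \<in> I" for j
      using F[OF that] by (simp add: sets_unit_labels)
    have split: "(\<lambda>(x, z). splice d J x z) -` ?E I \<inter> space (?M \<Otimes>\<^sub>M ?M) = ?E (I - J) \<times> ?E (I \<inter> J)"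
      using I F1 by (fastforce simp: prod_emb_def splice_def space_pair_measure space_random_labels
          PiE_iff extensional_def)
    have "emeasure ?D (?E I) = emeasure (?M \<Otimes>\<^sub>M ?M) (?E (I - J) \<times> ?E (I \<inter> J))"
      by (subst emeasure_distr[OF measurable_splice E]) (simp_all add: split)
    also have "\<dots> = emeasure ?M (?E (I - J)) * emeasure ?M (?E (I \<inter> J))"
      by (rule random_labels.emeasure_pair_measure_Times) (auto intro: E)
    also have "\<dots> = (\<Prod>j\<in>I - J. emeasure unit_labels (F j)) * (\<Prod>j\<in>I \<inter> J. emeasure unit_labels (F j))"
      unfolding random_labels_def using I F by (subst (1 2) P.emeasure_PiM_emb) auto
    also have "\<dots> = (\<Prod>j\<in>I. emeasure unit_labels (F j))"
      using I(1) by (metis mult.commute prod.Int_Diff)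
    finally show "emeasure ?D (?E I) = (\<Prod>j\<in>I. emeasure unit_labels (F j))" .
  qed
  then show ?thesis by (simp add: random_labels_def)
qed

text \<open>Fubini for the preimage of the event under \<open>splice\<close>: its sections at fixed
  \<open>z\<close> are the resampled events.\<close>

lemma expectation_splice:
  assumes E: "{x \<in> space (random_labels d). P x} \<in> sets (random_labels d)"
  shows "(\<lambda>z. measure (random_labels d) {x \<in> space (random_labels d). P (splice d J x z)})
           \<in> borel_measurable (random_labels d)"
    and "random_labels.expectation d
           (\<lambda>z. measure (random_labels d) {x \<in> space (random_labels d). P (splice d J x z)}) =
         measure (random_labels d) {x \<in> space (random_labels d). P x}"
proof -
  let ?M = "random_labels d"
  interpret PP: pair_sigma_finite ?M ?M ..
  define S where "S = (\<lambda>(x, z). splice d J x z) -` {x \<in> space ?M. P x} \<inter> space (?M \<Otimes>\<^sub>M ?M)"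
  have S: "S \<in> sets (?M \<Otimes>\<^sub>M ?M)"
    unfolding S_def by (rule measurable_sets[OF measurable_splice E])
  have sec: "(\<lambda>x. (x, z)) -` S = {x \<in> space ?M. P (splice d J x z)}" if "z \<in> space ?M" for z
    using that measurable_space[OF measurable_splice, of _ d J]
    by (auto simp: S_def space_pair_measure)
  have "(\<lambda>z. emeasure ?M ((\<lambda>x. (x, z)) -` S)) \<in> borel_measurable ?M"
    by (rule PP.measurable_emeasure_Pair2[OF S])
  then have meas: "(\<lambda>z. emeasure ?M {x \<in> space ?M. P (splice d J x z)}) \<in> borel_measurable ?M"
    by (subst measurable_cong[where g = "\<lambda>z. emeasure ?M ((\<lambda>x. (x, z)) -` S)"]) (simp_all add: sec)
  then show m: "(\<lambda>z. measure ?M {x \<in> space ?M. P (splice d J x z)}) \<in> borel_measurable ?M"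
    by (simp add: measure_def)
  have "emeasure ?M {x \<in> space ?M. P x} = emeasure (?M \<Otimes>\<^sub>M ?M) S"
    unfolding S_def by (subst emeasure_distr[OF measurable_splice E, symmetric]) (simp add: distr_splice)
  also have "\<dots> = (\<integral>\<^sup>+z. emeasure ?M {x \<in> space ?M. P (splice d J x z)} \<partial>?M)"
    by (subst PP.emeasure_pair_measure_alt2[OF S]) (auto intro!: nn_integral_cong simp: sec)
  also have "\<dots> = (\<integral>\<^sup>+z. ennreal (measure ?M {x \<in> space ?M. P (splice d J x z)}) \<partial>?M)"
    by (simp add: random_labels.emeasure_eq_measure)
  finally have "ennreal (measure ?M {x \<in> space ?M. P x}) =
      (\<integral>\<^sup>+z. ennreal (measure ?M {x \<in> space ?M. P (splice d J x z)}) \<partial>?M)"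
    by (simp add: random_labels.emeasure_eq_measure)
  then show "random_labels.expectation d (\<lambda>z. measure ?M {x \<in> space ?M. P (splice d J x z)}) =
      measure ?M {x \<in> space ?M. P x}"
    using m by (subst integral_eq_nn_integral) (simp_all flip: \<open>ennreal _ = _\<close>)
qed

text \<open>The sum over \<open>s\<close> of the resampled probabilities divided by \<open>B s\<close> has expectation at most
  \<open>card S\<close>.\<close>

lemma splice_averaging:
  assumes fin: "finite S" and card: "card S \<le> D" and D: "0 < D"
    and E: "\<And>s. s \<in> S \<Longrightarrow> {x \<in> space (random_labels d). P s x} \<in> sets (random_labels d)"
    and B: "\<And>s. s \<in> S \<Longrightarrow> measure (random_labels d) {x \<in> space (random_labels d). P s x} \<le> B s"
    and pos: "\<And>s. s \<in> S \<Longrightarrow> 0 < B s"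
  shows "\<exists>z\<in>space (random_labels d). \<forall>s\<in>S.
    measure (random_labels d) {x \<in> space (random_labels d). P s (splice d J x z)} \<le> real D * B s"
proof (rule ccontr)
  let ?M = "random_labels d"
  let ?f = "\<lambda>s z. measure ?M {x \<in> space ?M. P s (splice d J x z)}"
  assume "\<not> ?thesis"
  then have neg: "\<exists>s\<in>S. real D * B s < ?f s z" if "z \<in> space ?M" for z
    using that by (auto simp: not_le)
  have int: "integrable ?M (?f s)" if "s \<in> S" for s
    by (rule random_labels.integrable_const_bound[where B = 1])
       (use expectation_splice(1)[OF E[OF that]] in auto)
  have "real D < (\<Sum>s\<in>S. ?f s z / B s)" if z: "z \<in> space ?M" for z
  proof -
    obtain s where s: "s \<in> S" "real D * B s < ?f s z" using neg[OF z] by blast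
    then have "real D < ?f s z / B s" using pos[OF s(1)] by (simp add: less_divide_eq)
    also have "\<dots> \<le> (\<Sum>s\<in>S. ?f s z / B s)"
      using fin s(1) pos by (intro member_le_sum) (auto intro: divide_nonneg_pos)
    finally show ?thesis .
  qed
  then have "real D < random_labels.expectation d (\<lambda>z. \<Sum>s\<in>S. ?f s z / B s)"
    using int by (intro random_labels.expectation_greater) (auto intro!: AE_I2)
  also have "\<dots> = (\<Sum>s\<in>S. measure ?M {x \<in> space ?M. P s x} / B s)"
    using int by (simp add: expectation_splice(2)[OF E] Bochner_Integration.integral_sum)
  also have "\<dots> \<le> (\<Sum>s\<in>S. 1)"
    using B pos by (intro sum_mono) (simp add: divide_le_eq)
  also have "\<dots> \<le> real D" using card by simp
  finally show False by simp
qed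

text \<open>For each common value \<open>k\<close> both labels lie in one interval of length at most
  \<open>1 / 2 ^ n\<close>, which by independence has probability at most \<open>1 / 4 ^ n\<close>.
  There are \<open>2 ^ n + 1\<close> values because the label 1 yields \<open>2 ^ n\<close>; the
  extra value costs the factor 2.\<close>

lemma prob_same_digits:
  assumes v: "v \<in> grid d" and w: "w \<in> grid d" and ne: "v \<noteq> w"
  shows "measure (random_labels d) {x \<in> space (random_labels d). \<lfloor>2 ^ n * x v\<rfloor> = \<lfloor>2 ^ n * x w\<rfloor>}
    \<le> 2 / 2 ^ n"
proof -
  interpret P: product_prob_space "\<lambda>_::vertex. unit_labels" "grid d"
    by (intro product_prob_spaceI prob_space_unit_labels)
  let ?M = "random_labels d"
  define I where "I k = {y \<in> {0..1}. \<lfloor>2 ^ n * y :: real\<rfloor> = int k}" for k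
  define F where "F k = prod_emb (grid d) (\<lambda>_. unit_labels) {v, w} (\<Pi>\<^sub>E j\<in>{v, w}. I k)" for k
  have Isub: "I k \<subseteq> {real k / 2 ^ n..real (Suc k) / 2 ^ n}" for k
    by (auto simp: I_def floor_eq_iff field_simps)
  have Imeas: "I k \<in> sets unit_labels" for k
  proof -
    have "I k = {0..1} \<inter> {real k / 2 ^ n..<real (Suc k) / 2 ^ n}"
      by (auto simp: I_def floor_eq_iff field_simps)
    then show ?thesis by (simp add: sets_unit_labels)
  qed
  have Iprob: "measure unit_labels (I k) \<le> 1 / 2 ^ n" for k
  proof -
    have "measure unit_labels (I k) = measure lborel (I k)"
      using emeasure_unit_labels[of "I k"] Imeas[of k] by (simp add: measure_def sets_unit_labels)
    also have "\<dots> \<le> measure lborel {real k / 2 ^ n..real (Suc k) / 2 ^ n}"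
      using Isub[of k] Imeas[of k] by (intro measure_mono_fmeasurable) (auto simp: sets_unit_labels emeasure_lborel_Icc_eq intro!: fmeasurableI)
    also have "\<dots> = 1 / 2 ^ n" by (simp add: divide_simps)
    finally show ?thesis .
  qed
  have Fmeas: "F k \<in> sets ?M" for k
    unfolding F_def random_labels_def using v w Imeas by (intro sets_PiM_I) auto
  have Fprob: "measure ?M (F k) \<le> (1 / 2 ^ n) * (1 / 2 ^ n)" for k
  proof -
    have "measure ?M (F k) = measure unit_labels (I k) * measure unit_labels (I k)"
      unfolding F_def random_labels_def using v w ne Imeas by (subst P.measure_PiM_emb) auto
    also have "\<dots> \<le> (1 / 2 ^ n) * (1 / 2 ^ n)" by (intro mult_mono Iprob) auto
    finally show ?thesis .
  qed
  have sub: "{x \<in> space ?M. \<lfloor>2 ^ n * x v\<rfloor> = \<lfloor>2 ^ n * x w\<rfloor>} \<subseteq> (\<Union>k\<in>{..2 ^ n}. F k)"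
  proof
    fix x assume x: "x \<in> {x \<in> space ?M. \<lfloor>2 ^ n * x v\<rfloor> = \<lfloor>2 ^ n * x w\<rfloor>}"
    then have xv: "x v \<in> {0..1}" "x w \<in> {0..1}" and xe: "x \<in> extensional (grid d)"
      and xs: "x \<in> grid d \<rightarrow>\<^sub>E {0..1}"
      using v w by (auto simp: space_random_labels PiE_iff)
    define k where "k = nat \<lfloor>2 ^ n * x v\<rfloor>"
    have k: "int k = \<lfloor>2 ^ n * x v\<rfloor>" using xv by (simp add: k_def)
    have "2 ^ n * x v \<le> 2 ^ n" using xv by (simp add: mult_left_le)
    then have "2 ^ n * x v < 2 ^ n + 1" by linarith
    then have "\<lfloor>2 ^ n * x v\<rfloor> \<le> 2 ^ n" by (simp add: floor_le_iff)
    then have "k \<le> 2 ^ n" unfolding k_def by (simp add: nat_le_iff)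
    moreover have "x \<in> F k"
      using x xv xs k v w by (auto simp: F_def prod_emb_def I_def PiE_iff)
    ultimately show "x \<in> (\<Union>k\<in>{..2 ^ n}. F k)" by auto
  qed
  have "measure ?M {x \<in> space ?M. \<lfloor>2 ^ n * x v\<rfloor> = \<lfloor>2 ^ n * x w\<rfloor>} \<le> measure ?M (\<Union>k\<in>{..2 ^ n}. F k)"
    using Fmeas by (intro random_labels.finite_measure_mono sub) auto
  also have "\<dots> \<le> (\<Sum>k\<in>{..2 ^ n}. measure ?M (F k))"
    using Fmeas by (intro measure_UNION_le) auto
  also have "\<dots> \<le> (\<Sum>k\<in>{..(2::nat) ^ n}. (1 / 2 ^ n) * (1 / 2 ^ n))"
    by (intro sum_mono Fprob)
  also have "\<dots> = (2 ^ n + 1) / (2 ^ n * 2 ^ n)" by simp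
  also have "\<dots> \<le> (2 ^ n + 2 ^ n) / (2 ^ n * 2 ^ n)" by (intro divide_right_mono add_left_mono) auto
  also have "\<dots> = 2 / 2 ^ n" by simp
  finally show ?thesis .
qed

section \<open>Colouring powers of the grid\<close>

text \<open>The library unfolds sums of vertices pointwise as soon as they occur eta-expanded.\<close>

declare plus_fun_apply [simp del] minus_apply [simp del] uminus_apply [simp del]


section \<open>Towers of exponentials and the bit lengths of iterated colours\<close>

primrec tower :: "nat \<Rightarrow> nat" where
  "tower 0 = 1"
| "tower (Suc n) = 2 ^ tower n"

lemma tower_pos: "0 < tower n"
  by (cases n) auto

lemma tower_add: "tower n + h \<le> tower (n + h)"
proof (induction h)
  case (Suc h)
  have "tower (n + h) < 2 ^ tower (n + h)" by (rule less_exp)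
  then have "tower n + Suc h \<le> 2 ^ tower (n + h)" using Suc by linarith
  then show ?case by simp
qed simp

lemma two_power_tower: "0 < n \<Longrightarrow> 2 ^ h * tower n \<le> tower (n + h)"
proof (cases n)
  case (Suc m)
  have "2 ^ h * tower n = 2 ^ (tower m + h)" by (simp add: Suc power_add)
  also have "\<dots> \<le> 2 ^ tower (m + h)" by (intro power_increasing tower_add) simp
  finally show ?thesis by (simp add: Suc)
qed simp

text \<open>Here \<open>s\<close> is the number of neighbours and \<open>b j\<close> the bit length
  of the initial colours at level \<open>j\<close>. One reduction step turns
  \<open>b (Suc j) = 2 ^ a j\<close> bits into \<open>s * (a j + 1)\<close> bits, which must fit
  into \<open>b j\<close>; the third condition makes \<open>b j\<close> long enough for a clash to
  have probability at most \<open>1 / tower (Suc j)\<close>.\<close>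

lemma reduction_lengths_exist:
  assumes "0 < s"
  shows "\<exists>a b :: nat \<Rightarrow> nat. \<forall>j. b (Suc j) = 2 ^ a j \<and> s * (a j + 1) \<le> b j \<and> tower j + s + 2 \<le> b j"
proof -
  \<comment> \<open>The slack \<open>x\<close> lets the invariant \<open>b_ge\<close> reproduce
    itself: \<open>s * (x + 3) \<le> 2 ^ (x + 1)\<close> absorbs the division by \<open>s\<close> in
    each step.\<close>
  define x where "x = s + 3"
  have "s * (s + 6) + 7 \<le> 16 * 2 ^ s" by (induction s) (simp_all add: algebra_simps)
  then have x: "s * (x + 3) \<le> 2 ^ (x + 1)" by (simp add: x_def algebra_simps power_add)
  define b where "b = rec_nat (s * (1 + x + 2)) (\<lambda>_ c. 2 ^ (c div s - 1))"
  define a where "a j = b j div s - 1" for j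
  have b_Suc: "b (Suc j) = 2 ^ a j" for j by (simp add: b_def a_def)
  have b_ge: "s * (tower j + x + 2) \<le> b j" for j
  proof (induction j)
    case 0 then show ?case by (simp add: b_def)
  next
    case (Suc j)
    have "tower j + x + 2 \<le> b j div s"
      using Suc assms by (simp add: less_eq_div_iff_mult_less_eq mult.commute)
    then have "tower j + (x + 1) \<le> a j" by (simp add: a_def)
    then have C: "tower (Suc j) * 2 ^ (x + 1) \<le> b (Suc j)"
      unfolding b_Suc tower.simps power_add[symmetric] by (intro power_increasing) auto
    have A: "s * (tower (Suc j) + x + 2) \<le> s * (tower (Suc j) * (x + 3))"
    proof (rule mult_left_mono)
      have "1 * (x + 2) \<le> tower (Suc j) * (x + 2)"
        using tower_pos[of "Suc j"] by (intro mult_right_mono) auto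
      then show "tower (Suc j) + x + 2 \<le> tower (Suc j) * (x + 3)" by (simp add: algebra_simps)
    qed simp
    have "s * (tower (Suc j) * (x + 3)) = tower (Suc j) * (s * (x + 3))"
      by (rule mult.left_commute)
    also have "\<dots> \<le> tower (Suc j) * 2 ^ (x + 1)" by (rule mult_left_mono[OF x]) simp
    finally show ?case using A C by (meson order_trans)
  qed
  have "s * (a j + 1) \<le> b j" for j
  proof -
    have "s * 1 \<le> b j"
      using b_ge[of j] mult_le_mono2[of 1 "tower j + x + 2" s] tower_pos[of j] by linarith
    then have "1 \<le> b j div s"
      using assms by (simp add: less_eq_div_iff_mult_less_eq)
    then have "s * (a j + 1) = s * (b j div s)" by (simp add: a_def)
    then show ?thesis by simp
  qed
  moreover have "tower j + s + 2 \<le> b j" for j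
  proof -
    have "1 * (tower j + x + 2) \<le> s * (tower j + x + 2)" using assms by (intro mult_right_mono) auto
    then have "tower j + x + 2 \<le> b j" using b_ge[of j] by (metis nat_mult_1 order_trans)
    then show ?thesis by (simp add: x_def)
  qed
  ultimately show ?thesis using b_Suc by blast
qed

lemma bit_less_power: "bit c i \<Longrightarrow> (c :: nat) < 2 ^ n \<Longrightarrow> i < n"
proof (rule ccontr)
  assume "bit c i" "c < 2 ^ n" "\<not> i < n"
  then have "c < 2 ^ i" by (meson less_le_trans not_less one_le_numeral power_increasing)
  then show False using \<open>bit c i\<close> by (simp add: bit_iff_odd)
qed

text \<open>One Cole--Vishkin step in the Cayley graph of a set \<open>N\<close> of generators: each vertex records, for
  each generator, the first binary digit at which its colour differs from the neighbour's.\<close>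

lemma color_reduction_exists:
  assumes N: "finite (N :: 'v set)"
  shows "\<exists>R :: nat \<Rightarrow> ('v \<Rightarrow> nat) \<Rightarrow> nat.
    (\<forall>c f. R c f < 2 ^ (card N * (a + 1))) \<and>
    (\<forall>c f c' f' s. s \<in> N \<longrightarrow> c < 2 ^ 2 ^ a \<longrightarrow> c' < 2 ^ 2 ^ a \<longrightarrow> c \<noteq> c' \<longrightarrow> f s = c' \<longrightarrow> R c f \<noteq> R c' f')"
proof -
  \<comment> \<open>The fallback 0 only keeps the index below \<open>2 ^ a\<close> for arbitrary
    arguments; distinct colours below \<open>2 ^ 2 ^ a\<close> differ at an admissible index. Below,
    \<open>h\<close> packs this index and the own digit there into one number.\<close>
  define i where "i c e = (let j = (LEAST j. bit c j \<noteq> bit e j) in if j < 2 ^ a then j else 0)"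
    for c e :: nat
  define h where "h c e = 2 * i c e + of_bool (bit c (i c e))" for c e
  have i: "i c e < 2 ^ a" for c e by (simp add: i_def Let_def)
  have h: "h c e < 2 ^ (a + 1)" for c e using i[of c e] by (simp add: h_def)
  let ?P = "N \<rightarrow>\<^sub>E {..<(2::nat) ^ (a + 1)}"
  have "finite ?P" using N by (intro finite_PiE) auto
  then obtain enc where enc: "bij_betw enc ?P {0..<card ?P}"
    using ex_bij_betw_finite_nat by blast
  have card: "card ?P = 2 ^ (card N * (a + 1))"
    using N by (simp add: card_PiE power_mult[symmetric] mult.commute del: power_Suc)
  define R where "R c f = enc (\<lambda>s\<in>N. h c (f s))" for c f
  have mem: "(\<lambda>s\<in>N. h c (f s)) \<in> ?P" for c f using h by auto
  have "R c f < 2 ^ (card N * (a + 1))" for c f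
    using bij_betwE[OF enc] mem[of c f] card by (auto simp: R_def)
  moreover have "R c f \<noteq> R c' f'"
    if s: "s \<in> N" and c: "c < 2 ^ 2 ^ a" "c' < 2 ^ 2 ^ a" "c \<noteq> c'" and f: "f s = c'" for c f c' f' s
  proof
    assume "R c f = R c' f'"
    then have "(\<lambda>s\<in>N. h c (f s)) = (\<lambda>s\<in>N. h c' (f' s))"
      using enc mem unfolding R_def by (metis bij_betw_def inj_on_def)
    \<comment> \<open>The generator \<open>s\<close> leads from the first vertex to the second, so
      \<open>i c c'\<close> is an index where the two colours differ. Equal entries would force the
      second vertex to record the same index with the same digit, whatever \<open>f'\<close> holds
      at \<open>s\<close>.\<close>
    from fun_cong[OF this, of s] have heq: "h c c' = h c' (f' s)" using s f by simp
    have ieq: "i c c' = i c' (f' s)" and beq: "bit c (i c c') = bit c' (i c' (f' s))"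
      using heq by (auto simp: h_def of_bool_def split: if_splits) presburger+
    obtain j where j: "bit c j \<noteq> bit c' j" using c(3) by (metis bit_eqI)
    define j0 where "j0 = (LEAST j. bit c j \<noteq> bit c' j)"
    have j0: "bit c j0 \<noteq> bit c' j0" unfolding j0_def by (rule LeastI) (rule j)
    then have "j0 < 2 ^ a" using bit_less_power c(1,2) by blast
    then have "i c c' = j0" by (simp add: i_def j0_def Let_def)
    then show False using ieq beq j0 by simp
  qed
  ultimately show ?thesis by blast
qed

text \<open>A finite product of countable discrete spaces is discrete, so \<open>F\<close> may be an
  arbitrary function of the finitely many values.\<close>

lemma measurable_finite_family:
  fixes h :: "'v \<Rightarrow> 'a \<Rightarrow> 'b :: countable"
  assumes "finite N" "\<And>s. s \<in> N \<Longrightarrow> h s \<in> S \<rightarrow>\<^sub>M count_space UNIV"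
  shows "(\<lambda>\<omega>. F (\<lambda>s\<in>N. h s \<omega>)) \<in> S \<rightarrow>\<^sub>M count_space UNIV"
proof -
  have "(\<lambda>\<omega>. \<lambda>s\<in>N. h s \<omega>) \<in> S \<rightarrow>\<^sub>M PiM N (\<lambda>_. count_space UNIV)"
    using assms by (intro measurable_restrict)
  then have "(\<lambda>\<omega>. \<lambda>s\<in>N. h s \<omega>) \<in> S \<rightarrow>\<^sub>M count_space (N \<rightarrow>\<^sub>E UNIV)"
    using assms(1) by (simp add: count_space_PiM_finite)
  then show ?thesis by (rule measurable_compose) simp
qed

text \<open>\<open>N\<close> is the set of differences along the edges of the graph to be coloured,
  and \<open>k\<close> bounds the reach of an edge. \<open>R j\<close> lowers the bit length
  \<open>b (Suc j)\<close> to \<open>b j\<close>, so level \<open>j\<close> starts with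
  \<open>b j\<close> bits and takes \<open>j\<close> rounds to arrive at the fixed length
  \<open>b 0\<close>.\<close>

locale reduction =
  fixes d k :: nat and N :: "vertex set" and a b :: "nat \<Rightarrow> nat"
    and R :: "nat \<Rightarrow> nat \<Rightarrow> (vertex \<Rightarrow> nat) \<Rightarrow> nat"
  assumes finite_N: "finite N" and N_cube: "N \<subseteq> cube d k" and zero_N: "0 \<notin> N"
    and N_sym: "\<And>s. s \<in> N \<Longrightarrow> - s \<in> N"
    and b_Suc: "\<And>j. b (Suc j) = 2 ^ a j"
    and b_reduced: "\<And>j. card N * (a j + 1) \<le> b j"
    and b_tower: "\<And>j. tower j + card N + 2 \<le> b j"
    and R_bound: "\<And>j c f. R j c f < 2 ^ (card N * (a j + 1))"
    and R_proper: "\<And>j c f c' f' s. s \<in> N \<Longrightarrow> c < 2 ^ 2 ^ a j \<Longrightarrow> c' < 2 ^ 2 ^ a j \<Longrightarrow> c \<noteq> c' \<Longrightarrow>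
      f s = c' \<Longrightarrow> R j c f \<noteq> R j c' f'"
begin

text \<open>The label 1 yields the value \<open>2 ^ (b j - 1)\<close>, so one bit is held in reserve
  for the result to fit into \<open>b j\<close> bits.\<close>

definition digits :: "nat \<Rightarrow> real \<Rightarrow> int" where
  "digits j y = \<lfloor>2 ^ (b j - 1) * y\<rfloor>"

definition level :: "(vertex \<Rightarrow> real) \<Rightarrow> vertex \<Rightarrow> nat" where
  "level x v = (LEAST j. \<forall>s\<in>N. digits j (x v) \<noteq> digits j (x (v + s)))"

text \<open>The colours are proper only among the vertices of level \<open>j\<close>; after \<open>m\<close> rounds they have
  \<open>b (j - m)\<close> bits.\<close>

primrec reduced :: "(vertex \<Rightarrow> real) \<Rightarrow> nat \<Rightarrow> nat \<Rightarrow> vertex \<Rightarrow> nat" where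
  "reduced x j 0 v = nat (digits j (x v))"
| "reduced x j (Suc m) v = R (j - Suc m) (reduced x j m v) (\<lambda>s\<in>N. reduced x j m (v + s))"

definition palette :: nat where
  "palette = 2 ^ b 0"

text \<open>The pair of level and reduced colour in base \<open>palette\<close>: since the second
  entry is below \<open>palette\<close> for labels in the unit interval, the order is lexicographic
  and both entries can be recovered.\<close>

definition key :: "(vertex \<Rightarrow> real) \<Rightarrow> vertex \<Rightarrow> nat" where
  "key x v = level x v * palette + reduced x (level x v) (level x v) v"

text \<open>The argument \<open>n\<close> is fuel for the recursion along decreasing keys; the value
  is stable once \<open>n\<close> exceeds the key (\<open>greedy_eq_color\<close>).\<close>

primrec greedy :: "(vertex \<Rightarrow> real) \<Rightarrow> nat \<Rightarrow> vertex \<Rightarrow> nat" where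
  "greedy x 0 v = 0"
| "greedy x (Suc n) v = (LEAST c. \<forall>s\<in>N. key x (v + s) < key x v \<longrightarrow> greedy x n (v + s) \<noteq> c)"

definition color :: "(vertex \<Rightarrow> real) \<Rightarrow> vertex \<Rightarrow> nat" where
  "color x v = greedy x (Suc (key x v)) v"

lemma N_grid: "s \<in> N \<Longrightarrow> s \<in> grid d"
  using N_cube by (blast intro: cube_grid)

lemma reduced_less:
  assumes "x \<in> space (random_labels d)" "v \<in> grid d" "m \<le> j"
  shows "reduced x j m v < 2 ^ b (j - m)"
proof (cases m)
  case 0
  have xv: "x v \<in> {0..1}" using assms by (auto simp: space_random_labels PiE_iff)
  have "0 < b j" using b_tower[of j] by simp
  have "2 ^ (b j - 1) * x v \<le> 2 ^ (b j - 1)" using xv by (simp add: mult_left_le)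
  then have "2 ^ (b j - 1) * x v < 2 ^ (b j - 1) + 1" by linarith
  then have "digits j (x v) \<le> 2 ^ (b j - 1)"
    unfolding digits_def by (simp add: floor_le_iff)
  also have "(2 :: int) ^ (b j - 1) < 2 ^ b j"
    using \<open>0 < b j\<close> by (intro power_strict_increasing) auto
  finally have "nat (digits j (x v)) < 2 ^ b j"
    by (simp add: nat_less_iff zless_nat_conj flip: of_nat_less_iff[where 'a = int])
  then show ?thesis using 0 by simp
next
  case (Suc n)
  have "reduced x j m v < 2 ^ (card N * (a (j - m) + 1))" unfolding Suc reduced.simps by (rule R_bound)
  also have "\<dots> \<le> 2 ^ b (j - m)" using b_reduced by (intro power_increasing) auto
  finally show ?thesis .
qed

text \<open>Properness survives along a single edge: \<open>v\<close> reads the colour of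
  \<open>v + s\<close> at \<open>s\<close>, and \<open>R_proper\<close> asks nothing of the other
  neighbours. So a vertex whose own digits at level \<open>j\<close> differ from those of its
  neighbours stays distinguished from them, even if they clash elsewhere.\<close>

lemma reduced_proper:
  assumes x: "x \<in> space (random_labels d)" and s: "s \<in> N" and v: "v \<in> grid d" and "m \<le> j"
    and ne: "digits j (x v) \<noteq> digits j (x (v + s))"
  shows "reduced x j m v \<noteq> reduced x j m (v + s)"
  using \<open>m \<le> j\<close>
proof (induction m)
  case 0
  have "x v \<in> {0..1}" "x (v + s) \<in> {0..1}"
    using x v grid_add[OF v N_grid[OF s]] by (auto simp: space_random_labels PiE_iff)
  then have "0 \<le> digits j (x v)" "0 \<le> digits j (x (v + s))" by (simp_all add: digits_def)
  then show ?case using ne by (simp add: eq_nat_nat_iff)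
next
  case (Suc m)
  have eq: "j - m = Suc (j - Suc m)" using Suc.prems by simp
  have "reduced x j m w < 2 ^ 2 ^ a (j - Suc m)" if "w \<in> grid d" for w
    using reduced_less[OF x that, of m j] Suc.prems b_Suc[of "j - Suc m"] eq by simp
  then show ?case
    using Suc R_proper[of s] s v grid_add[OF v N_grid[OF s]] by simp
qed

lemma reduced_less_palette:
  assumes "x \<in> space (random_labels d)" "v \<in> grid d"
  shows "reduced x j j v < palette"
  using reduced_less[OF assms order_refl] by (simp add: palette_def)

lemma palette_pos: "0 < palette"
  by (simp add: palette_def)

lemma level_le_key: "level x v \<le> key x v"
proof -
  have "level x v * 1 \<le> level x v * palette" using palette_pos by (intro mult_left_mono) auto
  then show ?thesis unfolding key_def by linarith
qed

text \<open>Equal keys mean equal levels and equal reduced colours, but at its own level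
  \<open>v\<close> differs in digits from all its neighbours. The assumption \<open>ex\<close>
  guarantees that the \<open>LEAST\<close> in \<open>level\<close> is attained.\<close>

lemma key_neq:
  assumes x: "x \<in> space (random_labels d)" and v: "v \<in> grid d" and s: "s \<in> N"
    and ex: "\<exists>j. \<forall>s\<in>N. digits j (x v) \<noteq> digits j (x (v + s))"
  shows "key x v \<noteq> key x (v + s)"
proof
  assume eq: "key x v = key x (v + s)"
  have vs: "v + s \<in> grid d" using grid_add[OF v N_grid[OF s]] .
  have div: "key x u div palette = level x u" if "u \<in> grid d" for u
    using reduced_less_palette[OF x that, of "level x u"] by (simp add: key_def)
  have lev: "level x v = level x (v + s)" using div[OF v] div[OF vs] eq by simp
  have "\<forall>s\<in>N. digits (level x v) (x v) \<noteq> digits (level x v) (x (v + s))"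
    unfolding level_def by (rule LeastI_ex) (rule ex)
  then have "reduced x (level x v) (level x v) v \<noteq> reduced x (level x v) (level x v) (v + s)"
    using s by (intro reduced_proper x v) auto
  then show False using eq lev by (simp add: key_def)
qed

lemma greedy_eq_color: "key x v < n \<Longrightarrow> greedy x n v = color x v"
proof (induction n arbitrary: v rule: less_induct)
  case (less n)
  then obtain m where m: "n = Suc m" by (cases n) auto
  have "greedy x m (v + s) = greedy x (key x v) (v + s)" if "key x (v + s) < key x v" for s
    using less.IH[of m "v + s"] less.IH[of "key x v" "v + s"] that less.prems by (simp add: m)
  then have "(\<forall>s\<in>N. key x (v + s) < key x v \<longrightarrow> greedy x m (v + s) \<noteq> c) \<longleftrightarrow>
      (\<forall>s\<in>N. key x (v + s) < key x v \<longrightarrow> greedy x (key x v) (v + s) \<noteq> c)" for c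
    by auto
  then show ?case by (simp only: m color_def greedy.simps)
qed

lemma color_eq:
  "color x v = (LEAST c. \<forall>s\<in>N. key x (v + s) < key x v \<longrightarrow> color x (v + s) \<noteq> c)"
proof -
  have "(\<forall>s\<in>N. key x (v + s) < key x v \<longrightarrow> greedy x (key x v) (v + s) \<noteq> c) \<longleftrightarrow>
      (\<forall>s\<in>N. key x (v + s) < key x v \<longrightarrow> color x (v + s) \<noteq> c)" for c
    using greedy_eq_color by auto
  then show ?thesis by (simp only: color_def[of x v] greedy.simps)
qed

lemma unused_color_exists: "\<exists>c\<le>card N. \<forall>s\<in>N. f s \<noteq> (c :: nat)"
proof -
  have "card (f ` N) < card {..card N}"
    using card_image_le[OF finite_N, of f] by simp
  then have "\<not> {..card N} \<subseteq> f ` N"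
    using card_mono[OF finite_imageI[OF finite_N]] by (meson not_less)
  then obtain c where "c \<le> card N" "c \<notin> f ` N" by blast
  then show ?thesis by blast
qed

lemma color_le: "color x v \<le> card N"
  and color_neq_if_key_less: "s \<in> N \<Longrightarrow> key x (v + s) < key x v \<Longrightarrow> color x (v + s) \<noteq> color x v"
proof -
  define P where "P = (\<lambda>c. \<forall>s\<in>N. key x (v + s) < key x v \<longrightarrow> color x (v + s) \<noteq> c)"
  have eq: "color x v = Least P" unfolding P_def by (rule color_eq)
  obtain c where c: "c \<le> card N" "P c"
    unfolding P_def using unused_color_exists[of "\<lambda>s. color x (v + s)"] by blast
  have "Least P \<le> c" by (rule Least_le) (rule c)
  then show "color x v \<le> card N" using c(1) eq by simp
  have "P (Least P)" by (rule LeastI) (rule c)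
  then show "s \<in> N \<Longrightarrow> key x (v + s) < key x v \<Longrightarrow> color x (v + s) \<noteq> color x v"
    unfolding eq by (simp add: P_def)
qed

lemma color_neq:
  assumes "s \<in> N" "key x v \<noteq> key x (v + s)"
  shows "color x v \<noteq> color x (v + s)"
proof (cases "key x (v + s) < key x v")
  case True
  then show ?thesis using color_neq_if_key_less[OF assms(1) True] by (rule_tac not_sym)
next
  case False
  then have "key x (v + s + - s) < key x (v + s)" using assms(2) by simp
  from color_neq_if_key_less[OF N_sym[OF assms(1)] this] show ?thesis by simp
qed

lemma reduced_agree:
  "agree d (k * m) x v x' v' \<Longrightarrow> reduced x j m v = reduced x' j m v'"
proof (induction m arbitrary: v v')
  case 0
  then show ?case using agree_root[of d "k * 0" x v x' v'] by simp
next
  case (Suc m)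
  have "reduced x j m (v + s) = reduced x' j m (v' + s)" if "s \<in> N" for s
    by (rule Suc.IH[OF agree_move[OF Suc.prems, of s k]]) (use that N_cube in auto)
  moreover have "reduced x j m v = reduced x' j m v'"
    by (rule Suc.IH[OF agree_mono[OF Suc.prems]]) simp
  ultimately show ?case by (simp cong: restrict_cong)
qed

lemma level_agree:
  assumes "agree d k x v x' v'"
  shows "level x v = level x' v'"
proof -
  have "x (v + s) = x' (v' + s)" if "s \<in> N" for s
    using agreeD[OF assms] that N_cube by blast
  then show ?thesis using agree_root[OF assms] by (simp add: level_def)
qed

lemma key_agree:
  assumes "agree d (k * n) x v x' v'" "key x v < n"
  shows "key x' v' = key x v"
proof -
  have "0 < n" using assms(2) by simp
  then have lev: "level x v = level x' v'" by (intro level_agree agree_mono[OF assms(1)]) simp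
  have "level x v \<le> n" using level_le_key[of x v] assms(2) by simp
  then have "reduced x (level x v) (level x v) v = reduced x' (level x v) (level x v) v'"
    by (intro reduced_agree agree_mono[OF assms(1)]) simp
  then show ?thesis using lev by (simp add: key_def)
qed

text \<open>With \<open>n\<close> the key of \<open>v\<close>, the radius pays for two things:
  comparing \<open>n\<close> with the key of a neighbour takes \<open>k + k * Suc n\<close>, and the
  colour of a neighbour of smaller key takes at most \<open>k + 2 * k * n\<close>. Both are at most
  \<open>2 * k * Suc n\<close>.\<close>

lemma color_agree:
  "agree d (2 * k * Suc (key x v)) x v x' v' \<Longrightarrow> color x v = color x' v'"
proof (induction "key x v" arbitrary: v v' rule: less_induct)
  case less
  let ?n = "key x v"
  have n': "key x' v' = ?n"
    by (rule key_agree[where n = "Suc ?n"]) (auto intro: agree_mono[OF less.prems])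
  have ag: "agree d (k * Suc ?n) x (v + s) x' (v' + s)" if "s \<in> N" for s
    by (rule agree_move[OF less.prems, of s k]) (use that N_cube in auto)
  have iff: "key x (v + s) < ?n \<longleftrightarrow> key x' (v' + s) < ?n" if s: "s \<in> N" for s
    using key_agree[OF ag[OF s]] key_agree[OF agree_sym[OF ag[OF s]]] by (metis less_SucI)
  have eq: "color x (v + s) = color x' (v' + s)" if s: "s \<in> N" and lt: "key x (v + s) < ?n" for s
  proof (rule less.hyps[OF lt])
    have "k + 2 * k * Suc (key x (v + s)) \<le> 2 * k * Suc ?n"
      using mult_le_mono2[of "Suc (key x (v + s))" ?n "2 * k"] lt by simp
    then show "agree d (2 * k * Suc (key x (v + s))) x (v + s) x' (v' + s)"
      using s N_cube by (intro agree_move[OF less.prems]) auto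
  qed
  have "(key x (v + s) < ?n \<longrightarrow> color x (v + s) \<noteq> c) \<longleftrightarrow> (key x' (v' + s) < ?n \<longrightarrow> color x' (v' + s) \<noteq> c)"
    if "s \<in> N" for s c
    using iff[OF that] eq[OF that] by argo
  then show ?case unfolding color_eq[of x v] color_eq[of x' v'] n' by (simp only: cong: ball_cong)
qed

section \<open>Measurability, tail and almost sure properness of the colouring\<close>

context
  fixes S :: "'w measure" and y :: "'w \<Rightarrow> vertex \<Rightarrow> real"
  assumes y [measurable]: "\<And>v. (\<lambda>\<omega>. y \<omega> v) \<in> borel_measurable S"
begin

lemma measurable_level: "(\<lambda>\<omega>. level (y \<omega>) v) \<in> S \<rightarrow>\<^sub>M count_space UNIV"
  unfolding level_def digits_def
  by (intro measurable_Least pred_intros_finite finite_N) measurable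

lemma measurable_reduced: "(\<lambda>\<omega>. reduced (y \<omega>) j m v) \<in> S \<rightarrow>\<^sub>M count_space UNIV"
proof (induction m arbitrary: v)
  case 0
  have "(\<lambda>\<omega>. digits j (y \<omega> v)) \<in> S \<rightarrow>\<^sub>M count_space UNIV" unfolding digits_def by measurable
  then show ?case by (simp add: measurable_compose[where g = nat])
next
  case (Suc m)
  have "(\<lambda>\<omega>. R (j - Suc m) c (\<lambda>s\<in>N. reduced (y \<omega>) j m (v + s))) \<in> S \<rightarrow>\<^sub>M count_space UNIV" for c
    by (rule measurable_finite_family[OF finite_N]) (rule Suc)
  then show ?case
    unfolding reduced.simps by (rule measurable_compose_countable[OF _ Suc])
qed

lemma measurable_key: "(\<lambda>\<omega>. key (y \<omega>) v) \<in> S \<rightarrow>\<^sub>M count_space UNIV"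
proof -
  have "(\<lambda>\<omega>. l * palette + reduced (y \<omega>) l l v) \<in> S \<rightarrow>\<^sub>M count_space UNIV" for l
    by (rule measurable_compose[OF measurable_reduced]) simp
  then show ?thesis
    unfolding key_def by (rule measurable_compose_countable[OF _ measurable_level])
qed

lemma measurable_color: "(\<lambda>\<omega>. color (y \<omega>) v) \<in> S \<rightarrow>\<^sub>M count_space UNIV"
proof -
  have lt: "Measurable.pred S (\<lambda>\<omega>. key (y \<omega>) u < key (y \<omega>) v)" for u v
  proof (rule measurable_compose_countable[OF _ measurable_key])
    show "Measurable.pred S (\<lambda>\<omega>. key (y \<omega>) u < l)" for l
      by (rule measurable_compose[OF measurable_key]) simp
  qed
  have g: "(\<lambda>\<omega>. greedy (y \<omega>) n v) \<in> S \<rightarrow>\<^sub>M count_space UNIV" for n v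
  proof (induction n arbitrary: v)
    case 0
    then show ?case by simp
  next
    case (Suc n)
    have "Measurable.pred S (\<lambda>\<omega>. greedy (y \<omega>) n u = c)" for u c
      by (rule measurable_compose[OF Suc]) simp
    then show ?case unfolding greedy.simps
      by (intro measurable_Least pred_intros_finite pred_intros_logic finite_N lt)
  qed
  have "(\<lambda>\<omega>. greedy (y \<omega>) (Suc l) v) \<in> S \<rightarrow>\<^sub>M count_space UNIV" for l by (rule g)
  then show ?thesis
    unfolding color_def by (rule measurable_compose_countable[OF _ measurable_key])
qed

end

lemma prob_same_digits_le:
  assumes v: "v \<in> grid d"
  shows "{x \<in> space (random_labels d). \<exists>s\<in>N. digits j (x v) = digits j (x (v + s))} \<in> sets (random_labels d)"
    and "measure (random_labels d) {x \<in> space (random_labels d). \<exists>s\<in>N. digits j (x v) = digits j (x (v + s))}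
      \<le> 1 / tower (Suc j)"
proof -
  let ?M = "random_labels d"
  let ?E = "\<lambda>s. {x \<in> space ?M. \<lfloor>2 ^ (b j - 1) * x v\<rfloor> = \<lfloor>2 ^ (b j - 1) * x (v + s)\<rfloor>}"
  have E: "?E s \<in> sets ?M" if "s \<in> N" for s
  proof -
    note borel_measurable_label[OF v, measurable] borel_measurable_label[OF grid_add[OF v N_grid[OF that]], measurable]
    show ?thesis by measurable
  qed
  have eq: "{x \<in> space ?M. \<exists>s\<in>N. digits j (x v) = digits j (x (v + s))} = (\<Union>s\<in>N. ?E s)"
    by (auto simp: digits_def)
  show "{x \<in> space ?M. \<exists>s\<in>N. digits j (x v) = digits j (x (v + s))} \<in> sets ?M"
    unfolding eq using E finite_N by (intro sets.finite_UN) auto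
  have "measure ?M (\<Union>s\<in>N. ?E s) \<le> (\<Sum>s\<in>N. measure ?M (?E s))"
    using E finite_N by (intro measure_UNION_le) auto
  also have "\<dots> \<le> (\<Sum>s\<in>N. 2 / 2 ^ (b j - 1))"
    using v N_grid zero_N by (intro sum_mono prob_same_digits grid_add) auto
  also have "\<dots> = real (card N) * 2 / 2 ^ (b j - 1)" by simp
  also have "\<dots> \<le> 1 / tower (Suc j)"
  proof -
    \<comment> \<open>\<open>card N\<close> is bounded by \<open>2 ^ card N\<close>; with the factor
      2 and the reserved bit this accounts for
      \<open>tower j + card N + 2 \<le> b j\<close>.\<close>
    have "real (card N) * 2 * tower (Suc j) \<le> 2 ^ card N * 2 * 2 ^ tower j"
      using less_exp[of "card N"] by (simp flip: of_nat_power_less_of_nat_cancel_iff add: less_imp_le)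
    also have "\<dots> = 2 ^ (card N + 1 + tower j)" by (simp add: power_add)
    also have "\<dots> \<le> 2 ^ (b j - 1)"
      using b_tower[of j] by (intro power_increasing) auto
    finally show ?thesis using tower_pos[of "Suc j"] by (simp add: field_simps del: tower.simps)
  qed
  finally show "measure ?M {x \<in> space ?M. \<exists>s\<in>N. digits j (x v) = digits j (x (v + s))} \<le> 1 / tower (Suc j)"
    by (simp only: eq)
qed

text \<open>A key this large forces a level above \<open>j\<close>, hence a clash of digits at level
  \<open>j\<close> with some neighbour.\<close>

lemma prob_key_ge:
  assumes v: "v \<in> grid d"
  shows "measure (random_labels d) {x \<in> space (random_labels d). Suc j * palette \<le> key x v} \<le> 1 / tower (Suc j)"
proof (rule order_trans[OF random_labels.finite_measure_mono[OF subsetI prob_same_digits_le(1)] prob_same_digits_le(2)])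
  fix x assume x: "x \<in> {x \<in> space (random_labels d). Suc j * palette \<le> key x v}"
  then have xs: "x \<in> space (random_labels d)" by simp
  have "key x v < Suc (level x v) * palette"
    using reduced_less_palette[OF xs v, of "level x v"] by (simp add: key_def)
  moreover have "Suc j * palette \<le> key x v" using x by blast
  ultimately have "Suc j * palette < Suc (level x v) * palette" by (rule le_less_trans[rotated])
  then have "j < level x v" by (simp only: mult_less_cancel2 Suc_less_eq)
  then have "\<not> (\<forall>s\<in>N. digits j (x v) \<noteq> digits j (x (v + s)))"
    unfolding level_def by (rule not_less_Least)
  then show "x \<in> {x \<in> space (random_labels d). \<exists>s\<in>N. digits j (x v) = digits j (x (v + s))}"
    using xs by simp
qed (fact v)+

text \<open>A vertex without a level has clashing digits at every \<open>j\<close>, with probability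
  at most \<open>1 / tower (Suc j)\<close> for all \<open>j\<close>. Outside the countable union of
  these null events keys, hence colours, differ along all edges.\<close>

lemma AE_color_proper:
  "AE x in random_labels d. \<forall>v\<in>grid d. \<forall>s\<in>N. color x v \<noteq> color x (v + s)"
proof -
  let ?M = "random_labels d"
  have "AE x in ?M. \<exists>j. \<forall>s\<in>N. digits j (x v) \<noteq> digits j (x (v + s))" if v: "v \<in> grid d" for v
  proof (rule AE_I)
    let ?E = "\<lambda>j. {x \<in> space ?M. \<exists>s\<in>N. digits j (x v) = digits j (x (v + s))}"
    show "{x \<in> space ?M. \<not> (\<exists>j. \<forall>s\<in>N. digits j (x v) \<noteq> digits j (x (v + s)))} \<subseteq> (\<Inter>j. ?E j)"
      by auto
    show meas: "(\<Inter>j. ?E j) \<in> sets ?M"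
      using prob_same_digits_le(1)[OF v] by (intro sets.countable_INT) auto
    have "measure ?M (\<Inter>j. ?E j) \<le> 1 / real (Suc j)" for j
    proof -
      have "measure ?M (\<Inter>j. ?E j) \<le> measure ?M (?E j)"
        by (rule random_labels.finite_measure_mono[OF _ prob_same_digits_le(1)[OF v]]) auto
      also have "\<dots> \<le> 1 / tower (Suc j)" by (rule prob_same_digits_le(2)[OF v])
      also have "\<dots> \<le> 1 / real (Suc j)"
        using tower_add[of 0 "Suc j"] by (intro divide_left_mono) (auto simp del: tower.simps simp: tower_pos)
      finally show ?thesis .
    qed
    then have "measure ?M (\<Inter>j. ?E j) \<le> 0"
      by (intro LIMSEQ_le_const[OF LIMSEQ_inverse_real_of_nat]) (auto simp: inverse_eq_divide)
    then show "emeasure ?M (\<Inter>j. ?E j) = 0"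
      by (simp add: random_labels.emeasure_eq_measure measure_le_0_iff)
  qed
  then have "AE x in ?M. \<forall>v\<in>grid d. \<exists>j. \<forall>s\<in>N. digits j (x v) \<noteq> digits j (x (v + s))"
    by (intro AE_ball_countable[THEN iffD2] countable_grid) auto
  with AE_space show ?thesis
    by eventually_elim (use key_neq color_neq in blast)
qed

end

lemma reduction_exists:
  assumes "finite N" "N \<subseteq> cube d k" "0 \<notin> N" "\<And>s. s \<in> N \<Longrightarrow> - s \<in> N" "N \<noteq> {}"
  shows "\<exists>a b R. reduction d k N a b R"
proof -
  have "0 < card N" using assms by (simp add: card_gt_0_iff)
  then obtain a b where ab: "\<And>j. b (Suc j) = 2 ^ a j" "\<And>j. card N * (a j + 1) \<le> b j"
    "\<And>j. tower j + card N + 2 \<le> b j"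
    using reduction_lengths_exist by meson
  have "\<forall>j. \<exists>R :: nat \<Rightarrow> (vertex \<Rightarrow> nat) \<Rightarrow> nat. (\<forall>c f. R c f < 2 ^ (card N * (a j + 1))) \<and>
    (\<forall>c f c' f' s. s \<in> N \<longrightarrow> c < 2 ^ 2 ^ a j \<longrightarrow> c' < 2 ^ 2 ^ a j \<longrightarrow> c \<noteq> c' \<longrightarrow> f s = c' \<longrightarrow> R c f \<noteq> R c' f')"
    using color_reduction_exists[OF assms(1)] by blast
  from choice[OF this] obtain R :: "nat \<Rightarrow> nat \<Rightarrow> (vertex \<Rightarrow> nat) \<Rightarrow> nat"
    where R: "\<And>j. (\<forall>c f. R j c f < 2 ^ (card N * (a j + 1))) \<and>
      (\<forall>c f c' f' s. s \<in> N \<longrightarrow> c < 2 ^ 2 ^ a j \<longrightarrow> c' < 2 ^ 2 ^ a j \<longrightarrow> c \<noteq> c' \<longrightarrow> f s = c' \<longrightarrow>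
        R j c f \<noteq> R j c' f')"
    by blast
  have "reduction d k N a b R"
    by unfold_locales (use assms ab R in blast)+
  then show ?thesis by blast
qed

text \<open>The arguments stand for inputs, net, colouring and tape. \<open>P1\<close> and
  \<open>P4\<close> carry the invariants that inputs are legal labels and that tape values lie in
  the unit interval; \<open>step_agree\<close> needs them for the measurability of failure
  events.\<close>

lemma local_rule_map4:
  assumes F: "local_rule d F1" "local_rule d F2" "local_rule d F3" "local_rule d F4"
    and P: "\<And>l. P1 (F1 l)" "\<And>l. P4 (F4 l)"
    and G: "\<And>f1 f1' f2 f2' f3 f3' f4 f4' v v'. v \<in> grid d \<Longrightarrow> v' \<in> grid d \<Longrightarrow> P1 f1 \<Longrightarrow> P4 f4 \<Longrightarrow>
      agree d k f1 v f1' v' \<Longrightarrow> agree d k f2 v f2' v' \<Longrightarrow> agree d k f3 v f3' v' \<Longrightarrow>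
      agree d k f4 v f4' v' \<Longrightarrow> G f1 f2 f3 f4 v = G f1' f2' f3' f4' v'"
  shows "local_rule d (\<lambda>l. G (F1 l) (F2 l) (F3 l) (F4 l))"
proof -
  let ?T = "\<lambda>l v. (F1 l v, F2 l v, F3 l v, F4 l v)"
  obtain a where a: "\<And>l l' v v'. v \<in> grid d \<Longrightarrow> v' \<in> grid d \<Longrightarrow> agree d a l v l' v' \<Longrightarrow> ?T l v = ?T l' v'"
    using local_rule_pair[OF F(1) local_rule_pair[OF F(2) local_rule_pair[OF F(3,4)]]]
    by (rule local_ruleE) blast
  show ?thesis
  proof (rule local_ruleI[where k = "k + a"])
    fix l l' :: "vertex \<Rightarrow> 'a" and v v'
    assume v: "v \<in> grid d" "v' \<in> grid d" and ag: "agree d (k + a) l v l' v'"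
    have "?T l (v + u) = ?T l' (v' + u)" if "u \<in> cube d k" for u
      using a[OF grid_add[OF v(1) cube_grid[OF that]] grid_add[OF v(2) cube_grid[OF that]]
        agree_move[OF ag that order_refl]] .
    then show "G (F1 l) (F2 l) (F3 l) (F4 l) v = G (F1 l') (F2 l') (F3 l') (F4 l') v'"
      by (intro G v P) (simp_all add: agree_def)
  qed
qed

section \<open>Truncated runs and nets\<close>

text \<open>Unlike \<open>output_label\<close>, this is determined by the labels within distance
  \<open>r\<close>, for every labelling; \<open>None\<close> marks a late vertex.\<close>

definition early_output :: "nat \<Rightarrow> uniform_alg \<Rightarrow> nat \<Rightarrow> (vertex \<Rightarrow> nat) \<Rightarrow> (vertex \<Rightarrow> real) \<Rightarrow> vertex \<Rightarrow> nat option" where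
  "early_output d A r \<sigma> x v =
     (if \<exists>s\<le>r. explored d \<sigma> x v s \<in> stops A
      then Some (result A (explored d \<sigma> x v (LEAST s. s \<le> r \<and> explored d \<sigma> x v s \<in> stops A)))
      else None)"

lemma early_output_cong:
  assumes "\<And>s. s \<le> r \<Longrightarrow> explored d \<sigma> x v s = explored d \<sigma>' x' v' s"
  shows "early_output d A r \<sigma> x v = early_output d A r \<sigma>' x' v'"
proof -
  let ?P = "\<lambda>s. s \<le> r \<and> explored d \<sigma> x v s \<in> stops A" and ?P' = "\<lambda>s. s \<le> r \<and> explored d \<sigma>' x' v' s \<in> stops A"
  have eq: "?P = ?P'" using assms by auto
  have "explored d \<sigma> x v (Least ?P) = explored d \<sigma>' x' v' (Least ?P)" if "\<exists>s. ?P s"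
    using LeastI_ex[OF that] assms by blast
  then show ?thesis unfolding early_output_def using eq by (metis (no_types, lifting))
qed

lemma early_output_agree:
  assumes "agree d r \<sigma> v \<sigma>' v'" "agree d r x v x' v'"
  shows "early_output d A r \<sigma> x v = early_output d A r \<sigma>' x' v'"
  by (rule early_output_cong) (simp add: explored_def agree_nbhd[OF assms(1)] agree_nbhd[OF assms(2)])

lemma early_output_None_iff:
  "early_output d A r \<sigma> x v = None \<longleftrightarrow> ereal_of_enat (coding_radius d A \<sigma> x v) > ereal (real r)"
  by (auto simp: coding_radius_gt_iff early_output_def)

lemma early_output_Some:
  assumes "early_output d A r \<sigma> x v = Some y"
  shows "output_label d A \<sigma> x v = y"
proof -
  let ?P = "\<lambda>s. s \<le> r \<and> explored d \<sigma> x v s \<in> stops A"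
  define n where "n = Least ?P"
  have ex: "\<exists>s. ?P s" and y: "y = result A (explored d \<sigma> x v n)"
    using assms by (auto simp: early_output_def n_def split: if_splits)
  have n: "?P n" unfolding n_def by (rule LeastI_ex) (rule ex)
  have le: "n \<le> s" if "explored d \<sigma> x v s \<in> stops A" for s
  proof (cases "s \<le> r")
    case True
    then show ?thesis unfolding n_def using that by (intro Least_le) simp
  next
    case False
    then show ?thesis using n by simp
  qed
  have "coding_radius d A \<sigma> x v = enat n"
    unfolding coding_radius_def by (rule INF_eqI) (use n le in auto)
  then show ?thesis by (simp add: output_label_def y)
qed

text \<open>\<open>result\<close> is measurable only on the stopping sets, so the event of a given
  output is split by the first radius at which the run stops.\<close>

lemma measurable_early_output:
  assumes A: "is_uniform_alg d Sin Sout A" and v: "v \<in> grid d" and \<sigma>: "\<sigma> \<in> grid d \<rightarrow> Sin"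
  shows "(\<lambda>x. early_output d A r \<sigma> x v) \<in> random_labels d \<rightarrow>\<^sub>M count_space UNIV"
proof -
  let ?M = "random_labels d"
  define E where "E s = {x \<in> space ?M. explored d \<sigma> x v s \<in> stops A}" for s
  define F where "F s y = {x \<in> space ?M. explored d \<sigma> x v s \<in> stops A \<and> result A (explored d \<sigma> x v s) = y}" for s y
  have nb: "nbhd d \<sigma> v s \<in> gball d 0 s \<rightarrow>\<^sub>E Sin" for s
    using \<sigma> v by (auto simp: nbhd_def dest!: gball_grid intro: grid_add)
  let ?P = "\<lambda>s. PiM (gball d 0 s) (\<lambda>_. unit_labels)"
  have stops: "{y. (s, nbhd d \<sigma> v s, y) \<in> stops A} \<in> sets (?P s)"
    and res: "(\<lambda>y. result A (s, nbhd d \<sigma> v s, y)) \<in>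
      restrict_space (?P s) {y. (s, nbhd d \<sigma> v s, y) \<in> stops A} \<rightarrow>\<^sub>M count_space Sout" for s
    using A nb[of s] by (auto simp: is_uniform_alg_def)
  have E: "E s \<in> sets ?M" for s
  proof -
    have "E s = (\<lambda>x. nbhd d x v s) -` {y. (s, nbhd d \<sigma> v s, y) \<in> stops A} \<inter> space ?M"
      by (auto simp: E_def explored_def)
    then show ?thesis using measurable_sets[OF measurable_nbhd[OF v] stops] by metis
  qed
  have F: "F s y \<in> sets ?M" for s y
  proof -
    let ?\<Omega> = "{y. (s, nbhd d \<sigma> v s, y) \<in> stops A}"
    have "(\<lambda>y. result A (s, nbhd d \<sigma> v s, y)) \<in> restrict_space (?P s) ?\<Omega> \<rightarrow>\<^sub>M count_space UNIV"
      by (rule measurable_compose[OF res, where g = "\<lambda>y. y"]) auto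
    then have "(\<lambda>y. result A (s, nbhd d \<sigma> v s, y)) -` {y} \<inter> space (restrict_space (?P s) ?\<Omega>)
        \<in> sets (restrict_space (?P s) ?\<Omega>)"
      by (rule measurable_sets) simp
    then have "(\<lambda>y. result A (s, nbhd d \<sigma> v s, y)) -` {y} \<inter> space (restrict_space (?P s) ?\<Omega>) \<in> sets (?P s)"
      using sets_restrict_space_iff[of ?\<Omega> "?P s"] sets.Int_space_eq2[OF stops] stops by auto
    from measurable_sets[OF measurable_nbhd[OF v] this]
    have "(\<lambda>x. nbhd d x v s) -` ((\<lambda>y. result A (s, nbhd d \<sigma> v s, y)) -` {y} \<inter>
        space (restrict_space (?P s) ?\<Omega>)) \<inter> space ?M \<in> sets ?M" .
    also have "(\<lambda>x. nbhd d x v s) -` ((\<lambda>y. result A (s, nbhd d \<sigma> v s, y)) -` {y} \<inter>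
        space (restrict_space (?P s) ?\<Omega>)) \<inter> space ?M = F s y"
      using measurable_space[OF measurable_nbhd[OF v, of s]]
      by (auto simp: F_def explored_def space_restrict_space)
    finally show ?thesis .
  qed
  have None: "{x \<in> space ?M. early_output d A r \<sigma> x v = None} \<in> sets ?M"
  proof -
    have "{x \<in> space ?M. early_output d A r \<sigma> x v = None} = space ?M - (\<Union>s\<in>{..r}. E s)"
      by (auto simp: early_output_def E_def)
    then show ?thesis using E by auto
  qed
  have Some: "{x \<in> space ?M. early_output d A r \<sigma> x v = Some y} \<in> sets ?M" for y
  proof -
    have "{x \<in> space ?M. early_output d A r \<sigma> x v = Some y} =
      (\<Union>s\<in>{..r}. F s y \<inter> (space ?M - (\<Union>s'\<in>{..<s}. E s')))" (is "?L = ?R")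
    proof (intro set_eqI iffI)
      fix x assume x: "x \<in> ?L"
      define n where "n = (LEAST s. s \<le> r \<and> explored d \<sigma> x v s \<in> stops A)"
      have ex: "\<exists>s. s \<le> r \<and> explored d \<sigma> x v s \<in> stops A" and y: "result A (explored d \<sigma> x v n) = y"
        using x by (auto simp: early_output_def n_def split: if_splits)
      have n: "n \<le> r \<and> explored d \<sigma> x v n \<in> stops A" unfolding n_def by (rule LeastI_ex) (rule ex)
      have "explored d \<sigma> x v s' \<notin> stops A" if "s' < n" for s'
        using not_less_Least[OF that[unfolded n_def]] that n by auto
      then have "x \<in> F n y \<inter> (space ?M - (\<Union>s'\<in>{..<n}. E s'))"
        using x y n by (simp add: F_def E_def)
      then show "x \<in> ?R" using n by blast
    next
      fix x assume "x \<in> ?R"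
      then obtain s where s: "s \<le> r" "x \<in> F s y" "\<And>s'. s' < s \<Longrightarrow> x \<notin> E s'" by auto
      have "s \<le> s'" if "explored d \<sigma> x v s' \<in> stops A" for s'
        using s(3)[of s'] s(2) that by (cases "s \<le> s'") (auto simp: F_def E_def)
      then have "(LEAST s. s \<le> r \<and> explored d \<sigma> x v s \<in> stops A) = s"
        using s by (intro Least_equality) (auto simp: F_def)
      then show "x \<in> ?L" using s by (auto simp: F_def early_output_def)
    qed
    then show ?thesis using E F by auto
  qed
  show ?thesis
  proof (rule measurable_count_space_eq_countable[THEN iffD2])
    have "(\<lambda>x. early_output d A r \<sigma> x v) -` {e} \<inter> space ?M \<in> sets ?M" for e
      using None Some by (cases e) (auto simp: vimage_def Int_def conj_commute)
    then show "(\<lambda>x. early_output d A r \<sigma> x v) \<in> space ?M \<rightarrow> UNIV \<and>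
      (\<forall>e\<in>UNIV. (\<lambda>x. early_output d A r \<sigma> x v) -` {e} \<inter> space ?M \<in> sets ?M)" by auto
  qed simp
qed

text \<open>Translating \<open>v\<close> to the origin and restricting the inputs to the ball turns
  the event into one of those in the supremum that defines \<open>prob_radius_gt\<close>.\<close>

lemma prob_early_output_None:
  assumes A: "is_uniform_alg d Sin Sout A" and v: "v \<in> grid d" and \<sigma>: "\<sigma> \<in> grid d \<rightarrow> Sin"
  shows "emeasure (random_labels d) {x \<in> space (random_labels d). early_output d A r \<sigma> x v = None}
    \<le> prob_radius_gt d Sin A (real r)"
proof -
  let ?M = "random_labels d"
  define \<tau> where "\<tau> = nbhd d \<sigma> v r"
  have \<tau>: "\<tau> \<in> gball d 0 r \<rightarrow>\<^sub>E Sin"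
    using \<sigma> v by (auto simp: \<tau>_def nbhd_def dest!: gball_grid intro: grid_add)
  have "explored d \<sigma> x v s = explored d \<tau> (translate d v x) 0 s" if "s \<le> r" for x s
    using gball_mono[OF that, of d 0]
    by (auto simp: explored_def nbhd_def \<tau>_def translate_def restrict_def fun_eq_iff add.commute dest: gball_grid)
  then have "early_output d A r \<sigma> x v = early_output d A r \<tau> (translate d v x) 0" for x
    by (intro early_output_cong)
  then have "emeasure ?M {x \<in> space ?M. early_output d A r \<sigma> x v = None} =
      emeasure ?M {x \<in> space ?M. ereal_of_enat (coding_radius d A \<tau> (translate d v x) 0) > ereal (real r)}"
    by (simp add: early_output_None_iff)
  also have "\<dots> = emeasure ?M {x \<in> space ?M. ereal_of_enat (coding_radius d A \<tau> x 0) > ereal (real r)}"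
    using \<tau> by (intro emeasure_translate v coding_radius_gt_measurable[OF A]) auto
  also have "\<dots> \<le> prob_radius_gt d Sin A (real r)"
    unfolding prob_radius_gt_def by (rule SUP_upper) (use \<tau> in simp)
  finally show ?thesis .
qed

text \<open>A discrete mean value bound. It estimates the volume between two concentric cubes by
  thickness times surface, which is where the exponent \<open>d - 1\<close> arises.\<close>

lemma power_add_le:
  "(x + y) ^ n \<le> x ^ n + y * n * (x + y :: nat) ^ (n - 1)"
proof (induction n)
  case (Suc n)
  have "(x + y) ^ Suc n = x * (x + y) ^ n + y * (x + y) ^ n" by (simp add: algebra_simps)
  also have "\<dots> \<le> x * (x ^ n + y * n * (x + y) ^ (n - 1)) + y * (x + y) ^ n"
    using Suc by (intro add_right_mono mult_left_mono) auto
  also have "x * (y * n * (x + y) ^ (n - 1)) \<le> y * n * (x + y) ^ n"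
  proof (cases n)
    case (Suc k)
    have "x * (x + y) ^ k \<le> (x + y) ^ Suc k" by simp
    from mult_left_mono[OF this, of "y * n"] show ?thesis by (simp add: Suc algebra_simps)
  qed simp
  then have "x * (x ^ n + y * n * (x + y) ^ (n - 1)) + y * (x + y) ^ n
      \<le> x ^ Suc n + y * n * (x + y) ^ n + y * (x + y) ^ n"
    by (simp add: distrib_left)
  finally show ?case by (simp add: algebra_simps)
qed simp

definition overwrite :: "nat \<Rightarrow> (vertex \<Rightarrow> real option) \<Rightarrow> (vertex \<Rightarrow> real) \<Rightarrow> vertex \<Rightarrow> real" where
  "overwrite d Y x = (\<lambda>v\<in>grid d. case Y v of None \<Rightarrow> x v | Some y \<Rightarrow> y)"

definition valid_tape :: "(vertex \<Rightarrow> real option) \<Rightarrow> bool" where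
  "valid_tape Y \<longleftrightarrow> (\<forall>v y. Y v = Some y \<longrightarrow> y \<in> {0..1})"

lemma measurable_overwrite:
  assumes "valid_tape Y"
  shows "overwrite d Y \<in> random_labels d \<rightarrow>\<^sub>M random_labels d"
proof -
  have "(\<lambda>x. case Y v of None \<Rightarrow> x v | Some y \<Rightarrow> y) \<in> random_labels d \<rightarrow>\<^sub>M unit_labels"
    if "v \<in> grid d" for v
    using assms measurable_label[OF that] by (cases "Y v") (auto simp: valid_tape_def)
  then have "(\<lambda>x. \<lambda>v\<in>grid d. case Y v of None \<Rightarrow> x v | Some y \<Rightarrow> y)
      \<in> random_labels d \<rightarrow>\<^sub>M PiM (grid d) (\<lambda>_. unit_labels)"
    by (intro measurable_restrict)
  moreover have "overwrite d Y = (\<lambda>x. \<lambda>v\<in>grid d. case Y v of None \<Rightarrow> x v | Some y \<Rightarrow> y)"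
    by (simp add: overwrite_def fun_eq_iff)
  ultimately show ?thesis by (simp only: random_labels_def)
qed

text \<open>Greedy maximal independent set in the graph that joins vertices differing by an element
  of \<open>cube d r\<close>; round \<open>i\<close> decides the vertices of colour
  \<open>i\<close>.\<close>

primrec net :: "nat \<Rightarrow> nat \<Rightarrow> (vertex \<Rightarrow> nat) \<Rightarrow> nat \<Rightarrow> vertex \<Rightarrow> bool" where
  "net d r \<kappa> 0 v = False"
| "net d r \<kappa> (Suc i) v = (net d r \<kappa> i v \<or> (\<kappa> v = i \<and> (\<forall>s\<in>cube d r. \<not> net d r \<kappa> i (v + s))))"

lemma net_local: "local_rule d (\<lambda>\<kappa>. net d r \<kappa> i)"
proof (induction i)
  case 0
  then show ?case by (intro local_ruleI) simp
next
  case (Suc i)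
  have "local_rule d (\<lambda>\<kappa> :: vertex \<Rightarrow> nat. \<kappa>)" using local_rule_pointwise[of d "\<lambda>y. y"] by simp
  note id = this
  define G :: "(vertex \<Rightarrow> bool) \<Rightarrow> (vertex \<Rightarrow> nat) \<Rightarrow> (vertex \<Rightarrow> nat) \<Rightarrow> (vertex \<Rightarrow> nat) \<Rightarrow> vertex \<Rightarrow> bool"
    where "G z \<kappa> g h v \<longleftrightarrow> z v \<or> (\<kappa> v = i \<and> (\<forall>s\<in>cube d r. \<not> z (v + s)))" for z \<kappa> g h v
  have "local_rule d (\<lambda>\<kappa>. G (net d r \<kappa> i) \<kappa> \<kappa> \<kappa>)"
  proof (rule local_rule_map4[OF Suc id id id, where ?P1.0 = "\<lambda>_. True" and ?P4.0 = "\<lambda>_. True" and k = r])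
    fix f1 f1' :: "vertex \<Rightarrow> bool" and f2 f2' f3 f3' f4 f4' :: "vertex \<Rightarrow> nat" and v v'
    assume "agree d r f1 v f1' v'" "agree d r f2 v f2' v'"
    from agree_root[OF this(1)] agree_root[OF this(2)] agreeD[OF this(1)]
    show "G f1 f2 f3 f4 v = G f1' f2' f3' f4' v'" unfolding G_def by metis
  qed simp_all
  moreover have "(\<lambda>\<kappa>. G (net d r \<kappa> i) \<kappa> \<kappa> \<kappa>) = (\<lambda>\<kappa>. net d r \<kappa> (Suc i))"
    by (auto simp: G_def fun_eq_iff)
  ultimately show ?case by (simp only:)
qed

lemma net_separated:
  assumes \<kappa>: "\<And>u v. u \<in> grid d \<Longrightarrow> v \<in> grid d \<Longrightarrow> v - u \<in> cube d r \<Longrightarrow> \<kappa> u = \<kappa> v \<Longrightarrow> u = v"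
  shows "u \<in> grid d \<Longrightarrow> v \<in> grid d \<Longrightarrow> net d r \<kappa> i u \<Longrightarrow> net d r \<kappa> i v \<Longrightarrow> v - u \<in> cube d r \<Longrightarrow> u = v"
proof (induction i arbitrary: u v)
  case (Suc i)
  have uv: "net d r \<kappa> i (u + (v - u)) = net d r \<kappa> i v" "net d r \<kappa> i (v + (u - v)) = net d r \<kappa> i u"
    by (simp_all add: add_diff_eq)
  have "u - v \<in> cube d r" using Suc.prems(5) cube_minus_commute by blast
  then have "net d r \<kappa> i u \<or> (\<kappa> u = i \<and> \<not> net d r \<kappa> i v)" "net d r \<kappa> i v \<or> (\<kappa> v = i \<and> \<not> net d r \<kappa> i u)"
    using Suc.prems(3-5) uv by (auto dest: bspec)
  then show ?case using Suc.IH[OF Suc.prems(1,2) _ _ Suc.prems(5)] \<kappa>[OF Suc.prems(1,2,5)] by metis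
qed simp

lemma net_covering:
  assumes "\<kappa> v < i" shows "\<exists>s\<in>cube d r. net d r \<kappa> i (v + s)"
  using assms
proof (induction i)
  case (Suc i)
  show ?case
  proof (cases "\<exists>s\<in>cube d r. net d r \<kappa> i (v + s)")
    case True
    then show ?thesis by auto
  next
    case False
    then have "\<kappa> v = i" using Suc by (auto simp: less_Suc_eq)
    then have "net d r \<kappa> (Suc i) (v + 0)" using False by simp
    then show ?thesis using zero_in_cube by blast
  qed
qed simp

section \<open>Derandomization\<close>

lemma cube_memI:
  assumes "w = u + v" "u \<in> cube d a" "v \<in> cube d b" "a + b \<le> k"
  shows "w \<in> cube d k"
  using cube_in_mono[OF cube_add[OF assms(2,3)] assms(4)] assms(1) by simp

lemma overwrite_agree:
  assumes v: "v \<in> grid d" "v' \<in> grid d"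
    and "agree d k Y v Y' v'" "agree d k x v x' v'"
  shows "agree d k (overwrite d Y x) v (overwrite d Y' x') v'"
  using agreeD[OF assms(3)] agreeD[OF assms(4)]
  by (auto simp: agree_def overwrite_def grid_add v cube_grid split: option.split)

lemma translate_agree:
  assumes "v \<in> grid d"
  shows "agree d k (translate d (v' - v) x) v x v'"
  using assms by (auto simp: agree_def translate_def grid_add cube_grid algebra_simps)

text \<open>The width \<open>2 * t\<close> is the largest distance between two vertices of one
  neighbourhood of radius \<open>t\<close>: a net point within \<open>r\<close> of one of them is
  within \<open>r + 2 * t\<close> of the other, so it is within \<open>r\<close> of both or puts the
  other into the skeleton.\<close>

definition skeleton :: "nat \<Rightarrow> nat \<Rightarrow> nat \<Rightarrow> (vertex \<Rightarrow> bool) \<Rightarrow> vertex \<Rightarrow> bool" where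
  "skeleton d r t Z v \<longleftrightarrow> (\<exists>s \<in> cube d (r + 2 * t) - cube d r. Z (v + s))"

text \<open>\<open>f\<close> is written in coordinates relative to \<open>c\<close>.\<close>

definition extends ::
    "nat \<Rightarrow> lcl \<Rightarrow> uniform_alg \<Rightarrow> nat \<Rightarrow> (vertex \<Rightarrow> nat) \<Rightarrow> (vertex \<Rightarrow> bool) \<Rightarrow> (vertex \<Rightarrow> real) \<Rightarrow> vertex \<Rightarrow>
     (vertex \<Rightarrow> nat) \<Rightarrow> bool" where
  "extends d L A r \<sigma> Z x c f \<longleftrightarrow>
     (\<forall>u \<in> cube d (r + 2 * radius L). skeleton d r (radius L) Z (c + u) \<longrightarrow>
        early_output d A r \<sigma> x (c + u) = Some (f u)) \<and>
     (\<forall>u \<in> cube d (r + 3 * radius L). nbhd d (\<lambda>u. (\<sigma> (c + u), f u)) u (radius L) \<in> allowed L)"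

text \<open>Origin of the radii, using \<open>radius L \<le> r\<close> and writing t for
  \<open>radius L\<close>: membership in the skeleton reads \<open>Z\<close> within 2 r + 4 t, at
  most \<open>6 * r\<close>; the local check reads inputs within r + 4 t; truncated runs read random
  labels within 2 r + 2 t, at most \<open>4 * r\<close>.\<close>

lemma extends_agree:
  assumes r: "radius L \<le> r" and \<sigma>: "agree d (6 * r) \<sigma> c \<sigma>' c'" and Z: "agree d (6 * r) Z c Z' c'"
    and x: "agree d (4 * r) x c x' c'"
  shows "extends d L A r \<sigma> Z x c f \<longleftrightarrow> extends d L A r \<sigma>' Z' x' c' f"
proof -
  let ?t = "radius L"
  have sk: "skeleton d r ?t Z (c + u) \<longleftrightarrow> skeleton d r ?t Z' (c' + u)" if u: "u \<in> cube d (r + 2 * ?t)" for u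
  proof -
    have "agree d (r + 2 * ?t) Z (c + u) Z' (c' + u)"
      by (rule agree_move[OF Z u]) (use r in simp)
    then show ?thesis by (auto simp: skeleton_def agree_def)
  qed
  have eo: "early_output d A r \<sigma> x (c + u) = early_output d A r \<sigma>' x' (c' + u)"
    if u: "u \<in> cube d (r + 2 * ?t)" for u
    by (rule early_output_agree; rule agree_move[OF _ u]) (use r \<sigma> x in auto)
  have nb: "nbhd d (\<lambda>u. (\<sigma> (c + u), f u)) u ?t = nbhd d (\<lambda>u. (\<sigma>' (c' + u), f u)) u ?t"
    if u: "u \<in> cube d (r + 3 * ?t)" for u
  proof -
    have "\<sigma> (c + (u + g)) = \<sigma>' (c' + (u + g))" if "g \<in> gball d 0 ?t" for g
      by (rule agreeD[OF \<sigma>], rule cube_memI[OF refl u]) (use that gball_subset_cube r in auto)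
    then show ?thesis by (auto simp: nbhd_def restrict_def fun_eq_iff)
  qed
  show ?thesis using sk eo nb by (simp add: extends_def)
qed

text \<open>\<open>12 ^ d\<close> bounds the number of net points within \<open>6 * r\<close>, and
  the next factor bounds the volume of a shell, so \<open>prob_late\<close> bounds the expected
  number of late skeleton vertices near a net point by \<open>p\<close>. Base and exponent in
  \<open>p_small\<close> are both the bound \<open>16 ^ d\<close> on net points within
  \<open>8 * r\<close>: one factor for each round that touches a failure probability.\<close>

locale derandomization =
  fixes d r :: nat and L :: lcl and A :: uniform_alg and p :: real
  assumes solves: "solves d A L" and radius_le: "radius L \<le> r"
    and p_pos: "0 < p" and p_small: "p * real (16 ^ d) ^ (16 ^ d) < 1"
    and prob_late: "\<And>\<sigma> v. \<sigma> \<in> grid d \<rightarrow> in_labels L \<Longrightarrow> v \<in> grid d \<Longrightarrow>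
      real (12 ^ d * (4 * radius L * d * (2 * r + 4 * radius L + 1) ^ (d - 1))) *
      measure (random_labels d) {x \<in> space (random_labels d). early_output d A r \<sigma> x v = None} \<le> p"
begin

abbreviation "t \<equiv> radius L"

abbreviation "D \<equiv> (16 :: nat) ^ d"

abbreviation "M \<equiv> random_labels d"

abbreviation "skel \<equiv> skeleton d r t"

abbreviation "ext \<equiv> extends d L A r"

definition good :: "(vertex \<Rightarrow> nat) \<Rightarrow> (vertex \<Rightarrow> bool) \<Rightarrow> (vertex \<Rightarrow> real) \<Rightarrow> vertex \<Rightarrow> bool" where
  "good \<sigma> Z x c \<longleftrightarrow> (\<exists>f. ext \<sigma> Z x c f)"

definition separated :: "(vertex \<Rightarrow> bool) \<Rightarrow> bool" where
  "separated Z \<longleftrightarrow> (\<forall>u\<in>grid d. \<forall>v\<in>grid d. Z u \<longrightarrow> Z v \<longrightarrow> u - v \<in> cube d r \<longrightarrow> u = v)"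

lemma good_agree:
  assumes "agree d (6 * r) \<sigma> c \<sigma>' c'" "agree d (6 * r) Z c Z' c'" "agree d (4 * r) x c x' c'"
  shows "good \<sigma> Z x c \<longleftrightarrow> good \<sigma>' Z' x' c'"
proof -
  have "ext \<sigma> Z x c = ext \<sigma>' Z' x' c'"
    by (rule HOL.ext) (rule extends_agree[OF radius_le assms])
  then show ?thesis by (simp only: good_def)
qed

lemma alg: "is_uniform_alg d (in_labels L) (out_labels L) A"
  using solves by (simp add: solves_def)

lemma card_near:
  assumes "separated Z" "0 < k"
  shows "finite {c' \<in> grid d. Z c' \<and> c' - c \<in> cube d (k * r)} \<and>
    card {c' \<in> grid d. Z c' \<and> c' - c \<in> cube d (k * r)} \<le> (2 * k) ^ d"
  by (rule card_separated_le[OF assms(2), of _ c d r]) (use assms(1) in \<open>auto simp: separated_def\<close>)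

text \<open>A skeleton vertex near \<open>c\<close> is a net point minus an offset in the shell, and
  this net point lies within \<open>2 * r + 4 * t\<close>, hence within \<open>6 * r\<close>, of
  \<open>c\<close>.\<close>

lemma card_skeleton:
  assumes Z: "separated Z" and c: "c \<in> grid d"
  shows "card {u \<in> cube d (r + 2 * t). skel Z (c + u)} \<le>
    12 ^ d * (4 * t * d * (2 * r + 4 * t + 1) ^ (d - 1))"
proof -
  let ?C = "{c' \<in> grid d. Z c' \<and> c' - c \<in> cube d (6 * r)}"
  let ?S = "cube d (r + 2 * t) - cube d r"
  have "{u \<in> cube d (r + 2 * t). skel Z (c + u)} \<subseteq> (\<lambda>(c', s). c' - c - s) ` (?C \<times> ?S)"
  proof
    fix u assume u: "u \<in> {u \<in> cube d (r + 2 * t). skel Z (c + u)}"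
    then obtain s where s: "s \<in> ?S" "Z (c + u + s)" by (auto simp: skeleton_def)
    have "c + u + s \<in> grid d" using c u s by (auto intro!: grid_add dest: cube_grid)
    moreover have "c + u + s - c \<in> cube d (6 * r)"
      by (rule cube_memI[of _ u s]) (use u s radius_le in auto)
    ultimately show "u \<in> (\<lambda>(c', s). c' - c - s) ` (?C \<times> ?S)"
      using s by (intro image_eqI[of _ _ "(c + u + s, s)"]) auto
  qed
  then have "card {u \<in> cube d (r + 2 * t). skel Z (c + u)} \<le> card (?C \<times> ?S)"
    using card_near[OF Z, of 6 c] by (intro surj_card_le) auto
  also have "\<dots> = card ?C * card ?S" by (rule card_cartesian_product)
  also have "\<dots> \<le> 12 ^ d * (4 * t * d * (2 * r + 4 * t + 1) ^ (d - 1))"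
  proof (rule mult_le_mono)
    show "card ?C \<le> 12 ^ d" using card_near[OF Z, of 6 c] by simp
    have "card ?S = (2 * (r + 2 * t) + 1) ^ d - (2 * r + 1) ^ d"
      using cube_mono[of r "r + 2 * t" d] by (simp add: card_Diff_subset card_cube)
    also have "2 * (r + 2 * t) + 1 = (2 * r + 1) + 4 * t" by simp
    also have "\<dots> ^ d - (2 * r + 1) ^ d \<le> 4 * t * d * (2 * r + 1 + 4 * t) ^ (d - 1)"
      using power_add_le[of "2 * r + 1" "4 * t" d] by linarith
    also have "2 * r + 1 + 4 * t = 2 * r + 4 * t + 1" by simp
    finally show "card ?S \<le> 4 * t * d * (2 * r + 4 * t + 1) ^ (d - 1)" .
  qed
  finally show ?thesis .
qed

lemma good_measurable:
  assumes \<sigma>: "\<sigma> \<in> grid d \<rightarrow> in_labels L" and c: "c \<in> grid d"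
  shows "{x \<in> space M. \<not> good \<sigma> Z x c} \<in> sets M"
proof -
  let ?V = "{u \<in> cube d (r + 2 * t). skel Z (c + u)}"
  define F where "F g \<longleftrightarrow> \<not> (\<exists>f. (\<forall>u\<in>?V. g u = Some (f u)) \<and>
     (\<forall>u \<in> cube d (r + 3 * t). nbhd d (\<lambda>u. (\<sigma> (c + u), f u)) u t \<in> allowed L))" for g
  have "(\<lambda>x. F (\<lambda>u\<in>?V. early_output d A r \<sigma> x (c + u))) \<in> M \<rightarrow>\<^sub>M count_space UNIV"
    by (intro measurable_finite_family measurable_early_output[OF alg _ \<sigma>])
       (auto intro: grid_add c cube_grid)
  then have "{x \<in> space M. F (\<lambda>u\<in>?V. early_output d A r \<sigma> x (c + u))} \<in> sets M"
    by (simp add: pred_def)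
  moreover have "F (\<lambda>u\<in>?V. early_output d A r \<sigma> x (c + u)) \<longleftrightarrow> \<not> good \<sigma> Z x c" for x
    by (simp add: F_def good_def extends_def) blast
  ultimately show ?thesis by simp
qed

text \<open>Almost every run is a colouring, so a cube is bad only if some skeleton vertex is late.\<close>

lemma prob_bad:
  assumes \<sigma>: "\<sigma> \<in> grid d \<rightarrow> in_labels L" and c: "c \<in> grid d" and Z: "separated Z"
  shows "measure M {x \<in> space M. \<not> good \<sigma> Z x c} \<le> p"
proof -
  let ?V = "{u \<in> cube d (r + 2 * t). skel Z (c + u)}"
  let ?N = "\<lambda>u. {x \<in> space M. early_output d A r \<sigma> x (c + u) = None}"
  have cu: "c + u \<in> grid d" if "u \<in> cube d k" for u k
    using that c by (intro grid_add) (auto dest: cube_grid)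
  have N: "?N u \<in> sets M" if "u \<in> ?V" for u
    using measurable_early_output[OF alg cu \<sigma>, of u "r + 2 * t" r] that
    by (simp add: measurable_count_space_eq2_countable vimage_def Int_def conj_commute)
  have "AE x in M. is_coloring d L (\<lambda>v. (\<sigma> v, output_label d A \<sigma> x v))"
    using solves \<sigma> unfolding solves_def by fastforce
  then have ae: "AE x in M. x \<in> {x \<in> space M. \<not> good \<sigma> Z x c} \<longrightarrow> x \<in> (\<Union>u\<in>?V. ?N u)"
  proof eventually_elim
    case (elim x)
    show ?case
    proof (rule ccontr)
      assume neg: "\<not> ?thesis"
      \<comment> \<open>The run itself, including the vertices that finish late, is the required
        extension.\<close>
      define f where "f u = output_label d A \<sigma> x (c + u)" for u
      have "early_output d A r \<sigma> x (c + u) = Some (f u)" if "u \<in> ?V" for u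
        using neg that by (auto simp: f_def early_output_Some)
      moreover have "nbhd d (\<lambda>u. (\<sigma> (c + u), f u)) u t \<in> allowed L" if "u \<in> cube d (r + 3 * t)" for u
      proof -
        have "nbhd d (\<lambda>u. (\<sigma> (c + u), f u)) u t = nbhd d (\<lambda>v. (\<sigma> v, output_label d A \<sigma> x v)) (c + u) t"
          by (simp add: nbhd_def f_def add.assoc)
        then show ?thesis using elim cu[OF that] by (simp add: is_coloring_def)
      qed
      ultimately have "good \<sigma> Z x c" by (auto simp: good_def extends_def)
      then show False using neg by simp
    qed
  qed
  have "measure M {x \<in> space M. \<not> good \<sigma> Z x c} \<le> measure M (\<Union>u\<in>?V. ?N u)"
    using N by (intro random_labels.finite_measure_mono_AE ae) auto
  also have "\<dots> \<le> (\<Sum>u\<in>?V. measure M (?N u))"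
    using N by (intro measure_UNION_le) auto
  \<comment> \<open>The empty case is separate because the bound \<open>?K\<close>, by which the
    other case divides, vanishes for \<open>t = 0\<close>.\<close>
  also have "\<dots> \<le> p"
  proof (cases "?V = {}")
    case True
    show ?thesis unfolding True using p_pos by simp
  next
    case False
    let ?K = "12 ^ d * (4 * t * d * (2 * r + 4 * t + 1) ^ (d - 1))"
    have cV: "0 < card ?V" "card ?V \<le> ?K"
      using False card_skeleton[OF Z c] by (simp_all add: card_gt_0_iff)
    then have K: "0 < ?K" by linarith
    have "measure M (?N u) \<le> p / real ?K" if "u \<in> ?V" for u
    proof -
      have "real ?K * measure M (?N u) \<le> p"
        by (rule prob_late[OF \<sigma> cu[of u "r + 2 * t"]]) (use that in simp)
      then show ?thesis using K by (simp only: pos_le_divide_eq of_nat_0_less_iff mult.commute)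
    qed
    then have "(\<Sum>u\<in>?V. measure M (?N u)) \<le> real (card ?V) * (p / real ?K)"
      by (rule sum_bounded_above)
    also have "\<dots> \<le> real ?K * (p / real ?K)"
      using cV(2) p_pos by (intro mult_right_mono) (auto simp del: of_nat_mult of_nat_power)
    also have "\<dots> = p" using K by simp
    finally show ?thesis .
  qed
  finally show ?thesis .
qed

text \<open>The conditional probability of failure at \<open>c\<close> given the labels fixed in
  \<open>Y\<close>, the others being still random.\<close>

definition bad_prob :: "(vertex \<Rightarrow> nat) \<Rightarrow> (vertex \<Rightarrow> bool) \<Rightarrow> (vertex \<Rightarrow> real option) \<Rightarrow> vertex \<Rightarrow> real" where
  "bad_prob \<sigma> Z Y c = measure M {x \<in> space M. \<not> good \<sigma> Z (overwrite d Y x) c}"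

lemma overwrite_bad_measurable:
  assumes "\<sigma> \<in> grid d \<rightarrow> in_labels L" "c \<in> grid d" "valid_tape Y"
  shows "{x \<in> space M. \<not> good \<sigma> Z (overwrite d Y x) c} \<in> sets M"
proof -
  have "overwrite d Y -` {x \<in> space M. \<not> good \<sigma> Z x c} \<inter> space M \<in> sets M"
    by (rule measurable_sets[OF measurable_overwrite[OF assms(3)] good_measurable[OF assms(1,2)]])
  also have "overwrite d Y -` {x \<in> space M. \<not> good \<sigma> Z x c} \<inter> space M =
      {x \<in> space M. \<not> good \<sigma> Z (overwrite d Y x) c}"
    using measurable_space[OF measurable_overwrite[OF assms(3)]] by auto
  finally show ?thesis .
qed

text \<open>The labels that decide failure at \<open>c\<close> and at \<open>c'\<close> sit at
  different places; translation invariance of \<open>random_labels\<close> identifies the two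
  probabilities. This makes choices that are based on \<open>bad_prob\<close> local.\<close>

lemma bad_prob_agree:
  assumes \<sigma>: "\<sigma> \<in> grid d \<rightarrow> in_labels L" and c: "c \<in> grid d" "c' \<in> grid d" and Y: "valid_tape Y"
    and ag: "agree d (6 * r) \<sigma> c \<sigma>' c'" "agree d (6 * r) Z c Z' c'" "agree d (4 * r) Y c Y' c'"
  shows "bad_prob \<sigma> Z Y c = bad_prob \<sigma>' Z' Y' c'"
proof -
  have w: "c' - c \<in> grid d" using c by (intro grid_diff)
  have "good \<sigma> Z (overwrite d Y (translate d (c' - c) x)) c \<longleftrightarrow> good \<sigma>' Z' (overwrite d Y' x) c'" for x
    by (intro good_agree ag(1,2) overwrite_agree c ag(3) translate_agree)
  then have "bad_prob \<sigma>' Z' Y' c' =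
      measure M {x \<in> space M. \<not> good \<sigma> Z (overwrite d Y (translate d (c' - c) x)) c}"
    by (simp add: bad_prob_def)
  also have "\<dots> = bad_prob \<sigma> Z Y c"
    unfolding bad_prob_def measure_def
    by (simp add: emeasure_translate[OF w overwrite_bad_measurable[OF \<sigma> c(1) Y]])
  finally show ?thesis by simp
qed

section \<open>Fixing the random labels block by block\<close>

definition fix_block :: "(vertex \<Rightarrow> real option) \<Rightarrow> vertex \<Rightarrow> (vertex \<Rightarrow> real) \<Rightarrow> vertex \<Rightarrow> real option" where
  "fix_block Y c b v = (if Y v = None \<and> v - c \<in> cube d (4 * r) then Some (b (v - c)) else Y v)"

lemma fix_block_agree:
  assumes "agree d k Y c Y' c'"
  shows "agree d k (fix_block Y c b) c (fix_block Y' c' b) c'"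
  using assms by (simp add: agree_def fix_block_def)

lemma valid_fix_block:
  "valid_tape Y \<Longrightarrow> (\<And>u. b u \<in> {0..1}) \<Longrightarrow> valid_tape (fix_block Y c b)"
  by (auto simp: valid_tape_def fix_block_def split: if_splits)

text \<open>Only net points within \<open>8 * r\<close> can notice the block, as failure reads
  labels within \<open>4 * r\<close>. The maximum with \<open>p\<close> keeps the denominators in
  \<open>splice_averaging\<close> positive when some failure probability is already 0.\<close>

definition is_block :: "(vertex \<Rightarrow> nat) \<Rightarrow> (vertex \<Rightarrow> bool) \<Rightarrow> (vertex \<Rightarrow> real option) \<Rightarrow> vertex \<Rightarrow> (vertex \<Rightarrow> real) \<Rightarrow> bool" where
  "is_block \<sigma> Z Y c b \<longleftrightarrow> (\<forall>u. b u \<in> {0..1}) \<and>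
     (\<forall>s \<in> cube d (8 * r). Z (c + s) \<longrightarrow>
        bad_prob \<sigma> Z (fix_block Y c b) (c + s) \<le> D * max p (bad_prob \<sigma> Z Y (c + s)))"

lemma is_block_exists:
  assumes \<sigma>: "\<sigma> \<in> grid d \<rightarrow> in_labels L" and c: "c \<in> grid d" and Z: "separated Z" and Y: "valid_tape Y"
  shows "\<exists>b. is_block \<sigma> Z Y c b"
proof -
  let ?S = "{c' \<in> grid d. Z c' \<and> c' - c \<in> cube d (8 * r)}"
  let ?J = "{v. Y v = None \<and> v - c \<in> cube d (4 * r)}"
  have S: "finite ?S" "card ?S \<le> D" using card_near[OF Z, of 8 c] by simp_all
  have "\<exists>z\<in>space M. \<forall>s\<in>?S. measure M {x \<in> space M. \<not> good \<sigma> Z (overwrite d Y (splice d ?J x z)) s} \<le>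
      real D * max p (bad_prob \<sigma> Z Y s)"
    by (rule splice_averaging[OF S]) (use overwrite_bad_measurable[OF \<sigma> _ Y] p_pos in \<open>auto simp: bad_prob_def\<close>)
  then obtain z where z: "z \<in> space M" and le: "\<And>s. s \<in> ?S \<Longrightarrow>
      measure M {x \<in> space M. \<not> good \<sigma> Z (overwrite d Y (splice d ?J x z)) s} \<le>
      real D * max p (bad_prob \<sigma> Z Y s)"
    by blast
  \<comment> \<open>\<open>z\<close> is \<open>undefined\<close> off the grid; the value 0 there
    keeps \<open>b\<close> in the unit interval everywhere, as \<open>is_block\<close>
    demands.\<close>
  define b where "b u = (if c + u \<in> grid d then z (c + u) else 0)" for u
  have b: "b u \<in> {0..1}" for u using z by (auto simp: b_def space_random_labels PiE_iff)
  have "overwrite d (fix_block Y c b) x = overwrite d Y (splice d ?J x z)" for x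
    by (auto simp: overwrite_def fix_block_def splice_def b_def fun_eq_iff split: option.splits)
  then have "bad_prob \<sigma> Z (fix_block Y c b) s \<le> real D * max p (bad_prob \<sigma> Z Y s)" if "s \<in> ?S" for s
    using le[OF that] by (simp add: bad_prob_def)
  moreover have "c + s \<in> ?S" if "s \<in> cube d (8 * r)" "Z (c + s)" for s
    using that c by (auto intro: grid_add cube_grid)
  ultimately show ?thesis using b unfolding is_block_def by (intro exI[of _ b]) auto
qed

text \<open>The choice depends on its arguments only through the predicate
  \<open>is_block \<sigma> Z Y c\<close>, so centres with equal surroundings choose equal blocks.
  The fallback 0 keeps every tape valid.\<close>

definition block :: "(vertex \<Rightarrow> nat) \<Rightarrow> (vertex \<Rightarrow> bool) \<Rightarrow> (vertex \<Rightarrow> real option) \<Rightarrow> vertex \<Rightarrow> vertex \<Rightarrow> real" where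
  "block \<sigma> Z Y c = (if \<exists>b. is_block \<sigma> Z Y c b then (SOME b. is_block \<sigma> Z Y c b) else 0)"

text \<open>All net points of colour \<open>i\<close> fix their blocks simultaneously, each against
  the same old \<open>Y\<close>. The argument \<open>- s\<close> is the position of \<open>v\<close>
  relative to the net point \<open>v + s\<close>.\<close>

definition step :: "nat \<Rightarrow> (vertex \<Rightarrow> nat) \<Rightarrow> (vertex \<Rightarrow> bool) \<Rightarrow> (vertex \<Rightarrow> nat) \<Rightarrow> (vertex \<Rightarrow> real option) \<Rightarrow>
    vertex \<Rightarrow> real option" where
  "step i \<sigma> Z \<kappa> Y v =
     (if Y v = None \<and> (\<exists>s\<in>cube d (4 * r). Z (v + s) \<and> \<kappa> (v + s) = i)
      then (let s = (SOME s. s \<in> cube d (4 * r) \<and> Z (v + s) \<and> \<kappa> (v + s) = i)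
            in Some (block \<sigma> Z Y (v + s) (- s)))
      else Y v)"

primrec tape :: "(vertex \<Rightarrow> nat) \<Rightarrow> (vertex \<Rightarrow> bool) \<Rightarrow> (vertex \<Rightarrow> nat) \<Rightarrow> nat \<Rightarrow> vertex \<Rightarrow> real option" where
  "tape \<sigma> Z \<kappa> 0 = (\<lambda>_. None)"
| "tape \<sigma> Z \<kappa> (Suc i) = step i \<sigma> Z \<kappa> (tape \<sigma> Z \<kappa> i)"

text \<open>The least colour is a tie-break that nearby vertices off the skeleton resolve in the
  same way, see \<open>central_of_near\<close>.\<close>

definition central :: "(vertex \<Rightarrow> bool) \<Rightarrow> (vertex \<Rightarrow> nat) \<Rightarrow> vertex \<Rightarrow> vertex \<Rightarrow> bool" where
  "central Z \<kappa> v s \<longleftrightarrow> s \<in> cube d r \<and> Z (v + s) \<and> (\<forall>s'\<in>cube d r. Z (v + s') \<longrightarrow> \<kappa> (v + s) \<le> \<kappa> (v + s'))"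

definition label :: "(vertex \<Rightarrow> nat) \<Rightarrow> (vertex \<Rightarrow> bool) \<Rightarrow> (vertex \<Rightarrow> nat) \<Rightarrow> (vertex \<Rightarrow> real) \<Rightarrow> vertex \<Rightarrow> nat" where
  "label \<sigma> Z \<kappa> y v =
     (if skel Z v then the (early_output d A r \<sigma> y v)
      else if Ex (central Z \<kappa> v)
      then (let s = Eps (central Z \<kappa> v) in (SOME f. ext \<sigma> Z y (v + s) f) (- s))
      else 0)"

lemma block_valid: "block \<sigma> Z Y c u \<in> {0..1}"
proof (cases "\<exists>b. is_block \<sigma> Z Y c b")
  case True
  then have "is_block \<sigma> Z Y c (block \<sigma> Z Y c)"
    unfolding block_def if_P[OF True] by (rule someI_ex)
  then show ?thesis unfolding is_block_def by blast
qed (simp add: block_def)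

lemma valid_step: "valid_tape Y \<Longrightarrow> valid_tape (step i \<sigma> Z \<kappa> Y)"
  using block_valid by (auto simp: valid_tape_def step_def Let_def split: if_splits)

lemma valid_tape_tape: "valid_tape (tape \<sigma> Z \<kappa> i)"
  by (induction i) (simp_all add: valid_step, simp add: valid_tape_def)

text \<open>The radius is \<open>8 * r\<close> to reach the affected net points plus
  \<open>6 * r\<close> for their failure probabilities; another \<open>4 * r\<close> to reach the
  centre gives the \<open>18 * r\<close> of \<open>step_agree\<close>. Resampled probabilities are
  compared only for values in the unit interval, since \<open>bad_prob_agree\<close> requires a
  valid tape.\<close>

lemma is_block_agree:
  assumes \<sigma>: "\<sigma> \<in> grid d \<rightarrow> in_labels L" and c: "c \<in> grid d" "c' \<in> grid d" and Y: "valid_tape Y"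
    and ag: "agree d (14 * r) \<sigma> c \<sigma>' c'" "agree d (14 * r) Z c Z' c'" "agree d (14 * r) Y c Y' c'"
  shows "is_block \<sigma> Z Y c b \<longleftrightarrow> is_block \<sigma>' Z' Y' c' b"
proof -
  have *: "Z (c + s) \<longleftrightarrow> Z' (c' + s)" "bad_prob \<sigma> Z Y (c + s) = bad_prob \<sigma>' Z' Y' (c' + s)"
      "(\<forall>u. b u \<in> {0..1}) \<Longrightarrow>
        bad_prob \<sigma> Z (fix_block Y c b) (c + s) = bad_prob \<sigma>' Z' (fix_block Y' c' b) (c' + s)"
    if s: "s \<in> cube d (8 * r)" for s
  proof -
    show "Z (c + s) \<longleftrightarrow> Z' (c' + s)" by (rule agreeD[OF ag(2)]) (rule cube_in_mono[OF s], simp)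
    have g: "c + s \<in> grid d" "c' + s \<in> grid d" using c s by (auto intro: grid_add cube_grid)
    note m = agree_move[OF ag(1) s, of "6 * r"] agree_move[OF ag(2) s, of "6 * r"]
    show "bad_prob \<sigma> Z Y (c + s) = bad_prob \<sigma>' Z' Y' (c' + s)"
      by (rule bad_prob_agree[OF \<sigma> g Y]) (use m agree_move[OF ag(3) s, of "4 * r"] in auto)
    assume b: "\<forall>u. b u \<in> {0..1}"
    show "bad_prob \<sigma> Z (fix_block Y c b) (c + s) = bad_prob \<sigma>' Z' (fix_block Y' c' b) (c' + s)"
      by (rule bad_prob_agree[OF \<sigma> g valid_fix_block[OF Y]])
         (use b m agree_move[OF fix_block_agree[OF ag(3)] s, of "4 * r"] in auto)
  qed
  then show ?thesis unfolding is_block_def by (metis (no_types, lifting))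
qed

lemma step_agree:
  assumes \<sigma>: "\<sigma> \<in> grid d \<rightarrow> in_labels L" and v: "v \<in> grid d" "v' \<in> grid d" and Y: "valid_tape Y"
    and ag: "agree d (18 * r) \<sigma> v \<sigma>' v'" "agree d (18 * r) Z v Z' v'" "agree d (18 * r) \<kappa> v \<kappa>' v'"
      "agree d (18 * r) Y v Y' v'"
  shows "step i \<sigma> Z \<kappa> Y v = step i \<sigma>' Z' \<kappa>' Y' v'"
proof -
  let ?P = "\<lambda>s. s \<in> cube d (4 * r) \<and> Z (v + s) \<and> \<kappa> (v + s) = i"
  let ?P' = "\<lambda>s. s \<in> cube d (4 * r) \<and> Z' (v' + s) \<and> \<kappa>' (v' + s) = i"
  have P: "?P = ?P'"
    using agreeD[OF ag(2)] agreeD[OF ag(3)] cube_mono[of "4 * r" "18 * r" d] by (auto simp: fun_eq_iff)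
  have Yv: "Y v = Y' v'" by (rule agree_root[OF ag(4)])
  have "block \<sigma> Z Y (v + s) = block \<sigma>' Z' Y' (v' + s)" if s: "s \<in> cube d (4 * r)" for s
  proof -
    have "is_block \<sigma> Z Y (v + s) = is_block \<sigma>' Z' Y' (v' + s)"
    proof
      fix b
      show "is_block \<sigma> Z Y (v + s) b = is_block \<sigma>' Z' Y' (v' + s) b"
        by (rule is_block_agree[OF \<sigma> _ _ Y]; (rule agree_move[OF _ s])?)
           (use v s ag in \<open>auto intro: grid_add cube_grid\<close>)
    qed
    then show ?thesis by (simp add: block_def)
  qed
  moreover have "?P (Eps ?P)" if "\<exists>s. ?P s" using someI_ex[OF that] .
  ultimately have "block \<sigma> Z Y (v + Eps ?P) = block \<sigma>' Z' Y' (v' + Eps ?P)" if "\<exists>s. ?P s"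
    using that by blast
  then show ?thesis
    unfolding step_def Let_def Bex_def P[symmetric] Yv by (simp cong: if_cong)
qed

lemma label_agree:
  assumes v: "v \<in> grid d" "v' \<in> grid d"
    and ag: "agree d (7 * r) \<sigma> v \<sigma>' v'" "agree d (7 * r) Z v Z' v'" "agree d (7 * r) \<kappa> v \<kappa>' v'"
      "agree d (7 * r) y v y' v'"
  shows "label \<sigma> Z \<kappa> y v = label \<sigma>' Z' \<kappa>' y' v'"
proof -
  have Zs: "Z (v + s) = Z' (v' + s)" and \<kappa>s: "\<kappa> (v + s) = \<kappa>' (v' + s)" if "s \<in> cube d (3 * r)" for s
    using agreeD[OF ag(2), of s] agreeD[OF ag(3), of s] cube_in_mono[OF that, of "7 * r"] by simp_all
  have Zr: "Z (v + s) = Z' (v' + s)" and \<kappa>r: "\<kappa> (v + s) = \<kappa>' (v' + s)" if "s \<in> cube d r" for s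
    using Zs[of s] \<kappa>s[of s] cube_in_mono[OF that, of "3 * r"] by simp_all
  have sk: "skel Z v \<longleftrightarrow> skel Z' v'"
  proof -
    have "Z (v + s) = Z' (v' + s)" if "s \<in> cube d (r + 2 * t)" for s
      by (rule Zs[OF cube_in_mono[OF that]]) (use radius_le in simp)
    then show ?thesis by (auto simp: skeleton_def)
  qed
  have eo: "early_output d A r \<sigma> y v = early_output d A r \<sigma>' y' v'"
    by (rule early_output_agree; rule agree_mono) (use ag in auto)
  have P: "central Z \<kappa> v = central Z' \<kappa>' v'"
  proof
    fix s show "central Z \<kappa> v s = central Z' \<kappa>' v' s"
      by (cases "s \<in> cube d r") (simp_all add: central_def Zr \<kappa>r cong: ball_cong)
  qed
  have "ext \<sigma> Z y (v + s) = ext \<sigma>' Z' y' (v' + s)" if s: "s \<in> cube d r" for s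
  proof
    fix f show "ext \<sigma> Z y (v + s) f = ext \<sigma>' Z' y' (v' + s) f"
      by (rule extends_agree[OF radius_le]; rule agree_move[OF _ s, where k = "7 * r"]) (use ag in auto)
  qed
  moreover have "Eps (central Z \<kappa> v) \<in> cube d r" if "Ex (central Z \<kappa> v)"
  proof -
    have "s \<in> cube d r" if "central Z \<kappa> v s" for s using that by (simp add: central_def)
    then show ?thesis using someI_ex[OF that] .
  qed
  ultimately have "ext \<sigma> Z y (v + Eps (central Z \<kappa> v)) = ext \<sigma>' Z' y' (v' + Eps (central Z \<kappa> v))"
    if "Ex (central Z \<kappa> v)" using that by blast
  then show ?thesis
    unfolding label_def Let_def P[symmetric] sk eo by (simp cong: if_cong)
qed

section \<open>Correctness for a fixed input, net and colouring\<close>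

context
  fixes \<sigma> :: "vertex \<Rightarrow> nat" and Z :: "vertex \<Rightarrow> bool" and \<kappa> :: "vertex \<Rightarrow> nat" and q :: nat
  assumes \<sigma>: "\<sigma> \<in> grid d \<rightarrow> in_labels L" and separated: "separated Z"
    and covering: "\<And>v. v \<in> grid d \<Longrightarrow> \<exists>s\<in>cube d r. Z (v + s)"
    and distinct_colors: "\<And>u v. u \<in> grid d \<Longrightarrow> v \<in> grid d \<Longrightarrow> Z u \<Longrightarrow> Z v \<Longrightarrow> \<kappa> u = \<kappa> v \<Longrightarrow>
      u - v \<in> cube d (16 * r) \<Longrightarrow> u = v"
    and colors: "\<And>v. v \<in> grid d \<Longrightarrow> \<kappa> v < q"
begin

text \<open>A net point of the colour of \<open>c\<close> that could set \<open>v\<close> lies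
  within \<open>4 * r + 4 * r + 8 * r\<close> of \<open>c\<close> and hence equals \<open>c\<close>.
  Seen from \<open>w\<close>, the simultaneous round just fixes the single block of
  \<open>c\<close>.\<close>

lemma step_near:
  assumes c: "c \<in> grid d" "Z c" and v: "v \<in> grid d" and w: "v - w \<in> cube d (4 * r)" "w - c \<in> cube d (8 * r)"
  shows "step (\<kappa> c) \<sigma> Z \<kappa> Y v = fix_block Y c (block \<sigma> Z Y c) v"
proof -
  let ?P = "\<lambda>s. s \<in> cube d (4 * r) \<and> Z (v + s) \<and> \<kappa> (v + s) = \<kappa> c"
  have unique: "v + s = c" if "?P s" for s
  proof (rule distinct_colors[OF _ c(1)])
    show "v + s \<in> grid d" using that v by (auto intro: grid_add cube_grid)
    have "v + s - c = s + ((v - w) + (w - c))" by (simp add: algebra_simps)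
    then show "v + s - c \<in> cube d (16 * r)"
      by (rule cube_memI[OF _ _ cube_add[OF w]]) (use that in auto)
  qed (use that c in auto)
  show ?thesis
  proof (cases "v - c \<in> cube d (4 * r)")
    case True
    have P: "?P (c - v)" using True cube_minus_commute c by auto
    define e where "e = (SOME s. s \<in> cube d (4 * r) \<and> Z (v + s) \<and> \<kappa> (v + s) = \<kappa> c)"
    have "?P e" unfolding e_def by (rule someI[where P = ?P, OF P])
    then have ve: "v + e = c" by (rule unique)
    have e: "- e = v - c" by (simp add: ve[symmetric])
    have ex: "\<exists>s\<in>cube d (4 * r). Z (v + s) \<and> \<kappa> (v + s) = \<kappa> c" using P by blast
    have "step (\<kappa> c) \<sigma> Z \<kappa> Y v = (if Y v = None then Some (block \<sigma> Z Y (v + e) (- e)) else Y v)"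
      by (simp only: step_def Let_def e_def ex simp_thms)
    then show ?thesis using True by (simp only: fix_block_def ve e simp_thms)
  next
    case False
    have "\<not> ?P s" for s
    proof
      assume s: "?P s"
      have "v - c = - s" by (simp add: unique[OF s, symmetric])
      then show False using False s cube_uminus[of s d "4 * r"] by simp
    qed
    then have "\<not> (\<exists>s\<in>cube d (4 * r). Z (v + s) \<and> \<kappa> (v + s) = \<kappa> c)" by blast
    then show ?thesis using False by (simp only: step_def fix_block_def simp_thms if_False)
  qed
qed

lemma step_far:
  assumes v: "v \<in> grid d" and w: "v - w \<in> cube d (4 * r)"
    and none: "\<And>c. c \<in> grid d \<Longrightarrow> Z c \<Longrightarrow> \<kappa> c = i \<Longrightarrow> w - c \<notin> cube d (8 * r)"
  shows "step i \<sigma> Z \<kappa> Y v = Y v"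
proof -
  have "\<not> (Z (v + s) \<and> \<kappa> (v + s) = i)" if s: "s \<in> cube d (4 * r)" for s
  proof
    assume "Z (v + s) \<and> \<kappa> (v + s) = i"
    moreover have "v + s \<in> grid d" using s v by (auto intro: grid_add cube_grid)
    moreover have "w - (v + s) \<in> cube d (8 * r)"
      by (rule cube_memI[of _ "- (v - w)" "- s", OF _ cube_uminus[OF w] cube_uminus[OF s]]) auto
    ultimately show False using none by blast
  qed
  then have "\<not> (\<exists>s\<in>cube d (4 * r). Z (v + s) \<and> \<kappa> (v + s) = i)" by blast
  then show ?thesis by (simp only: step_def simp_thms if_False)
qed

lemma bad_prob_cong:
  assumes "w \<in> grid d" "valid_tape Y" "\<And>v. v \<in> grid d \<Longrightarrow> v - w \<in> cube d (4 * r) \<Longrightarrow> Y v = Y' v"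
  shows "bad_prob \<sigma> Z Y w = bad_prob \<sigma> Z Y' w"
  by (rule bad_prob_agree[OF \<sigma> assms(1,1,2)]) (use assms in \<open>simp_all add: agree_def grid_add cube_grid\<close>)

text \<open>In each round at most one net point within \<open>8 * r\<close> of \<open>w\<close> is
  active, at the cost of a factor \<open>D\<close>; without one nothing changes. The exponent thus
  counts nearby net points and not rounds, which makes the bound uniform in the number of
  colours.\<close>

lemma bad_prob_tape:
  assumes w: "w \<in> grid d" "Z w"
  shows "bad_prob \<sigma> Z (tape \<sigma> Z \<kappa> i) w \<le>
    p * real D ^ card {c \<in> grid d. Z c \<and> \<kappa> c < i \<and> c - w \<in> cube d (8 * r)}"
proof (induction i)
  case 0
  have "overwrite d (\<lambda>_. None) x = x" if "x \<in> space M" for x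
    using that by (auto simp: overwrite_def space_random_labels PiE_iff extensional_def fun_eq_iff)
  then have "{x \<in> space M. \<not> good \<sigma> Z (overwrite d (\<lambda>_. None) x) w} = {x \<in> space M. \<not> good \<sigma> Z x w}"
    by auto
  then show ?case using prob_bad[OF \<sigma> w(1) separated] by (simp add: bad_prob_def)
next
  case (Suc i)
  let ?Y = "tape \<sigma> Z \<kappa> i"
  let ?N = "\<lambda>i. {c \<in> grid d. Z c \<and> \<kappa> c < i \<and> c - w \<in> cube d (8 * r)}"
  have "finite {c \<in> grid d. Z c \<and> c - w \<in> cube d (8 * r)}" using card_near[OF separated, of 8 w] by simp
  then have fin: "finite (?N j)" for j by (rule rev_finite_subset) blast
  show ?case
  proof (cases "\<exists>c \<in> grid d. Z c \<and> \<kappa> c = i \<and> w - c \<in> cube d (8 * r)")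
    case True
    then obtain c where c: "c \<in> grid d" "Z c" "\<kappa> c = i" "w - c \<in> cube d (8 * r)" by blast
    have ex: "\<exists>b. is_block \<sigma> Z ?Y c b" by (rule is_block_exists[OF \<sigma> c(1) separated valid_tape_tape])
    then have block: "is_block \<sigma> Z ?Y c (block \<sigma> Z ?Y c)"
      unfolding block_def if_P[OF ex] by (rule someI_ex)
    have "bad_prob \<sigma> Z (tape \<sigma> Z \<kappa> (Suc i)) w = bad_prob \<sigma> Z (fix_block ?Y c (block \<sigma> Z ?Y c)) w"
      using step_near[OF c(1,2) _ _ c(4)] c(3)
      by (intro bad_prob_cong w valid_tape_tape) simp
    also have "\<dots> \<le> real D * max p (bad_prob \<sigma> Z ?Y w)"
    proof -
      have "c + (w - c) = w" by simp
      then show ?thesis using block c(4) w(2) unfolding is_block_def by (metis of_nat_numeral of_nat_power)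
    qed
    \<comment> \<open>The bound of the induction hypothesis is itself at least \<open>p\<close>, so
      the maximum costs nothing.\<close>
    also have "\<dots> \<le> real D * (p * real D ^ card (?N i))"
    proof (intro mult_left_mono max.boundedI Suc)
      have "1 \<le> real D ^ card (?N i)" by (intro one_le_power) simp
      then show "p \<le> p * real D ^ card (?N i)" using p_pos by simp
    qed simp
    also have "\<dots> = p * real D ^ card (insert c (?N i))"
      using fin c(3) by simp
    also have "insert c (?N i) = ?N (Suc i)"
    proof -
      have A: "c' = c" if "c' \<in> grid d" "Z c'" "\<kappa> c' = i" "c' - w \<in> cube d (8 * r)" for c'
      proof (rule distinct_colors[OF that(1) c(1) that(2) c(2)])
        have "c' - c = (c' - w) + (w - c)" by simp
        then show "c' - c \<in> cube d (16 * r)" by (rule cube_memI[OF _ that(4) c(4)]) simp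
      qed (use that c in simp)
      have B: "c - w \<in> cube d (8 * r)" using c(4) cube_minus_commute by blast
      show ?thesis
      proof (intro equalityI subsetI)
        fix x assume "x \<in> insert c (?N i)"
        then show "x \<in> ?N (Suc i)" using c(1-3) B by (elim insertE) simp_all
      next
        fix x assume x: "x \<in> ?N (Suc i)"
        then show "x \<in> insert c (?N i)" using A[of x] by (cases "\<kappa> x < i") simp_all
      qed
    qed
    finally show ?thesis .
  next
    case False
    have "bad_prob \<sigma> Z (tape \<sigma> Z \<kappa> (Suc i)) w = bad_prob \<sigma> Z ?Y w"
    proof -
      have "step i \<sigma> Z \<kappa> ?Y v = ?Y v" if "v \<in> grid d" "v - w \<in> cube d (4 * r)" for v
        by (rule step_far[OF that]) (use False in blast)
      then show ?thesis by (intro bad_prob_cong w valid_tape_tape) simp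
    qed
    also have "\<dots> \<le> p * real D ^ card (?N i)" by (rule Suc)
    also have "\<dots> \<le> p * real D ^ card (?N (Suc i))"
      using p_pos by (intro mult_left_mono power_increasing card_mono fin) auto
    finally show ?thesis .
  qed
qed

lemma tape_defined: "c \<in> grid d \<Longrightarrow> Z c \<Longrightarrow> v - c \<in> cube d (4 * r) \<Longrightarrow> \<kappa> c < i \<Longrightarrow> tape \<sigma> Z \<kappa> i v \<noteq> None"
proof (induction i)
  case (Suc i)
  have "c - v \<in> cube d (4 * r)" "Z (v + (c - v))" "v + (c - v) = c"
    using Suc.prems cube_minus_commute by simp_all
  then have "\<exists>s\<in>cube d (4 * r). Z (v + s) \<and> \<kappa> (v + s) = \<kappa> c" by metis
  then show ?case using Suc by (auto simp: step_def Let_def less_Suc_eq)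
qed simp

abbreviation final_tape :: "vertex \<Rightarrow> real" where
  "final_tape \<equiv> \<lambda>v. the (tape \<sigma> Z \<kappa> q v)"

text \<open>A failure probability below 1 leaves some \<open>x\<close> that succeeds; by covering,
  all labels on the grid are already fixed, so success does not depend on \<open>x\<close>.\<close>

lemma good_final_tape:
  assumes w: "w \<in> grid d" "Z w"
  shows "good \<sigma> Z final_tape w"
proof -
  let ?Y = "tape \<sigma> Z \<kappa> q"
  let ?N = "{c \<in> grid d. Z c \<and> \<kappa> c < q \<and> c - w \<in> cube d (8 * r)}"
  have "card ?N \<le> card {c \<in> grid d. Z c \<and> c - w \<in> cube d (8 * r)}"
    using card_near[OF separated, of 8 w] by (intro card_mono) auto
  also have "\<dots> \<le> D" using card_near[OF separated, of 8 w] by simp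
  finally have "p * real D ^ card ?N \<le> p * real D ^ D"
    using p_pos by (intro mult_left_mono power_increasing) auto
  then have lt: "bad_prob \<sigma> Z ?Y w < 1" using bad_prob_tape[OF w, of q] p_small by linarith
  have "\<exists>x\<in>space M. good \<sigma> Z (overwrite d ?Y x) w"
  proof (rule ccontr)
    assume "\<not> ?thesis"
    then have "{x \<in> space M. \<not> good \<sigma> Z (overwrite d ?Y x) w} = space M" by auto
    then show False using lt by (simp add: bad_prob_def random_labels.prob_space)
  qed
  then obtain x where x: "good \<sigma> Z (overwrite d ?Y x) w" by blast
  have "overwrite d ?Y x v = final_tape v" if v: "v \<in> grid d" for v
  proof -
    obtain s where s: "s \<in> cube d r" "Z (v + s)" using covering[OF v] by blast
    have "v + s \<in> grid d" using v s by (auto intro: grid_add cube_grid)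
    moreover have "v - (v + s) \<in> cube d (4 * r)" using cube_in_mono[OF cube_uminus[OF s(1)], of "4 * r"] by simp
    ultimately have "?Y v \<noteq> None" using s colors by (intro tape_defined) auto
    then show ?thesis using v by (auto simp: overwrite_def)
  qed
  then have "agree d (4 * r) (overwrite d ?Y x) w final_tape w"
    using w by (auto simp: agree_def intro: grid_add cube_grid)
  then have "good \<sigma> Z (overwrite d ?Y x) w \<longleftrightarrow> good \<sigma> Z final_tape w"
    by (intro good_agree) (simp_all add: agree_def)
  then show ?thesis using x by simp
qed

lemma central_exists:
  assumes v: "v \<in> grid d" shows "\<exists>s. central Z \<kappa> v s"
proof -
  let ?S = "{s \<in> cube d r. Z (v + s)}"
  have "?S \<noteq> {}" "finite ?S" using covering[OF v] by auto
  then obtain s where "s \<in> ?S" "\<forall>s'\<in>?S. \<kappa> (v + s) \<le> \<kappa> (v + s')"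
    using ex_is_arg_min_if_finite[of ?S "\<lambda>s. \<kappa> (v + s)"] by (auto simp: is_arg_min_linorder)
  then show ?thesis by (auto simp: central_def)
qed

text \<open>A net point within \<open>r\<close> of one vertex is within \<open>r + 2 * t\<close> of
  the other and, as that one is not in the skeleton, within \<open>r\<close> of it. So both see the
  same net points, and distinct colours make the one of least colour unique.\<close>

lemma central_of_near:
  assumes v: "v \<in> grid d" "v' \<in> grid d" and near: "v' - v \<in> cube d (2 * t)"
    and sk: "\<not> skel Z v" "\<not> skel Z v'" and s: "central Z \<kappa> v s" "central Z \<kappa> v' s'"
  shows "v + s = v' + s'"
proof -
  have cov: "u' + (u + s - u') = u + s \<and> u + s - u' \<in> cube d r"
    if "u' - u \<in> cube d (2 * t)" "\<not> skel Z u'" "s \<in> cube d r" "Z (u + s)" for u u' s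
  proof -
    have "u + s - u' = s + - (u' - u)" by simp
    then have "u + s - u' \<in> cube d (r + 2 * t)"
      by (rule cube_memI[OF _ that(3) cube_uminus[OF that(1)]]) simp
    moreover have "u' + (u + s - u') = u + s" by simp
    ultimately show ?thesis using that(2,4) unfolding skeleton_def by (metis DiffI)
  qed
  have near': "v - v' \<in> cube d (2 * t)" using near cube_minus_commute by blast
  note s1 = s(1)[unfolded central_def] and s2 = s(2)[unfolded central_def]
  have "\<kappa> (v + s) \<le> \<kappa> (v' + s')"
    using cov[OF near' sk(1), of s'] s1 s2 by metis
  moreover have "\<kappa> (v' + s') \<le> \<kappa> (v + s)"
    using cov[OF near sk(2), of s] s1 s2 by metis
  moreover have "v + s - (v' + s') \<in> cube d (16 * r)"
  proof (rule cube_memI)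
    show "v + s - (v' + s') = (v + s - v') + - s'" by simp
    show "v + s - v' \<in> cube d r" using cov[OF near sk(2), of s] s1 by blast
    show "- s' \<in> cube d r" using s2 cube_uminus by blast
  qed simp
  ultimately show ?thesis
    using s1 s2 v by (intro distinct_colors) (auto intro: grid_add cube_grid)
qed

text \<open>Each neighbourhood of radius \<open>t\<close> is matched against a single extension
  \<open>F c\<close>. On the skeleton every nearby extension gives the actual label, since it
  reproduces the truncated run on the final tape; vertices off the skeleton in one neighbourhood are
  at most \<open>2 * t\<close> apart and share a centre, which is taken as \<open>c\<close>. If
  there are none, any net point near \<open>w\<close> serves.\<close>

lemma label_coloring: "is_coloring d L (\<lambda>v. (\<sigma> v, label \<sigma> Z \<kappa> final_tape v))"
  unfolding is_coloring_def
proof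
  fix w assume w: "w \<in> grid d"
  define F where "F c = (SOME f. ext \<sigma> Z final_tape c f)" for c
  have F: "ext \<sigma> Z final_tape c (F c)" if "c \<in> grid d" "Z c" for c
    using good_final_tape[OF that] unfolding F_def good_def by (rule someI_ex)
  have skel_label: "label \<sigma> Z \<kappa> final_tape v = F c (v - c)"
    if c: "c \<in> grid d" "Z c" and v: "v - c \<in> cube d (r + 2 * t)" "skel Z v" for v c
  proof -
    have "early_output d A r \<sigma> final_tape (c + (v - c)) = Some (F c (v - c))"
      using F[OF c] v unfolding extends_def by (metis add_diff_cancel_left' add_diff_eq)
    then show ?thesis using v(2) by (simp add: label_def)
  qed
  have fill_label: "label \<sigma> Z \<kappa> final_tape v = F (v + s) (v - (v + s))"
    if v: "v \<in> grid d" and sk: "\<not> skel Z v" and s: "central Z \<kappa> v s" for v s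
  proof -
    have ex: "Ex (central Z \<kappa> v)" using s by blast
    have "central Z \<kappa> v (Eps (central Z \<kappa> v))" by (rule someI[where P = "central Z \<kappa> v", OF s])
    moreover have "v - v \<in> cube d (2 * t)" by simp
    ultimately have "v + Eps (central Z \<kappa> v) = v + s" using central_of_near[OF v v _ sk sk _ s] by blast
    then have "Eps (central Z \<kappa> v) = s" by (rule add_left_imp_eq)
    then show ?thesis using sk ex by (simp add: label_def F_def)
  qed
  have gw: "w + g \<in> grid d" if "g \<in> gball d 0 t" for g
    using w that by (auto intro: grid_add gball_grid)
  have gc: "g \<in> cube d t" if "g \<in> gball d 0 t" for g using that gball_subset_cube by blast
  obtain c where c: "c \<in> grid d" "Z c" "w - c \<in> cube d (r + 3 * t)"
    and lab: "\<And>g. g \<in> gball d 0 t \<Longrightarrow> label \<sigma> Z \<kappa> final_tape (w + g) = F c (w + g - c)"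
  proof (cases "\<forall>g\<in>gball d 0 t. skel Z (w + g)")
    case True
    obtain s where s: "s \<in> cube d r" "Z (w + s)" using covering[OF w] by blast
    show thesis
    proof (rule that[of "w + s"])
      show ws: "w + s \<in> grid d" using w s by (auto intro: grid_add cube_grid)
      show "w - (w + s) \<in> cube d (r + 3 * t)" using cube_in_mono[OF cube_uminus[OF s(1)], of "r + 3 * t"] by simp
      show "label \<sigma> Z \<kappa> final_tape (w + g) = F (w + s) (w + g - (w + s))" if g: "g \<in> gball d 0 t" for g
      proof (rule skel_label[OF ws s(2)])
        have "w + g - (w + s) = g + - s" by simp
        then show "w + g - (w + s) \<in> cube d (r + 2 * t)"
          by (rule cube_memI[OF _ gc[OF g] cube_uminus[OF s(1)]]) simp
      qed (use True g in blast)
    qed (fact s)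
  next
    case False
    then obtain g0 where g0: "g0 \<in> gball d 0 t" "\<not> skel Z (w + g0)" by blast
    obtain s where s: "central Z \<kappa> (w + g0) s" using central_exists[OF gw[OF g0(1)]] by blast
    have sc: "s \<in> cube d r" and Zs: "Z (w + g0 + s)" using s by (simp_all add: central_def)
    show thesis
    proof (rule that[of "w + g0 + s"])
      show cg: "w + g0 + s \<in> grid d" using gw[OF g0(1)] sc by (auto intro: grid_add cube_grid)
      have "w - (w + g0 + s) = - g0 + - s" by simp
      then show "w - (w + g0 + s) \<in> cube d (r + 3 * t)"
        by (rule cube_memI[OF _ cube_uminus[OF gc[OF g0(1)]] cube_uminus[OF sc]]) simp
      show "label \<sigma> Z \<kappa> final_tape (w + g) = F (w + g0 + s) (w + g - (w + g0 + s))" if g: "g \<in> gball d 0 t" for g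
      proof (cases "skel Z (w + g)")
        case True
        have "w + g - (w + g0 + s) = (g + - g0) + - s" by simp
        then have "w + g - (w + g0 + s) \<in> cube d (r + 2 * t)"
          by (rule cube_memI[OF _ cube_add[OF gc[OF g] cube_uminus[OF gc[OF g0(1)]]] cube_uminus[OF sc]]) simp
        then show ?thesis by (rule skel_label[OF cg Zs _ True])
      next
        case False
        obtain s' where s': "central Z \<kappa> (w + g) s'" using central_exists[OF gw[OF g]] by blast
        have "w + g0 - (w + g) = g0 + - g" by simp
        then have "w + g0 - (w + g) \<in> cube d (2 * t)"
          by (rule cube_memI[OF _ gc[OF g0(1)] cube_uminus[OF gc[OF g]]]) simp
        from central_of_near[OF gw[OF g] gw[OF g0(1)] this False g0(2) s' s]
        show ?thesis using fill_label[OF gw[OF g] False s'] by (simp only:)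
      qed
    qed (fact Zs)
  qed
  have "(\<sigma> (w + g), label \<sigma> Z \<kappa> final_tape (w + g)) = (\<sigma> (c + (w - c + g)), F c (w - c + g))"
    if "g \<in> gball d 0 t" for g
  proof -
    have "c + (w - c + g) = w + g" "w - c + g = w + g - c" by simp_all
    then show ?thesis using lab[OF that] by (simp only:)
  qed
  then have "nbhd d (\<lambda>v. (\<sigma> v, label \<sigma> Z \<kappa> final_tape v)) w t =
      nbhd d (\<lambda>u. (\<sigma> (c + u), F c u)) (w - c) t"
    unfolding nbhd_def by (intro restrict_ext)
  also have "\<dots> \<in> allowed L" using F[OF c(1,2)] c(3) by (simp add: extends_def)
  finally show "nbhd d (\<lambda>v. (\<sigma> v, label \<sigma> Z \<kappa> final_tape v)) w t \<in> allowed L" .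
qed

end

text \<open>The label \<open>a\<close> replaces invalid inputs, so that the rule is local on arbitrary labellings.\<close>

lemma local_solution:
  assumes a: "a \<in> in_labels L"
  shows "\<exists>\<Phi> :: (vertex \<Rightarrow> nat \<times> nat) \<Rightarrow> vertex \<Rightarrow> nat. local_rule d \<Phi> \<and>
    (\<forall>\<sigma> \<kappa>. \<sigma> \<in> grid d \<rightarrow> in_labels L \<longrightarrow>
      (\<forall>u\<in>grid d. \<forall>v\<in>grid d. v - u \<in> cube d (16 * r) \<longrightarrow> \<kappa> u = \<kappa> v \<longrightarrow> u = v) \<longrightarrow>
      (\<forall>v\<in>grid d. \<kappa> v < q) \<longrightarrow>
      is_coloring d L (\<lambda>v. (\<sigma> v, \<Phi> (\<lambda>v. (\<sigma> v, \<kappa> v)) v)))"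
proof -
  define S where "S l = (\<lambda>v. if fst (l v) \<in> in_labels L then fst (l v) else a)" for l :: "vertex \<Rightarrow> nat \<times> nat"
  define K where "K l = (\<lambda>v. snd (l v))" for l :: "vertex \<Rightarrow> nat \<times> nat"
  define Z where "Z l = net d r (K l) q" for l
  define Y where "Y i l = tape (S l) (Z l) (K l) i" for i l
  define \<Phi> where "\<Phi> l = label (S l) (Z l) (K l) (\<lambda>v. the (Y q l v))" for l
  have S: "local_rule d S"
    unfolding S_def by (rule local_rule_pointwise[of d "\<lambda>y. if fst y \<in> in_labels L then fst y else a"])
  have K: "local_rule d K" unfolding K_def by (rule local_rule_pointwise)
  have Z: "local_rule d Z" unfolding Z_def by (rule local_rule_comp[OF K net_local])
  have S_in: "S l \<in> grid d \<rightarrow> in_labels L" for l using a by (simp add: S_def)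
  have Y: "local_rule d (Y i)" for i
  proof (induction i)
    case 0
    show ?case by (rule local_ruleI) (simp add: Y_def)
  next
    case (Suc i)
    have "local_rule d (\<lambda>l. step i (S l) (Z l) (K l) (Y i l))"
      by (rule local_rule_map4[OF S Z K Suc, where ?P1.0 = "\<lambda>\<sigma>. \<sigma> \<in> grid d \<rightarrow> in_labels L"
            and ?P4.0 = valid_tape and k = "18 * r"])
         (rule S_in, simp add: Y_def valid_tape_tape, rule step_agree)
    then show ?case by (simp add: Y_def)
  qed
  have "local_rule d (\<lambda>l v. the (Y q l v))"
    by (rule local_rule_comp[OF Y local_rule_pointwise])
  then have "local_rule d (\<lambda>l. label (S l) (Z l) (K l) (\<lambda>v. the (Y q l v)))"
    by (rule local_rule_map4[OF S Z K, where ?P1.0 = "\<lambda>_. True" and ?P4.0 = "\<lambda>_. True" and k = "7 * r"])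
       (simp, simp, rule label_agree)
  then have "local_rule d \<Phi>" by (simp add: \<Phi>_def[abs_def])
  moreover have "is_coloring d L (\<lambda>v. (\<sigma> v, \<Phi> (\<lambda>v. (\<sigma> v, \<kappa> v)) v))"
    if \<sigma>: "\<sigma> \<in> grid d \<rightarrow> in_labels L"
      and \<kappa>: "\<forall>u\<in>grid d. \<forall>v\<in>grid d. v - u \<in> cube d (16 * r) \<longrightarrow> \<kappa> u = \<kappa> v \<longrightarrow> u = v"
      and q: "\<forall>v\<in>grid d. \<kappa> v < q" for \<sigma> \<kappa>
  proof -
    let ?l = "\<lambda>v. (\<sigma> v, \<kappa> v)"
    have Kl: "K ?l = \<kappa>" by (simp add: K_def)
    have sep: "separated (Z ?l)"
      unfolding separated_def
    proof (intro ballI impI)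
      fix u v assume uv: "u \<in> grid d" "v \<in> grid d" "Z ?l u" "Z ?l v" "u - v \<in> cube d r"
      have "v - u \<in> cube d r" using uv(5) cube_minus_commute by blast
      then show "u = v"
        using uv(3,4) unfolding Z_def Kl
        by (intro net_separated[OF _ uv(1,2)]) (use \<kappa> cube_mono[of r "16 * r" d] in auto)
    qed
    have "is_coloring d L (\<lambda>v. (S ?l v, label (S ?l) (Z ?l) \<kappa> (\<lambda>v. the (tape (S ?l) (Z ?l) \<kappa> q v)) v))"
    proof (rule label_coloring[OF S_in sep])
      show "\<exists>s\<in>cube d r. Z ?l (v + s)" if "v \<in> grid d" for v
        unfolding Z_def Kl by (rule net_covering) (use that q in simp)
      show "u = v" if "u \<in> grid d" "v \<in> grid d" "\<kappa> u = \<kappa> v" "u - v \<in> cube d (16 * r)" for u v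
        using \<kappa> that cube_minus_commute by blast
    qed (use q in simp)
    then have col: "is_coloring d L (\<lambda>v. (S ?l v, \<Phi> ?l v))"
      by (simp add: \<Phi>_def Y_def Kl)
    have "nbhd d (\<lambda>v. (S ?l v, \<Phi> ?l v)) v t = nbhd d (\<lambda>v. (\<sigma> v, \<Phi> ?l v)) v t" if "v \<in> grid d" for v
      unfolding nbhd_def
    proof (rule restrict_ext)
      fix u assume "u \<in> gball d 0 t"
      then have "\<sigma> (v + u) \<in> in_labels L" using \<sigma> that by (auto intro: grid_add gball_grid)
      then show "(S ?l (v + u), \<Phi> ?l (v + u)) = (\<sigma> (v + u), \<Phi> ?l (v + u))" by (simp add: S_def)
    qed
    then show ?thesis using col by (simp add: is_coloring_def)
  qed
  ultimately show ?thesis by blast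
qed

end

section \<open>Complexity of the resulting algorithm\<close>

lemma log_star_exists: "\<exists>n. (log 2 ^^ n) x \<le> 1"
proof -
  have "x \<le> real N \<Longrightarrow> \<exists>n. (log 2 ^^ n) x \<le> 1" for N x
  proof (induction N arbitrary: x)
    case 0
    then show ?case by (intro exI[of _ 0]) simp
  next
    case (Suc N)
    show ?case
    proof (cases "x \<le> 1")
      case True
      then show ?thesis by (intro exI[of _ 0]) simp
    next
      case False
      have "real (Suc N) \<le> 2 ^ N"
        using less_exp[of N] by (metis Suc_leI of_nat_le_iff of_nat_numeral of_nat_power)
      then have "log 2 x \<le> log 2 (2 ^ N)" using False Suc.prems by (intro log_mono) auto
      then have "log 2 x \<le> real N" by simp
      from Suc.IH[OF this] obtain n where "(log 2 ^^ n) (log 2 x) \<le> 1" by blast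
      then have "(log 2 ^^ Suc n) x \<le> 1" by (simp only: funpow_Suc_right o_apply)
      then show ?thesis by blast
    qed
  qed
  moreover have "x \<le> real (nat \<lceil>x\<rceil>)" by (rule real_nat_ceiling_ge)
  ultimately show ?thesis by blast
qed

text \<open>Induction from the last iterate back to \<open>x\<close>, undoing one logarithm at a
  time; every iterate before the last exceeds 1, so the logarithm can be inverted there.\<close>

lemma le_tower_log_star: "x \<le> real (tower (log_star x))"
proof -
  let ?n = "log_star x"
  have "(log 2 ^^ (?n - m)) x \<le> real (tower m)" if "m \<le> ?n" for m
    using that
  proof (induction m)
    case 0
    have "(log 2 ^^ ?n) x \<le> 1" unfolding log_star_def by (rule LeastI_ex) (rule log_star_exists)
    then show ?case by simp
  next
    case (Suc m)
    let ?y = "(log 2 ^^ (?n - Suc m)) x"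
    have "?n - Suc m < ?n" using Suc.prems by simp
    from not_less_Least[OF this[unfolded log_star_def]] have y: "1 < ?y"
      by (simp add: log_star_def)
    have "?n - m = Suc (?n - Suc m)" using Suc.prems by simp
    then have "log 2 ?y = (log 2 ^^ (?n - m)) x" by simp
    then have "log 2 ?y \<le> real (tower m)" using Suc by simp
    then have "?y \<le> 2 powr real (tower m)" using y by (simp add: log_le_iff)
    then show ?case by (simp add: powr_realpow)
  qed
  from this[of ?n] show ?thesis by simp
qed

lemma log_star_pos: "1 < x \<Longrightarrow> 0 < log_star x"
proof (rule ccontr)
  assume "1 < x" "\<not> 0 < log_star x"
  moreover have "(log 2 ^^ log_star x) x \<le> 1"
    unfolding log_star_def by (rule LeastI_ex) (rule log_star_exists)
  ultimately show False by simp
qed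

lemma cube_subset_gball_le: "d * k \<le> n \<Longrightarrow> cube d k \<subseteq> gball d 0 n"
  using cube_subset_gball[of d k] gball_mono[of "d * k" n d 0] by blast

lemma agree_explored:
  assumes u: "u \<in> cube d \<rho>" and n: "d * (\<rho> + m) \<le> n"
  shows "agree d m (nbhd d f v n) u f (v + u)"
proof -
  have "u + w \<in> gball d 0 n" if "w \<in> cube d m" for w
    using cube_add[OF u that] cube_subset_gball_le[OF n] by blast
  then show ?thesis by (simp add: agree_def nbhd_def add.assoc)
qed

section \<open>Running a local rule on the random colouring as a uniform algorithm\<close>

context reduction
begin

text \<open>The radius is that of \<open>color_agree\<close>, for all vertices read by a rule of
  radius \<open>\<rho>\<close>; the factor \<open>d\<close> makes the cube fit into a ball of graph
  distance.\<close>

definition settled :: "nat \<Rightarrow> nat \<Rightarrow> (vertex \<Rightarrow> real) \<Rightarrow> vertex \<Rightarrow> bool" where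
  "settled \<rho> n x v \<longleftrightarrow> (\<forall>u\<in>cube d \<rho>. d * (\<rho> + 2 * k * Suc (key x (v + u))) \<le> n)"

text \<open>The fallback \<open>z\<close> gives a legal output on every labelled ball, including
  those from the null set where the colouring is not proper.\<close>

definition colored_alg :: "nat set \<Rightarrow> nat set \<Rightarrow> nat \<Rightarrow> nat \<Rightarrow> ((vertex \<Rightarrow> nat \<times> nat) \<Rightarrow> vertex \<Rightarrow> nat) \<Rightarrow> uniform_alg" where
  "colored_alg Sin Sout z \<rho> \<Phi> =
     \<lparr>stops = {(n, \<sigma>, x). \<sigma> \<in> gball d 0 n \<rightarrow>\<^sub>E Sin \<and> x \<in> gball d 0 n \<rightarrow>\<^sub>E {0..1} \<and> settled \<rho> n x 0},
      result = (\<lambda>(n, \<sigma>, x). let y = \<Phi> (\<lambda>u. (\<sigma> u, color x u)) 0 in if y \<in> Sout then y else z)\<rparr>"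

text \<open>Keys computed from the explored ball may be wrong, since labels outside it read as
  \<open>undefined\<close>. But if the true or the apparent key passes the test, the ball is large
  enough for \<open>key_agree\<close> and the two are equal, so the test can be carried out on the
  ball alone.\<close>

lemma key_explored:
  assumes u: "u \<in> cube d \<rho>"
  shows "d * (\<rho> + 2 * k * Suc (key x (v + u))) \<le> n \<longleftrightarrow> d * (\<rho> + 2 * k * Suc (key (nbhd d x v n) u)) \<le> n"
    and "d * (\<rho> + 2 * k * Suc (key x (v + u))) \<le> n \<Longrightarrow> color (nbhd d x v n) u = color x (v + u)"
proof -
  let ?y = "nbhd d x v n"
  have 1: "key x (v + u) = key ?y u" if "d * (\<rho> + 2 * k * Suc (key ?y u)) \<le> n"
    by (rule key_agree[OF agree_mono[OF agree_explored[OF u that]]]) auto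
  have 2: "key ?y u = key x (v + u)" "color ?y u = color x (v + u)"
    if "d * (\<rho> + 2 * k * Suc (key x (v + u))) \<le> n"
  proof -
    show "key ?y u = key x (v + u)"
      by (rule key_agree[OF agree_mono[OF agree_sym[OF agree_explored[OF u that]]]]) auto
    show "color ?y u = color x (v + u)"
      using color_agree[OF agree_sym[OF agree_explored[OF u that]]] by simp
  qed
  show "d * (\<rho> + 2 * k * Suc (key x (v + u))) \<le> n \<longleftrightarrow> d * (\<rho> + 2 * k * Suc (key ?y u)) \<le> n"
    using 1 2(1) by metis
  show "d * (\<rho> + 2 * k * Suc (key x (v + u))) \<le> n \<Longrightarrow> color ?y u = color x (v + u)" by (rule 2(2))
qed

lemma explored_in_stops_iff:
  assumes v: "v \<in> grid d" and \<sigma>: "\<sigma> \<in> grid d \<rightarrow> Sin" and x: "x \<in> space (random_labels d)"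
  shows "explored d \<sigma> x v n \<in> stops (colored_alg Sin Sout z \<rho> \<Phi>) \<longleftrightarrow> settled \<rho> n x v"
proof -
  have "nbhd d \<sigma> v n \<in> gball d 0 n \<rightarrow>\<^sub>E Sin"
    using \<sigma> v by (auto simp: nbhd_def dest!: gball_grid intro: grid_add)
  moreover have "nbhd d x v n \<in> gball d 0 n \<rightarrow>\<^sub>E {0..1}"
    using x v by (force simp: nbhd_def space_random_labels PiE_iff dest!: gball_grid intro: grid_add)
  moreover have "settled \<rho> n (nbhd d x v n) 0 \<longleftrightarrow> settled \<rho> n x v"
    unfolding settled_def using key_explored(1) by simp
  ultimately show ?thesis by (simp add: colored_alg_def explored_def)
qed

lemma measurable_settled:
  assumes y: "\<And>v. (\<lambda>\<omega>. y \<omega> v) \<in> borel_measurable S"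
  shows "{\<omega> \<in> space S. settled \<rho> n (y \<omega>) v} \<in> sets S"
proof -
  have "Measurable.pred S (\<lambda>\<omega>. \<forall>u\<in>cube d \<rho>. d * (\<rho> + 2 * k * Suc (key (y \<omega>) (v + u))) \<le> n)"
    by (intro pred_intros_finite finite_cube measurable_compose[OF measurable_key[OF y]]) simp
  then show ?thesis by (simp add: pred_def settled_def)
qed

lemma borel_measurable_ball_label:
  "(\<lambda>x. x w) \<in> borel_measurable (PiM (gball d 0 n) (\<lambda>_. unit_labels))"
proof (cases "w \<in> gball d 0 n")
  case True
  have "(\<lambda>x. x w) \<in> PiM (gball d 0 n) (\<lambda>_. unit_labels) \<rightarrow>\<^sub>M restrict_space lborel {0..1}"
    unfolding unit_labels_def[symmetric] by (rule measurable_component_singleton[OF True])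
  then show ?thesis by (simp add: measurable_restrict_space2_iff)
next
  case False
  then have "x w = undefined" if "x \<in> space (PiM (gball d 0 n) (\<lambda>_. unit_labels))" for x
    using that by (auto simp: space_PiM PiE_iff extensional_def)
  then show ?thesis by (subst measurable_cong[where g = "\<lambda>_. undefined"]) simp_all
qed

context
  fixes \<Phi> :: "(vertex \<Rightarrow> nat \<times> nat) \<Rightarrow> vertex \<Rightarrow> nat" and \<rho> :: nat
  assumes \<Phi>: "\<And>l l' v v'. v \<in> grid d \<Longrightarrow> v' \<in> grid d \<Longrightarrow> agree d \<rho> l v l' v' \<Longrightarrow> \<Phi> l v = \<Phi> l' v'"
begin

lemma is_uniform_colored_alg:
  assumes z: "z \<in> Sout"
  shows "is_uniform_alg d Sin Sout (colored_alg Sin Sout z \<rho> \<Phi>)"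
  unfolding is_uniform_alg_def
proof (intro conjI allI ballI)
  let ?A = "colored_alg Sin Sout z \<rho> \<Phi>"
  show "case s of (n, \<sigma>, x) \<Rightarrow> \<sigma> \<in> gball d 0 n \<rightarrow>\<^sub>E Sin \<and> x \<in> gball d 0 n \<rightarrow>\<^sub>E {0..1}"
    if "s \<in> stops ?A" for s
    using that by (auto simp: colored_alg_def)
  fix n \<sigma> assume \<sigma>: "\<sigma> \<in> gball d 0 n \<rightarrow>\<^sub>E Sin"
  let ?P = "PiM (gball d 0 n) (\<lambda>_. unit_labels)"
  have "{x. (n, \<sigma>, x) \<in> stops ?A} = {x \<in> space ?P. settled \<rho> n x 0}"
    using \<sigma> by (auto simp: colored_alg_def space_PiM)
  then show "{x. (n, \<sigma>, x) \<in> stops ?A} \<in> sets ?P"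
    using measurable_settled[OF borel_measurable_ball_label] by simp
  define F where "F g = (let y = \<Phi> (\<lambda>u. (\<sigma> u, g u)) 0 in if y \<in> Sout then y else z)" for g
  have "result ?A (n, \<sigma>, x) = F (\<lambda>u\<in>cube d \<rho>. color x u)" for x
  proof -
    have "\<Phi> (\<lambda>u. (\<sigma> u, color x u)) 0 = \<Phi> (\<lambda>u. (\<sigma> u, (\<lambda>u\<in>cube d \<rho>. color x u) u)) 0"
      by (rule \<Phi>) (simp_all add: agree_def)
    then show ?thesis by (simp add: colored_alg_def F_def)
  qed
  moreover have "(\<lambda>x. F (\<lambda>u\<in>cube d \<rho>. color x u)) \<in> ?P \<rightarrow>\<^sub>M count_space UNIV"
    by (intro measurable_finite_family finite_cube measurable_color borel_measurable_ball_label)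
  ultimately have "(\<lambda>x. result ?A (n, \<sigma>, x)) \<in> ?P \<rightarrow>\<^sub>M count_space UNIV" by simp
  then have "(\<lambda>x. if result ?A (n, \<sigma>, x) \<in> Sout then result ?A (n, \<sigma>, x) else z) \<in> ?P \<rightarrow>\<^sub>M count_space Sout"
    by (rule measurable_compose) (use z in simp)
  moreover have "result ?A (n, \<sigma>, x) \<in> Sout" for x using z by (simp add: colored_alg_def Let_def)
  ultimately show "(\<lambda>x. result ?A (n, \<sigma>, x)) \<in> restrict_space ?P {x. (n, \<sigma>, x) \<in> stops ?A} \<rightarrow>\<^sub>M count_space Sout"
    by (intro measurable_restrict_space1) simp
qed

lemma colored_alg_output:
  fixes Sin Sout :: "nat set" and z :: nat
  assumes v: "v \<in> grid d" and \<sigma>: "\<sigma> \<in> grid d \<rightarrow> Sin" and x: "x \<in> space (random_labels d)"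
  defines "A \<equiv> colored_alg Sin Sout z \<rho> \<Phi>" and "y \<equiv> \<Phi> (\<lambda>v. (\<sigma> v, color x v)) v"
  shows "coding_radius d A \<sigma> x v < \<infinity>" and "y \<in> Sout \<Longrightarrow> output_label d A \<sigma> x v = y"
proof -
  define m where "m = (LEAST n. settled \<rho> n x v)"
  let ?f = "\<lambda>u. d * (\<rho> + 2 * k * Suc (key x (v + u)))"
  have "settled \<rho> (Max (?f ` cube d \<rho>)) x v" unfolding settled_def by (intro ballI Max_ge) auto
  then have m: "settled \<rho> m x v" unfolding m_def by (rule LeastI)
  have cr: "coding_radius d A \<sigma> x v = enat m"
    unfolding coding_radius_def A_def
  proof (rule INF_eqI)
    fix n assume "n \<in> {n. explored d \<sigma> x v n \<in> stops (colored_alg Sin Sout z \<rho> \<Phi>)}"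
    then have "settled \<rho> n x v" using explored_in_stops_iff[OF v \<sigma> x] by simp
    then show "enat m \<le> enat n" by (simp add: m_def Least_le)
  qed (use m explored_in_stops_iff[OF v \<sigma> x] in auto)
  then show "coding_radius d A \<sigma> x v < \<infinity>" by simp
  have "\<Phi> (\<lambda>u. (nbhd d \<sigma> v m u, color (nbhd d x v m) u)) 0 = y"
    unfolding y_def
  proof (rule \<Phi>)
    have "nbhd d \<sigma> v m u = \<sigma> (v + u)" "color (nbhd d x v m) u = color x (v + u)" if u: "u \<in> cube d \<rho>" for u
    proof -
      have le: "d * (\<rho> + 2 * k * Suc (key x (v + u))) \<le> m" using m u by (simp add: settled_def)
      then show "color (nbhd d x v m) u = color x (v + u)" by (rule key_explored(2)[OF u])
      have "d * \<rho> \<le> m" by (rule order_trans[OF _ le]) simp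
      then have "u \<in> gball d 0 m" using cube_subset_gball_le u by blast
      then show "nbhd d \<sigma> v m u = \<sigma> (v + u)" by (simp add: nbhd_def)
    qed
    then show "agree d \<rho> (\<lambda>u. (nbhd d \<sigma> v m u, color (nbhd d x v m) u)) 0 (\<lambda>v. (\<sigma> v, color x v)) v"
      by (simp add: agree_def)
  qed (simp_all add: v)
  then show "y \<in> Sout \<Longrightarrow> output_label d A \<sigma> x v = y"
    unfolding output_label_def cr by (simp add: A_def colored_alg_def explored_def Let_def)
qed

text \<open>The union bound over the \<open>h\<close> vertices of \<open>cube d \<rho>\<close> loses
  a factor \<open>h\<close>, which \<open>h\<close> further levels make up for, since
  \<open>2 ^ h * tower n \<le> tower (n + h)\<close>.\<close>

lemma colored_alg_complexity:
  assumes i: "i \<in> Sin"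
  shows "\<exists>C>0. has_uniform_complexity d Sin (colored_alg Sin Sout z \<rho> \<Phi>) (\<lambda>\<epsilon>. C * real (log_star (1 / \<epsilon>)))"
proof -
  let ?A = "colored_alg Sin Sout z \<rho> \<Phi>" and ?M = "random_labels d"
  define h where "h = card (cube d \<rho>)"
  \<comment> \<open>For positive \<open>n\<close>, \<open>Suc (n + h)\<close> is at most
    \<open>n * (h + 2)\<close>, so \<open>C * n\<close> covers the radius in \<open>settled\<close>
    for all keys below \<open>Suc (n + h) * palette\<close>; the successor makes \<open>C\<close>
    positive.\<close>
  define C where "C = Suc (d * (\<rho> + 2 * k * ((h + 2) * palette)))"
  have "prob_radius_gt d Sin ?A (real C * real (log_star (1 / \<epsilon>))) \<le> ennreal \<epsilon>"
    if \<epsilon>: "0 < \<epsilon>" "\<epsilon> \<le> 1 / 2" for \<epsilon>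
  proof -
    define n where "n = log_star (1 / \<epsilon>)"
    have "1 < 1 / \<epsilon>" using \<epsilon> by (simp add: field_simps)
    then have n: "0 < n" unfolding n_def by (rule log_star_pos)
    have tn: "1 / \<epsilon> \<le> real (tower n)" unfolding n_def by (rule le_tower_log_star)
    have Cn: "real C * real n = real (C * n)" by simp
    have floor: "nat \<lfloor>real C * real n\<rfloor> = C * n" by (simp only: Cn floor_of_nat nat_int)
    show ?thesis
      unfolding prob_radius_gt_def n_def[symmetric]
    proof (rule SUP_least)
      fix \<sigma> assume \<sigma>: "\<sigma> \<in> gball d 0 (nat \<lfloor>real C * real n\<rfloor>) \<rightarrow>\<^sub>E Sin"
      \<comment> \<open>\<open>\<sigma>\<close> is \<open>undefined\<close> outside the ball, while
        \<open>explored_in_stops_iff\<close> expects a labelling of the whole grid.\<close>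
      define \<sigma>' where "\<sigma>' v = (if v \<in> gball d 0 (C * n) then \<sigma> v else i)" for v
      have \<sigma>': "\<sigma>' \<in> grid d \<rightarrow> Sin" using \<sigma> i unfolding floor by (auto simp: \<sigma>'_def)
      let ?E = "\<lambda>u. {x \<in> space ?M. Suc (n + h) * palette \<le> key x u}"
      have E: "?E u \<in> sets ?M" if "u \<in> cube d \<rho>" for u
      proof -
        \<comment> \<open>the labels outside the grid are \<open>undefined\<close>\<close>
        have "(\<lambda>x. x w) \<in> borel_measurable ?M" for w
        proof (cases "w \<in> grid d")
          case False
          then have "x w = undefined" if "x \<in> space ?M" for x
            using that by (auto simp: space_random_labels PiE_iff extensional_def)
          then show ?thesis by (subst measurable_cong[where g = "\<lambda>_. undefined"]) simp_all
        qed (rule borel_measurable_label)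
        then have "(\<lambda>x. key x u) \<in> ?M \<rightarrow>\<^sub>M count_space UNIV" by (rule measurable_key)
        from measurable_sets[OF this, of "{Suc (n + h) * palette..}"] show ?thesis
          by (simp add: vimage_def Int_def conj_commute)
      qed
      have "{x \<in> space ?M. ereal_of_enat (coding_radius d ?A \<sigma> x 0) > ereal (real C * real n)} \<subseteq>
          (\<Union>u\<in>cube d \<rho>. ?E u)"
      proof
        fix x assume "x \<in> {x \<in> space ?M. ereal_of_enat (coding_radius d ?A \<sigma> x 0) > ereal (real C * real n)}"
        then have x: "x \<in> space ?M" and "explored d \<sigma> x 0 (C * n) \<notin> stops ?A"
          unfolding Cn by (auto simp: coding_radius_gt_iff)
        moreover have "explored d \<sigma> x 0 (C * n) = explored d \<sigma>' x 0 (C * n)"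
          by (simp add: explored_def nbhd_def \<sigma>'_def cong: restrict_cong)
        ultimately have "\<not> settled \<rho> (C * n) x 0" using explored_in_stops_iff[OF grid_zero \<sigma>' x] by simp
        then obtain u where u: "u \<in> cube d \<rho>" "C * n < d * (\<rho> + 2 * k * Suc (key x u))"
          by (auto simp: settled_def not_le)
        have "Suc (n + h) * palette \<le> key x u"
        proof (rule ccontr)
          assume "\<not> ?thesis"
          then have "Suc (key x u) \<le> Suc (n + h) * palette" by simp
          also have "\<dots> \<le> (n * (h + 2)) * palette"
          proof (rule mult_right_mono)
            show "Suc (n + h) \<le> n * (h + 2)" using n by (cases n) (simp_all add: algebra_simps)
          qed simp
          finally have "d * (\<rho> + 2 * k * Suc (key x u)) \<le> d * (\<rho> + 2 * k * (n * (h + 2) * palette))"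
            by (intro mult_left_mono add_left_mono) auto
          also have "\<dots> \<le> d * (n * \<rho> + 2 * k * (n * (h + 2) * palette))"
            using n by (intro mult_left_mono add_right_mono) auto
          also have "\<dots> \<le> C * n" by (simp add: C_def algebra_simps)
          finally show False using u(2) by simp
        qed
        then show "x \<in> (\<Union>u\<in>cube d \<rho>. ?E u)" using u(1) x by blast
      qed
      then have "emeasure ?M {x \<in> space ?M. ereal_of_enat (coding_radius d ?A \<sigma> x 0) > ereal (real C * real n)}
          \<le> emeasure ?M (\<Union>u\<in>cube d \<rho>. ?E u)"
        using E by (intro emeasure_mono) auto
      also have "\<dots> = ennreal (measure ?M (\<Union>u\<in>cube d \<rho>. ?E u))"
        by (rule random_labels.emeasure_eq_measure)
      also have "\<dots> \<le> ennreal \<epsilon>"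
      proof (rule ennreal_leI)
        have "measure ?M (\<Union>u\<in>cube d \<rho>. ?E u) \<le> (\<Sum>u\<in>cube d \<rho>. measure ?M (?E u))"
          using E by (intro measure_UNION_le) auto
        also have "\<dots> \<le> (\<Sum>u\<in>cube d \<rho>. 1 / tower (Suc (n + h)))"
          by (intro sum_mono prob_key_ge) (rule cube_grid)
        also have "\<dots> = real h / tower (Suc (n + h))" by (simp add: h_def)
        also have "\<dots> \<le> 1 / tower n"
        proof -
          have "h * tower n \<le> 2 ^ h * tower n" by (intro mult_right_mono less_imp_le[OF less_exp]) simp
          also have "\<dots> \<le> tower (n + h)" by (rule two_power_tower[OF n])
          also have "\<dots> \<le> tower (Suc (n + h))" using tower_add[of "n + h" 1] by simp
          finally have "real (h * tower n) \<le> real (tower (Suc (n + h)))" by (simp only: of_nat_le_iff)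
          then show ?thesis using tower_pos[of n] tower_pos[of "Suc (n + h)"]
            by (simp add: field_simps del: tower.simps)
        qed
        also have "\<dots> \<le> \<epsilon>"
          using tn \<epsilon>(1) tower_pos[of n] by (simp add: field_simps)
        finally show "measure ?M (\<Union>u\<in>cube d \<rho>. ?E u) \<le> \<epsilon>" .
      qed
      finally show "emeasure ?M {x \<in> space ?M. ereal_of_enat (coding_radius d ?A \<sigma> x 0) > ereal (real C * real n)}
        \<le> ennreal \<epsilon>" .
    qed
  qed
  then have "has_uniform_complexity d Sin ?A (\<lambda>\<epsilon>. real C * real (log_star (1 / \<epsilon>)))"
    unfolding has_uniform_complexity_def by (intro exI[of _ "1 / 2"]) auto
  moreover have "0 < real C" unfolding of_nat_0_less_iff by (simp only: C_def zero_less_Suc)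
  ultimately show ?thesis by blast
qed

end

end

section \<open>Assembly of the algorithm and the sufficient conditions on the tail\<close>

lemma coloring_out_label:
  assumes "is_lcl d L" "is_coloring d L (\<lambda>v. (\<sigma> v, f v))" "v \<in> grid d"
  shows "f v \<in> out_labels L"
proof -
  have "nbhd d (\<lambda>v. (\<sigma> v, f v)) v (radius L) \<in> gball d 0 (radius L) \<rightarrow>\<^sub>E in_labels L \<times> out_labels L"
    using assms by (auto simp: is_lcl_def is_coloring_def)
  then have "nbhd d (\<lambda>v. (\<sigma> v, f v)) v (radius L) 0 \<in> in_labels L \<times> out_labels L" by (rule PiE_mem) simp
  then show ?thesis by (simp add: nbhd_def)
qed

lemma is_coloring_cong:
  assumes "\<And>v. v \<in> grid d \<Longrightarrow> l v = l' v"
  shows "is_coloring d L l \<longleftrightarrow> is_coloring d L l'"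
proof -
  have "nbhd d l v (radius L) = nbhd d l' v (radius L)" if "v \<in> grid d" for v
    unfolding nbhd_def using assms that by (intro restrict_ext) (auto intro: grid_add gball_grid)
  then show ?thesis by (simp add: is_coloring_def)
qed

lemma derandomization_imp_log_star:
  assumes der: "derandomization d r L A p" and L: "is_lcl d L" and d: "0 < d" and r: "0 < r"
  shows "L \<in> ULOCAL_O d (\<lambda>\<epsilon>. real (log_star (1 / \<epsilon>)))"
proof (cases "in_labels L = {}")
  \<comment> \<open>Without input labels no ball can be labelled, all suprema are 0, and the given
    algorithm already has the required complexity.\<close>
  case True
  have "solves d A L" using der by (simp add: derandomization_def)
  moreover have "gball d 0 n \<rightarrow>\<^sub>E in_labels L = {}" for n
    using True by (auto simp: PiE_eq_empty_iff intro!: zero_in_gball)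
  then have "has_uniform_complexity d (in_labels L) A (\<lambda>\<epsilon>. 1 * real (log_star (1 / \<epsilon>)))"
    by (auto simp: has_uniform_complexity_def prob_radius_gt_def bot_ennreal intro!: exI[of _ 1])
  ultimately show ?thesis using L unfolding ULOCAL_O_def ULOCAL_def by (intro UN_I[of 1]) auto
next
  case False
  then obtain i where i: "i \<in> in_labels L" by blast
  interpret derandomization d r L A p by (rule der)
  \<comment> \<open>These are the differences across which \<open>local_solution\<close> needs
    distinct colours; greedy colouring then uses at most \<open>Suc (card N)\<close>
    colours.\<close>
  define N where "N = cube d (16 * r) - {0}"
  have "(gen 0 :: vertex) \<in> cube d (16 * r)" using d r by (auto simp: cube_def gen_def grid_def)
  moreover have "gen 0 \<noteq> (0 :: vertex)" by (simp add: gen_def fun_eq_iff)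
  ultimately have "N \<noteq> {}" by (auto simp: N_def)
  moreover have "- s \<in> N" if "s \<in> N" for s
    using that cube_uminus by (auto simp: N_def)
  ultimately obtain a b R where "reduction d (16 * r) N a b R"
    using reduction_exists[of N d "16 * r"] by (auto simp: N_def)
  then interpret reduction d "16 * r" N a b R .
  obtain \<Phi> :: "(vertex \<Rightarrow> nat \<times> nat) \<Rightarrow> vertex \<Rightarrow> nat" where loc: "local_rule d \<Phi>" and
    sol: "\<And>\<sigma> \<kappa>. \<sigma> \<in> grid d \<rightarrow> in_labels L \<Longrightarrow>
      (\<forall>u\<in>grid d. \<forall>v\<in>grid d. v - u \<in> cube d (16 * r) \<longrightarrow> \<kappa> u = \<kappa> v \<longrightarrow> u = v) \<Longrightarrow>
      (\<forall>v\<in>grid d. \<kappa> v < Suc (card N)) \<Longrightarrow> is_coloring d L (\<lambda>v. (\<sigma> v, \<Phi> (\<lambda>v. (\<sigma> v, \<kappa> v)) v))"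
    using local_solution[OF i, of "Suc (card N)"] by blast
  obtain \<rho> where \<rho>: "\<And>l l' v v'. v \<in> grid d \<Longrightarrow> v' \<in> grid d \<Longrightarrow> agree d \<rho> l v l' v' \<Longrightarrow> \<Phi> l v = \<Phi> l' v'"
    using loc by (rule local_ruleE) blast
  have ae: "AE x in random_labels d. x \<in> space (random_labels d) \<and>
      is_coloring d L (\<lambda>v. (\<sigma> v, \<Phi> (\<lambda>v. (\<sigma> v, color x v)) v))"
    if \<sigma>: "\<sigma> \<in> grid d \<rightarrow> in_labels L" for \<sigma>
    using AE_space AE_color_proper
  proof eventually_elim
    case (elim x)
    have "u = v" if "u \<in> grid d" "v \<in> grid d" "v - u \<in> cube d (16 * r)" "color x u = color x v" for u v
    proof (rule ccontr)
      assume "u \<noteq> v"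
      then have "v - u \<in> N" using that by (simp add: N_def)
      then have "color x u \<noteq> color x (u + (v - u))" using elim that(1) by blast
      then show False using that(4) by simp
    qed
    then show ?case using elim(1) color_le by (intro conjI sol[OF \<sigma>]) (auto simp: less_Suc_eq_le)
  qed
  \<comment> \<open>An output label exists because an almost sure event is nonempty, so a constant
    input has some colouring.\<close>
  obtain z where z: "z \<in> out_labels L"
  proof -
    have "(\<lambda>_. i) \<in> grid d \<rightarrow> in_labels L" using i by simp
    from eventually_happens'[OF random_labels.ae_filter_bot ae[OF this]]
    obtain x where "is_coloring d L (\<lambda>v. (i, \<Phi> (\<lambda>v. (i, color x v)) v))" by blast
    from coloring_out_label[OF L this grid_zero] show thesis by (rule that)
  qed
  let ?A = "colored_alg (in_labels L) (out_labels L) z \<rho> \<Phi>"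
  have "solves d ?A L"
    unfolding solves_def
  proof (intro conjI ballI)
    show "is_uniform_alg d (in_labels L) (out_labels L) ?A" by (rule is_uniform_colored_alg[where \<Phi> = \<Phi>, OF \<rho> z])
    fix \<sigma> assume \<sigma>: "\<sigma> \<in> grid d \<rightarrow> in_labels L"
    show "AE x in random_labels d. (\<forall>v\<in>grid d. coding_radius d ?A \<sigma> x v < \<infinity>) \<and>
        is_coloring d L (\<lambda>v. (\<sigma> v, output_label d ?A \<sigma> x v))"
      using ae[OF \<sigma>]
    proof eventually_elim
      case (elim x)
      have "output_label d ?A \<sigma> x v = \<Phi> (\<lambda>v. (\<sigma> v, color x v)) v" if v: "v \<in> grid d" for v
        by (rule colored_alg_output(2)[where \<Phi> = \<Phi>, OF \<rho> v \<sigma> conjunct1[OF elim] coloring_out_label[OF L conjunct2[OF elim] v]])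
      then have "is_coloring d L (\<lambda>v. (\<sigma> v, output_label d ?A \<sigma> x v)) \<longleftrightarrow>
          is_coloring d L (\<lambda>v. (\<sigma> v, \<Phi> (\<lambda>v. (\<sigma> v, color x v)) v))"
        by (intro is_coloring_cong) simp
      then show ?case
        using elim colored_alg_output(1)[where \<Phi> = \<Phi>, OF \<rho> _ \<sigma> conjunct1[OF elim]] by blast
    qed
  qed
  moreover obtain C where "0 < C" "has_uniform_complexity d (in_labels L) ?A (\<lambda>\<epsilon>. C * real (log_star (1 / \<epsilon>)))"
    using colored_alg_complexity[where \<Phi> = \<Phi>, OF \<rho> i] by blast
  ultimately show ?thesis using L unfolding ULOCAL_O_def ULOCAL_def by blast
qed

text \<open>Half of the bound on \<open>p\<close> in \<open>p_small\<close>, which makes the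
  inequality there strict.\<close>

definition threshold :: "nat \<Rightarrow> real" where
  "threshold d = 1 / (2 * real (16 ^ d) ^ (16 ^ d))"

text \<open>Only one radius enters, so in every dimension the task is to find a single
  \<open>r\<close> at which the tail times the bound on skeleton vertices stays below
  \<open>threshold d\<close>.\<close>

lemma log_star_if_rarely_late:
  assumes L: "is_lcl d L" and A: "solves d A L" and d: "0 < d" and r: "0 < r" "radius L \<le> r"
    and \<eta>: "0 \<le> \<eta>" "prob_radius_gt d (in_labels L) A (real r) \<le> ennreal \<eta>"
    and small: "real (12 ^ d * (4 * radius L * d * (2 * r + 4 * radius L + 1) ^ (d - 1))) * \<eta> \<le> threshold d"
  shows "L \<in> ULOCAL_O d (\<lambda>\<epsilon>. real (log_star (1 / \<epsilon>)))"
proof (rule derandomization_imp_log_star[OF _ L d r(1)])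
  show "derandomization d r L A (threshold d)"
  proof
    show "solves d A L" "radius L \<le> r" by fact+
    show "0 < threshold d" by (simp add: threshold_def)
    show "threshold d * real (16 ^ d) ^ 16 ^ d < 1" by (simp add: threshold_def)
    fix \<sigma> v assume \<sigma>: "\<sigma> \<in> grid d \<rightarrow> in_labels L" and v: "v \<in> grid d"
    have "is_uniform_alg d (in_labels L) (out_labels L) A" using A by (simp add: solves_def)
    from order_trans[OF prob_early_output_None[OF this v \<sigma>] \<eta>(2)]
    have "measure (random_labels d) {x \<in> space (random_labels d). early_output d A r \<sigma> x v = None} \<le> \<eta>"
      using \<eta>(1) by (simp add: random_labels.emeasure_eq_measure)
    then show "real (12 ^ d * (4 * radius L * d * (2 * r + 4 * radius L + 1) ^ (d - 1))) *
        measure (random_labels d) {x \<in> space (random_labels d). early_output d A r \<sigma> x v = None} \<le> threshold d"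
      by (intro order_trans[OF mult_left_mono small]) auto
  qed
qed

text \<open>Compactness: otherwise Koenig's lemma gives one input labelling whose coding radius is
  infinite with positive probability.\<close>

lemma late_probability_small:
  assumes L: "is_lcl d L" and A: "solves d A L" and \<eta>: "0 < \<eta>"
  shows "\<exists>r\<ge>m. prob_radius_gt d (in_labels L) A (real r) \<le> ennreal \<eta>"
proof (rule ccontr)
  let ?M = "random_labels d" and ?S = "in_labels L"
  define late where "late s \<tau> = {x \<in> space ?M. ereal_of_enat (coding_radius d A \<tau> x 0) > ereal (real s)}" for s \<tau>
  define bad where "bad s \<tau> \<longleftrightarrow> \<tau> \<in> gball d 0 s \<rightarrow>\<^sub>E ?S \<and> ennreal \<eta> < emeasure ?M (late s \<tau>)" for s \<tau>
  assume "\<not> ?thesis"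
  then have neg: "ennreal \<eta> < prob_radius_gt d ?S A (real r)" if "m \<le> r" for r
    using that by (meson not_le)
  have ex_m: "\<exists>\<tau>. bad r \<tau>" if "m \<le> r" for r
    using neg[OF that] by (auto simp: prob_radius_gt_def less_SUP_iff bad_def late_def)
  have alg: "is_uniform_alg d ?S (out_labels L) A" using A by (simp add: solves_def)
  have late_meas: "late s \<sigma> \<in> sets ?M" if "\<And>u. u \<in> gball d 0 s \<Longrightarrow> \<sigma> u \<in> ?S" for s \<sigma>
    unfolding late_def by (rule coding_radius_gt_measurable[OF alg grid_zero]) (use that in simp)
  have late_restrict: "late s (restrict \<sigma> (gball d 0 s)) = late s \<sigma>" for s \<sigma>
  proof -
    have "nbhd d (restrict \<sigma> (gball d 0 s)) 0 n = nbhd d \<sigma> 0 n" if "n \<le> s" for n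
      using gball_mono[OF that, of d 0] unfolding nbhd_def by (intro restrict_ext) auto
    then show ?thesis by (auto simp: late_def coding_radius_gt_iff explored_def)
  qed
  have late_mono: "late r \<sigma> \<subseteq> late s \<sigma>" if "s \<le> r" for r s \<sigma>
    using that by (force simp: late_def coding_radius_gt_iff)
  have bad_restrict: "bad s (restrict \<sigma> (gball d 0 s))" if bad: "bad r \<sigma>" and "s \<le> r" for r s \<sigma>
  proof -
    have sub: "gball d 0 s \<subseteq> gball d 0 r" by (rule gball_mono) fact
    have mem: "\<sigma> u \<in> ?S" if "u \<in> gball d 0 s" for u using bad sub that by (auto simp: bad_def)
    have "ennreal \<eta> < emeasure ?M (late r \<sigma>)" using bad by (simp add: bad_def)
    also have "\<dots> \<le> emeasure ?M (late s \<sigma>)"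
      by (intro emeasure_mono late_mono late_meas mem) fact
    finally show ?thesis using mem by (auto simp: bad_def late_restrict)
  qed
  have ex: "\<exists>\<tau>. bad r \<tau>" for r
    using ex_m[of "max m r"] bad_restrict[of "max m r" _ r] by fastforce
  \<comment> \<open>The nodes of the Koenig tree that are restrictions of bad labellings of every
    larger radius; each level is finite because the label set is.\<close>
  define extendable where "extendable s \<tau> \<longleftrightarrow> \<tau> \<in> gball d 0 s \<rightarrow>\<^sub>E ?S \<and>
    (\<forall>r\<ge>s. \<exists>\<sigma>. bad r \<sigma> \<and> restrict \<sigma> (gball d 0 s) = \<tau>)" for s \<tau>
  have fin: "finite (gball d 0 s \<rightarrow>\<^sub>E ?S)" for s
    using L by (intro finite_PiE) (auto simp: is_lcl_def)
  \<comment> \<open>the pigeonhole step of Koenig's lemma\<close>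
  have pigeon: "\<exists>\<tau>. extendable s \<tau> \<and> P \<tau>"
    if P: "\<And>r. s \<le> r \<Longrightarrow> \<exists>\<sigma>. bad r \<sigma> \<and> P (restrict \<sigma> (gball d 0 s))" for s P
  proof (rule ccontr)
    assume neg: "\<not> ?thesis"
    let ?F = "{\<tau> \<in> gball d 0 s \<rightarrow>\<^sub>E ?S. P \<tau>}"
    have "\<forall>\<tau>\<in>?F. \<exists>r\<ge>s. \<not> (\<exists>\<sigma>. bad r \<sigma> \<and> restrict \<sigma> (gball d 0 s) = \<tau>)"
      using neg by (auto simp: extendable_def)
    from bchoice[OF this]
    obtain f where f: "\<And>\<tau>. \<tau> \<in> ?F \<Longrightarrow> s \<le> f \<tau> \<and> \<not> (\<exists>\<sigma>. bad (f \<tau>) \<sigma> \<and> restrict \<sigma> (gball d 0 s) = \<tau>)"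
      by blast
    define r where "r = Max (insert s (f ` ?F))"
    have finF: "finite ?F" using fin[of s] by simp
    have r: "s \<le> r" "\<And>\<tau>. \<tau> \<in> ?F \<Longrightarrow> f \<tau> \<le> r" unfolding r_def using finF by (auto intro!: Max_ge)
    obtain \<sigma> where \<sigma>: "bad r \<sigma>" "P (restrict \<sigma> (gball d 0 s))" using P[OF r(1)] by blast
    let ?\<tau> = "restrict \<sigma> (gball d 0 s)"
    have mem: "?\<tau> \<in> ?F" using bad_restrict[OF \<sigma>(1) r(1)] \<sigma>(2) by (simp add: bad_def)
    have "gball d 0 s \<subseteq> gball d 0 (f ?\<tau>)" using f[OF mem] by (intro gball_mono) simp
    then have "restrict (restrict \<sigma> (gball d 0 (f ?\<tau>))) (gball d 0 s) = ?\<tau>" by (simp add: Int_absorb1)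
    then show False using f[OF mem] bad_restrict[OF \<sigma>(1) r(2)[OF mem]] by blast
  qed
  have "\<exists>\<tau>. \<forall>s. extendable s (\<tau> s) \<and> restrict (\<tau> (Suc s)) (gball d 0 s) = \<tau> s"
  proof (rule dependent_nat_choice)
    show "\<exists>\<tau>. extendable 0 \<tau>" using pigeon[of 0 "\<lambda>_. True"] ex by blast
    fix \<tau> s assume \<tau>: "extendable s \<tau>"
    show "\<exists>\<tau>'. extendable (Suc s) \<tau>' \<and> restrict \<tau>' (gball d 0 s) = \<tau>"
    proof (rule pigeon)
      fix r assume r: "Suc s \<le> r"
      then obtain \<sigma> where "bad r \<sigma>" "restrict \<sigma> (gball d 0 s) = \<tau>"
        using \<tau> by (auto simp: extendable_def dest: Suc_leD)
      then show "\<exists>\<sigma>. bad r \<sigma> \<and> restrict (restrict \<sigma> (gball d 0 (Suc s))) (gball d 0 s) = \<tau>"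
        using gball_mono[of s "Suc s" d 0] by (intro exI[of _ \<sigma>]) (simp add: Int_absorb1)
    qed
  qed
  then obtain \<tau> where \<tau>: "\<And>s. extendable s (\<tau> s)" "\<And>s. restrict (\<tau> (Suc s)) (gball d 0 s) = \<tau> s" by blast
  have \<tau>_eq: "\<tau> (s + n) u = \<tau> s u" if "u \<in> gball d 0 s" for s n u
  proof (induction n)
    case (Suc n)
    have "u \<in> gball d 0 (s + n)" using that gball_mono[of s "s + n" d 0] by auto
    then show ?case using fun_cong[OF \<tau>(2)[of "s + n"], of u] Suc by simp
  qed simp
  define \<sigma> where "\<sigma> u = \<tau> (gdist d 0 u) u" for u
  have \<sigma>_eq: "\<sigma> u = \<tau> s u" if "u \<in> gball d 0 s" for s u
    using \<tau>_eq[of u "gdist d 0 u" "s - gdist d 0 u"] that by (simp add: \<sigma>_def gball_def)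
  have \<sigma>: "\<sigma> \<in> grid d \<rightarrow> ?S"
  proof
    fix u assume "u \<in> grid d"
    then have "u \<in> gball d 0 (gdist d 0 u)" by (simp add: gball_def)
    then show "\<sigma> u \<in> ?S" using \<tau>(1)[of "gdist d 0 u"] by (auto simp: \<sigma>_def extendable_def)
  qed
  have late_large: "ennreal \<eta> < emeasure ?M (late s \<sigma>)" for s
  proof -
    have mem: "\<tau> s \<in> gball d 0 s \<rightarrow>\<^sub>E ?S" using \<tau>(1)[of s] by (simp add: extendable_def)
    have "restrict \<sigma> (gball d 0 s) = \<tau> s"
      using mem by (auto simp: fun_eq_iff restrict_def \<sigma>_eq PiE_iff extensional_def)
    moreover obtain \<sigma>' where "bad s \<sigma>'" "restrict \<sigma>' (gball d 0 s) = \<tau> s"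
      using \<tau>(1)[of s] by (auto simp: extendable_def)
    ultimately show ?thesis using late_restrict[of s \<sigma>] late_restrict[of s \<sigma>'] by (simp add: bad_def)
  qed
  have meas: "late s \<sigma> \<in> sets ?M" for s
    using \<sigma> by (intro late_meas) (auto dest: gball_grid)
  \<comment> \<open>The events decrease, so their intersection, on which the coding radius is
    infinite, still has probability at least \<open>\<eta>\<close>.\<close>
  have "(\<lambda>s. emeasure ?M (late s \<sigma>)) \<longlonglongrightarrow> emeasure ?M (\<Inter>s. late s \<sigma>)"
  proof (rule Lim_emeasure_decseq)
    show "range (\<lambda>s. late s \<sigma>) \<subseteq> sets ?M" using meas by blast
    show "decseq (\<lambda>s. late s \<sigma>)" using late_mono by (simp add: decseq_def)
  qed simp
  then have large: "ennreal \<eta> \<le> emeasure ?M (\<Inter>s. late s \<sigma>)"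
    by (rule LIMSEQ_le_const) (use late_large less_imp_le in blast)
  have "AE x in ?M. coding_radius d A \<sigma> x 0 < \<infinity>"
    using A \<sigma> unfolding solves_def by (fastforce elim: AE_mp)
  then have "AE x in ?M. x \<notin> (\<Inter>s. late s \<sigma>)"
  proof eventually_elim
    case (elim x)
    then obtain n where "coding_radius d A \<sigma> x 0 = enat n" by auto
    then have "x \<notin> late n \<sigma>" by (simp add: late_def)
    then show ?case by blast
  qed
  moreover have "(\<Inter>s. late s \<sigma>) \<in> sets ?M" using meas by (intro sets.countable_INT) auto
  ultimately have "emeasure ?M (\<Inter>s. late s \<sigma>) = 0" using AE_iff_null_sets null_setsD1 by blast
  then show False using large \<eta> by simp
qed

text \<open>For \<open>\<epsilon> = (C / r) ^ (d - 1)\<close> the radius in the assumption is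
  exactly \<open>r\<close>, and \<open>\<epsilon>\<close> times the growth
  \<open>r ^ (d - 1)\<close> of the skeleton is \<open>C ^ (d - 1)\<close>. The choice of
  \<open>C\<close> thus works at every scale \<open>r\<close>.\<close>

lemma log_star_if_root_tail:
  assumes d: "2 \<le> d"
  shows "\<exists>C>0. \<forall>L. is_lcl d L \<and> radius L = t \<and>
    (\<exists>A. solves d A L \<and> (\<exists>\<epsilon>0>0. \<forall>\<epsilon>. 0 < \<epsilon> \<and> \<epsilon> \<le> \<epsilon>0 \<longrightarrow>
      prob_radius_gt d (in_labels L) A (C * root (d - 1) (1 / \<epsilon>)) < ennreal \<epsilon>)) \<longrightarrow>
    L \<in> ULOCAL_O d (\<lambda>\<epsilon>. real (log_star (1 / \<epsilon>)))"
proof -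
  \<comment> \<open>The 7 comes from \<open>2 * r + 4 * t + 1 \<le> 7 * r\<close> for
    \<open>r\<close> at least 1 and \<open>t\<close>. In \<open>C\<close>, the bound 1 gives
    \<open>C ^ (d - 1) \<le> C\<close>, and \<open>K + 1\<close> avoids a division by 0 for
    \<open>t = 0\<close>.\<close>
  define K where "K = real (12 ^ d * (4 * t * d * 7 ^ (d - 1)))"
  define C where "C = min 1 (threshold d / (K + 1))"
  have thr: "0 < threshold d" by (simp add: threshold_def)
  have K: "0 \<le> K" by (simp add: K_def)
  have C: "0 < C" "C \<le> 1" "K * C \<le> threshold d"
  proof -
    show "0 < C" "C \<le> 1" using thr K by (simp_all add: C_def)
    have "K * C \<le> (K + 1) * (threshold d / (K + 1))"
      using K thr by (intro mult_mono) (auto simp: C_def)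
    then show "K * C \<le> threshold d" using K by simp
  qed
  show ?thesis
  proof (intro exI[of _ C] conjI allI impI C(1))
    fix L assume "is_lcl d L \<and> radius L = t \<and>
      (\<exists>A. solves d A L \<and> (\<exists>\<epsilon>0>0. \<forall>\<epsilon>. 0 < \<epsilon> \<and> \<epsilon> \<le> \<epsilon>0 \<longrightarrow>
        prob_radius_gt d (in_labels L) A (C * root (d - 1) (1 / \<epsilon>)) < ennreal \<epsilon>))"
    then obtain A \<epsilon>0 where L: "is_lcl d L" "radius L = t" and A: "solves d A L" and \<epsilon>0: "0 < \<epsilon>0"
      and tail: "\<And>\<epsilon>. 0 < \<epsilon> \<Longrightarrow> \<epsilon> \<le> \<epsilon>0 \<Longrightarrow> prob_radius_gt d (in_labels L) A (C * root (d - 1) (1 / \<epsilon>)) < ennreal \<epsilon>"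
      by blast
    \<comment> \<open>The term \<open>C / \<epsilon>0\<close> yields
      \<open>\<epsilon> \<le> C / r \<le> \<epsilon>0\<close>, so the tail assumption applies to
      \<open>\<epsilon>\<close>.\<close>
    define r where "r = max (max 1 t) (nat \<lceil>C / \<epsilon>0\<rceil>)"
    define \<epsilon> where "\<epsilon> = (C / real r) ^ (d - 1)"
    have r: "0 < r" "t \<le> r" "C / \<epsilon>0 \<le> real r"
      using real_nat_ceiling_ge[of "C / \<epsilon>0"] by (auto simp: r_def)
    have Cr: "0 < C / real r" "C / real r \<le> 1" using C r(1) by (auto simp: divide_simps)
    have \<epsilon>: "0 < \<epsilon>" using Cr by (simp add: \<epsilon>_def)
    have "\<epsilon> \<le> C / real r"
      unfolding \<epsilon>_def using Cr d power_decreasing[of 1 "d - 1" "C / real r"] by simp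
    also have "\<dots> \<le> \<epsilon>0" using r(1,3) \<epsilon>0 by (simp add: field_simps)
    finally have "\<epsilon> \<le> \<epsilon>0" .
    have "root (d - 1) (1 / \<epsilon>) = root (d - 1) ((real r / C) ^ (d - 1))"
      by (simp add: \<epsilon>_def power_divide)
    also have "\<dots> = real r / C" using d C r by (intro real_root_power_cancel) auto
    finally have "C * root (d - 1) (1 / \<epsilon>) = real r" using C by simp
    then have late: "prob_radius_gt d (in_labels L) A (real r) \<le> ennreal \<epsilon>"
      using tail[OF \<epsilon> \<open>\<epsilon> \<le> \<epsilon>0\<close>] by simp
    have "real (12 ^ d * (4 * t * d * (2 * r + 4 * t + 1) ^ (d - 1))) * \<epsilon>
        \<le> real (12 ^ d * (4 * t * d * (7 * r) ^ (d - 1))) * \<epsilon>"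
    proof (intro mult_right_mono)
      have "(2 * r + 4 * t + 1) ^ (d - 1) \<le> (7 * r) ^ (d - 1)"
        using r by (intro power_mono) auto
      then show "real (12 ^ d * (4 * t * d * (2 * r + 4 * t + 1) ^ (d - 1)))
          \<le> real (12 ^ d * (4 * t * d * (7 * r) ^ (d - 1)))"
        unfolding of_nat_le_iff by (intro mult_left_mono) auto
    qed (use \<epsilon> in simp)
    also have "\<dots> = K * (real r * (C / real r)) ^ (d - 1)"
      by (simp only: K_def \<epsilon>_def power_mult_distrib of_nat_mult of_nat_power mult.assoc)
    also have "real r * (C / real r) = C" using r(1) by simp
    also have "K * C ^ (d - 1) \<le> K * C"
      using power_decreasing[of 1 "d - 1" C] d C K by (intro mult_left_mono) auto
    also have "\<dots> \<le> threshold d" by (rule C(3))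
    finally show "L \<in> ULOCAL_O d (\<lambda>\<epsilon>. real (log_star (1 / \<epsilon>)))"
      using L d r \<epsilon> late by (intro log_star_if_rarely_late[OF L(1) A, where r = r and \<eta> = \<epsilon>]) auto
  qed
qed

text \<open>On the line at most 12 * 4 * \<open>radius L\<close> skeleton vertices lie near a net
  point, independently of \<open>r\<close>. A fixed small tail is therefore enough, and compactness
  provides a radius that attains it.\<close>

lemma log_star_on_line:
  assumes L: "is_lcl 1 L" and A: "solves 1 A L"
  shows "L \<in> ULOCAL_O 1 (\<lambda>\<epsilon>. real (log_star (1 / \<epsilon>)))"
proof -
  define \<eta> where "\<eta> = threshold 1 / (48 * real (radius L) + 1)"
  have \<eta>: "0 < \<eta>" by (simp add: \<eta>_def threshold_def divide_pos_pos add_nonneg_pos)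
  obtain r where r: "max 1 (radius L) \<le> r" "prob_radius_gt 1 (in_labels L) A (real r) \<le> ennreal \<eta>"
    using late_probability_small[OF L A \<eta>] by blast
  have "48 * real (radius L) * \<eta> \<le> (48 * real (radius L) + 1) * \<eta>" using \<eta> by (intro mult_right_mono) auto
  also have "\<dots> = threshold 1" by (simp add: \<eta>_def add_nonneg_eq_0_iff)
  finally show ?thesis
    using r \<eta> by (intro log_star_if_rarely_late[OF L A, where r = r and \<eta> = \<eta>]) auto
qed

theorem theorem3p4:
  shows "(\<forall>d t :: nat. d \<ge> 2 \<longrightarrow>
           (\<exists>C :: real. C > 0 \<and>
             (\<forall>L. is_lcl d L \<and> radius L = t \<and>
                (\<exists>A. solves d A L \<and>
                   (\<exists>\<epsilon>0 > 0. \<forall>\<epsilon>. 0 < \<epsilon> \<and> \<epsilon> \<le> \<epsilon>0 \<longrightarrow>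
                      prob_radius_gt d (in_labels L) A (C * root (d - 1) (1 / \<epsilon>)) < ennreal \<epsilon>))
                \<longrightarrow> L \<in> ULOCAL_O d (\<lambda>\<epsilon>. real (log_star (1 / \<epsilon>)))))) \<and>
         ffiid 1 = ULOCAL_O 1 (\<lambda>\<epsilon>. real (log_star (1 / \<epsilon>))) \<and>
         (\<forall>L. is_lcl 1 L \<and> (\<exists>A. solves 1 A L) \<longrightarrow>
                L \<in> ULOCAL_O 1 (\<lambda>\<epsilon>. real (log_star (1 / \<epsilon>))))"
proof (intro conjI)
  show "ffiid 1 = ULOCAL_O 1 (\<lambda>\<epsilon>. real (log_star (1 / \<epsilon>)))"
  proof
    show "ffiid 1 \<subseteq> ULOCAL_O 1 (\<lambda>\<epsilon>. real (log_star (1 / \<epsilon>)))"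
      using log_star_on_line unfolding ffiid_def ULOCAL_def by blast
    show "ULOCAL_O 1 (\<lambda>\<epsilon>. real (log_star (1 / \<epsilon>))) \<subseteq> ffiid 1"
      unfolding ffiid_def ULOCAL_O_def by blast
  qed
qed (use log_star_if_root_tail log_star_on_line in \<open>blast+\<close>)

end
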